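(* For $\xi=(\xi_1,\xi_2)\in\mathbb{R}^2$ let $P_m(\xi)=\xi_1\xi_2+h_m(\xi_1)$, where $h_m(\xi_1)=\frac1m\xi_1^m$ if $m\in\mathbb{N}^+$, and $h_m(\xi_1)=\frac1m|\xi_1|^m$ if $1<m<2$. (1) For each $m\in\mathbb{N}^+$, each $s>1/2$ and every $f\in H^s(\mathbb{R}^2)$, $$\Big\|\sup_{0<t<1}|e^{itP_m(D)}f|\Big\|_{L^2(B(0,1))}\lesssim\|f\|_{H^s(\mathbb{R}^2)}.$$ (2) Let $1<m<2$. For each $s>\frac12$ and every $f\in H^s(\mathbb{R}^2)$, $$\Big\|\sup_{0<t<1}|e^{itP_m(D)}f|\Big\|_{L^2(B(0,1))}\lesssim\|f\|_{H^s(\mathbb{R}^2)}.$$ Moreover, for each $s<\frac12$ there exist, for all sufficiently large $R$, functions $f=f_R\in L^2(\mathbb{R}^2)$ with $\hat f_R$ supported in the annulus $\{\xi\in\mathbb{R}^2:|\xi|\sim R\}$, such that $$\lim_{R\to+\infty}\frac{R^{-s}\,\big\|\sup_{0<t<1}|e^{itP_m(D)}f_R|\big\|_{L^1(B(0,1))}}{\|f_R\|_{L^2(\mathbb{R}^2)}}=+\infty.$$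
   Context: For a real continuous function $P$ on $\mathbb{R}^2$, the operator $e^{itP(D)}$ is given (formally) by $$e^{itP(D)}f(x)=\int_{\mathbb{R}^2}e^{ix\cdot\xi+itP(\xi)}\hat f(\xi)\,d\xi,$$ where $\hat f$ is the Fourier transform of $f$, normalised so that $f(x)=\int_{\mathbb{R}^2}e^{ix\cdot\xi}\hat f(\xi)\,d\xi$. $H^s(\mathbb{R}^2)$ is the usual $L^2$-based inhomogeneous Sobolev space, and $B(0,1)$ is the unit ball of $\mathbb{R}^2$ centred at $0$. $\mathbb{N}^+$ is the set of positive integers. $A\lesssim B$ means $A\le CB$ with $C$ independent of $f$ (it may depend on $s$ and $m$). $|\xi|\sim R$ means $c_1R\le|\xi|\le c_2R$ for absolute constants $0<c_1<c_2$ independent of $R$. *)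

theory Defs
  imports "HOL-Analysis.Analysis"
begin

section \<open>Square-integrable functions on the plane\<close>

definition ennsqrt :: "ennreal \<Rightarrow> ennreal" where
  "ennsqrt a = (if a = top then top else ennreal (sqrt (enn2real a)))"

definition L2_norm_on :: "(real^2) set \<Rightarrow> (real^2 \<Rightarrow> ennreal) \<Rightarrow> ennreal" where
  "L2_norm_on A F = ennsqrt (\<integral>\<^sup>+ x\<in>A. (F x)\<^sup>2 \<partial>lborel)"

definition L1_norm_on :: "(real^2) set \<Rightarrow> (real^2 \<Rightarrow> ennreal) \<Rightarrow> ennreal" where
  "L1_norm_on A F = (\<integral>\<^sup>+ x\<in>A. F x \<partial>lborel)"

definition L2_norm :: "(real^2 \<Rightarrow> complex) \<Rightarrow> ennreal" where
  "L2_norm f = L2_norm_on UNIV (\<lambda>x. ennreal (cmod (f x)))"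

definition in_L2 :: "(real^2 \<Rightarrow> complex) \<Rightarrow> bool" where
  "in_L2 f \<longleftrightarrow> f \<in> borel_measurable lborel \<and> L2_norm f < top"


section \<open>Fourier transform and Sobolev spaces\<close>

text \<open>The integral of \<open>K x y\<close> over \<open>y\<close> need not converge absolutely when \<open>K\<close> is an
  oscillating exponential times an \<open>L\<^sup>2\<close> function of \<open>y\<close>.  As usual in Plancherel theory, it is
  read as the limit, in \<open>L\<^sup>2\<close> with respect to \<open>x\<close>, of the integrals over large discs.\<close>

definition has_L2_integral ::
    "(real^2 \<Rightarrow> real^2 \<Rightarrow> complex) \<Rightarrow> (real^2 \<Rightarrow> complex) \<Rightarrow> bool" where
  "has_L2_integral K F \<longleftrightarrow> in_L2 F \<and>
     ((\<lambda>r. L2_norm (\<lambda>x. F x - (LINT y:cball 0 r|lborel. K x y))) \<longlongrightarrow> 0) at_top"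

text \<open>The factor \<open>(2\<pi>)\<^sup>-\<^sup>2\<close> normalises the transform so that inversion reads
  \<open>f(x) = \<integral> e\<^bsup>ix\<cdot>\<xi>\<^esup> fourier f \<xi> d\<xi>\<close>.  The transform is determined up to a null set.\<close>

definition is_fourier :: "(real^2 \<Rightarrow> complex) \<Rightarrow> (real^2 \<Rightarrow> complex) \<Rightarrow> bool" where
  "is_fourier f g \<longleftrightarrow> has_L2_integral (\<lambda>\<xi> x. cis (- (x \<bullet> \<xi>)) * f x / (2 * pi)\<^sup>2) g"

definition fourier :: "(real^2 \<Rightarrow> complex) \<Rightarrow> real^2 \<Rightarrow> complex" where
  "fourier f = (SOME g. is_fourier f g)"

definition sobolev_norm :: "real \<Rightarrow> (real^2 \<Rightarrow> complex) \<Rightarrow> ennreal" where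
  "sobolev_norm s f = L2_norm (\<lambda>\<xi>. of_real ((1 + (norm \<xi>)\<^sup>2) powr (s / 2)) * fourier f \<xi>)"

text \<open>This is \<open>H\<^sup>s\<close> only for \<open>s \<ge> 0\<close>, where it is contained in \<open>L\<^sup>2\<close>.\<close>

definition in_sobolev :: "real \<Rightarrow> (real^2 \<Rightarrow> complex) \<Rightarrow> bool" where
  "in_sobolev s f \<longleftrightarrow> in_L2 f \<and> sobolev_norm s f < top"


section \<open>Dispersive evolution and its maximal function\<close>

text \<open>For each \<open>t\<close> the function \<open>e\<^bsup>itP(D)\<^esup> f\<close> is an element of \<open>L\<^sup>2\<close>, given only up to a null set
  that may depend on \<open>t\<close>, so a supremum over \<open>0 < t < 1\<close> is meaningful only once representatives
  are fixed.  They are fixed by asking for continuity in \<open>t\<close> for almost every \<open>x\<close>; lemma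
  \<open>is_evolution_unique\<close> below shows that this determines them, for almost every \<open>x\<close>,
  at all times simultaneously.  When \<open>fourier f\<close> is integrable, the absolutely convergent
  integral defines such a \<open>u\<close>.\<close>

definition is_evolution ::
    "(real^2 \<Rightarrow> real) \<Rightarrow> (real^2 \<Rightarrow> complex) \<Rightarrow> (real \<Rightarrow> real^2 \<Rightarrow> complex) \<Rightarrow> bool" where
  "is_evolution P f u \<longleftrightarrow>
     (\<forall>t\<in>{0<..<1}. has_L2_integral (\<lambda>x \<xi>. cis (x \<bullet> \<xi> + t * P \<xi>) * fourier f \<xi>) (u t)) \<and>
     (AE x in lborel. continuous_on {0<..<1} (\<lambda>t. u t x))"

text \<open>When \<open>t \<mapsto> u t x\<close> is continuous for almost every \<open>x\<close>, this agrees almost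
  everywhere with the supremum over rational \<open>t\<close>, which is Borel.  So the norms above, being
  built on \<open>nn_integral\<close> (which does not see null sets), give the Lebesgue norms of the
  supremum even if it fails to be Borel on a null set.\<close>

definition maximal :: "(real \<Rightarrow> real^2 \<Rightarrow> complex) \<Rightarrow> real^2 \<Rightarrow> ennreal" where
  "maximal u x = (SUP t\<in>{0<..<1}. ennreal (cmod (u t x)))"

definition phase :: "(real \<Rightarrow> real) \<Rightarrow> real^2 \<Rightarrow> real" where
  "phase h \<xi> = \<xi> $ 1 * \<xi> $ 2 + h (\<xi> $ 1)"

definition h_nat :: "nat \<Rightarrow> real \<Rightarrow> real" where
  "h_nat m y = 1 / real m * y ^ m"

definition h_real :: "real \<Rightarrow> real \<Rightarrow> real" where
  "h_real m y = 1 / m * \<bar>y\<bar> powr m"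


section \<open>Uniqueness of the evolution\<close>

lemma ennsqrt_squared: "(ennsqrt a)\<^sup>2 = a"
proof (cases "a = top")
  case True
  then show ?thesis by (simp add: ennsqrt_def power2_eq_square ennreal_mult_top)
next
  case False
  then show ?thesis
    by (simp add: ennsqrt_def ennreal_power less_top)
qed

lemma L2_norm_squared: "(L2_norm f)\<^sup>2 = (\<integral>\<^sup>+ x. ennreal ((cmod (f x))\<^sup>2) \<partial>lborel)"
  by (simp add: L2_norm_def L2_norm_on_def ennsqrt_squared ennreal_power)

lemma has_L2_integral_unique:
  assumes F: "has_L2_integral K F" and G: "has_L2_integral K G"
    and K: "case_prod K \<in> borel_measurable (lborel \<Otimes>\<^sub>M lborel)"
  shows "AE x in lborel. F x = G x"
proof -
  define S where "S r x = (LINT y:cball 0 r|lborel. K x y)" for r x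
  have [measurable]: "F \<in> borel_measurable lborel" "G \<in> borel_measurable lborel"
    using F G by (auto simp: has_L2_integral_def in_L2_def)
  have [measurable]: "S r \<in> borel_measurable lborel" for r
  proof -
    have "(\<lambda>z. indicator (cball 0 r) (snd z) *\<^sub>R case_prod K z)
        \<in> borel_measurable (lborel \<Otimes>\<^sub>M lborel)"
      using K by (intro borel_measurable_scaleR measurable_compose[OF measurable_snd]
          borel_measurable_indicator) auto
    then show ?thesis
      unfolding S_def set_lebesgue_integral_def
      by (intro lborel.borel_measurable_lebesgue_integral) (simp add: split_def)
  qed
  let ?N = "\<lambda>H. \<integral>\<^sup>+ x. ennreal ((cmod (H x))\<^sup>2) \<partial>lborel"
  have lim: "((\<lambda>r. ?N (\<lambda>x. H x - S r x)) \<longlongrightarrow> 0) at_top" if "has_L2_integral K H" for H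
  proof -
    have "((\<lambda>r. L2_norm (\<lambda>x. H x - S r x)) \<longlongrightarrow> 0) at_top"
      using that by (simp add: has_L2_integral_def S_def)
    then have "((\<lambda>r. L2_norm (\<lambda>x. H x - S r x) * L2_norm (\<lambda>x. H x - S r x)) \<longlongrightarrow> 0 * 0) at_top"
      by (intro tendsto_mult_ennreal) auto
    then show ?thesis
      by (simp add: L2_norm_squared flip: power2_eq_square)
  qed
  have le: "?N (\<lambda>x. F x - G x) \<le> 2 * ?N (\<lambda>x. F x - S r x) + 2 * ?N (\<lambda>x. G x - S r x)" for r
  proof -
    have pt: "(cmod (a - b))\<^sup>2 \<le> 2 * (cmod (a - c))\<^sup>2 + 2 * (cmod (b - c))\<^sup>2" for a b c
    proof -
      have "cmod (a - b) \<le> cmod (a - c) + cmod (b - c)"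
        using dist_triangle2[of a b c] by (simp add: dist_norm)
      then have "(cmod (a - b))\<^sup>2 \<le> (cmod (a - c) + cmod (b - c))\<^sup>2"
        by (intro power_mono) auto
      also have "\<dots> \<le> 2 * (cmod (a - c))\<^sup>2 + 2 * (cmod (b - c))\<^sup>2"
        using sum_squares_bound[of "cmod (a - c)" "cmod (b - c)"]
        by (simp add: power2_sum)
      finally show ?thesis .
    qed
    have "?N (\<lambda>x. F x - G x) \<le>
        (\<integral>\<^sup>+ x. 2 * ennreal ((cmod (F x - S r x))\<^sup>2) + 2 * ennreal ((cmod (G x - S r x))\<^sup>2) \<partial>lborel)"
    proof (rule nn_integral_mono)
      fix x
      have "ennreal ((cmod (F x - G x))\<^sup>2) \<le>
          ennreal (2 * (cmod (F x - S r x))\<^sup>2 + 2 * (cmod (G x - S r x))\<^sup>2)"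
        by (rule ennreal_leI, rule pt)
      also have "\<dots> = 2 * ennreal ((cmod (F x - S r x))\<^sup>2) + 2 * ennreal ((cmod (G x - S r x))\<^sup>2)"
        by (simp add: ennreal_mult')
      finally show "ennreal ((cmod (F x - G x))\<^sup>2) \<le>
          2 * ennreal ((cmod (F x - S r x))\<^sup>2) + 2 * ennreal ((cmod (G x - S r x))\<^sup>2)" .
    qed
    also have "\<dots> = 2 * ?N (\<lambda>x. F x - S r x) + 2 * ?N (\<lambda>x. G x - S r x)"
      by (simp add: nn_integral_add nn_integral_cmult)
    finally show ?thesis .
  qed
  have "((\<lambda>r. 2 * ?N (\<lambda>x. F x - S r x) + 2 * ?N (\<lambda>x. G x - S r x)) \<longlongrightarrow> 2 * 0 + 2 * 0) at_top"
    by (intro tendsto_add tendsto_mult_ennreal tendsto_const lim F G) auto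
  then have "?N (\<lambda>x. F x - G x) \<le> 2 * 0 + 2 * 0"
    by (rule tendsto_lowerbound) (use le in auto)
  then have "?N (\<lambda>x. F x - G x) = 0" by simp
  then show ?thesis
    by (subst (asm) nn_integral_0_iff_AE) auto
qed

lemma is_evolution_unique:
  assumes u: "is_evolution P f u" and v: "is_evolution P f v"
    and [measurable]: "P \<in> borel_measurable borel" "fourier f \<in> borel_measurable borel"
  shows "AE x in lborel. \<forall>t\<in>{0<..<1}. u t x = v t x"
proof -
  let ?Q = "\<rat> \<inter> {0<..<1::real}"
  have "AE x in lborel. u t x = v t x" if "t \<in> ?Q" for t
  proof (rule has_L2_integral_unique)
    show "has_L2_integral (\<lambda>x \<xi>. cis (x \<bullet> \<xi> + t * P \<xi>) * fourier f \<xi>) (u t)"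
         "has_L2_integral (\<lambda>x \<xi>. cis (x \<bullet> \<xi> + t * P \<xi>) * fourier f \<xi>) (v t)"
      using u v that by (auto simp: is_evolution_def)
    show "(\<lambda>(x, \<xi>). cis (x \<bullet> \<xi> + t * P \<xi>) * fourier f \<xi>)
        \<in> borel_measurable (lborel \<Otimes>\<^sub>M lborel)"
      unfolding cis_conv_exp by measurable
  qed
  then have "AE x in lborel. \<forall>t\<in>?Q. u t x = v t x"
    by (subst AE_ball_countable) (auto intro: countable_rat)
  moreover have "AE x in lborel. continuous_on {0<..<1} (\<lambda>t. u t x)"
                "AE x in lborel. continuous_on {0<..<1} (\<lambda>t. v t x)"
    using u v by (auto simp: is_evolution_def)
  ultimately show ?thesis
  proof eventually_elim
    case (elim x)
    show ?case
    proof
      fix t :: real assume t: "t \<in> {0<..<1}"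
      have "t \<in> closure ?Q"
        unfolding closure_approachable
      proof (intro allI impI)
        fix e :: real assume "e > 0"
        with t obtain q where "q \<in> \<rat>" "max 0 (t - e) < q" "q < t"
          using Rats_dense_in_real[of "max 0 (t - e)" t] by auto
        with t show "\<exists>y\<in>?Q. dist y t < e"
          by (intro bexI[of _ q]) (auto simp: dist_real_def)
      qed
      then obtain q where q: "\<And>n. q n \<in> ?Q" "q \<longlonglongrightarrow> t"
        unfolding closure_sequential by blast
      have q': "\<forall>\<^sub>F n in sequentially. q n \<in> {0<..<1}" using q(1) by simp
      have "(\<lambda>n. u (q n) x) \<longlonglongrightarrow> u t x"
        by (rule continuous_on_tendsto_compose[OF elim(2) q(2) t q'])
      moreover have "(\<lambda>n. v (q n) x) \<longlonglongrightarrow> v t x"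
        by (rule continuous_on_tendsto_compose[OF elim(3) q(2) t q'])
      moreover have "u (q n) x = v (q n) x" for n using elim(1) q(1) by blast
      ultimately show "u t x = v t x"
        using LIMSEQ_unique by simp
    qed
  qed
qed

end

theory Submission
  imports Defs "HOL-Probability.Characteristic_Functions"
begin

text \<open>Write \<open>g\<close> for the Fourier transform of the datum.  By Euler's identity the phase \<open>P\<close> is a
  combination of \<open>\<xi>\<^sub>1 \<partial>\<^sub>1 P\<close> and \<open>\<xi>\<^sub>2 \<partial>\<^sub>2 P\<close>, so that for \<open>\<bar>\<xi>\<^sub>1\<bar> > 1\<close> one of these products dominates
  \<open>P\<close>.  Freeze the space variable dual to the corresponding \<open>\<xi>\<^sub>j\<close> (for \<open>\<bar>\<xi>\<^sub>1\<bar> \<le> 1\<close>, freeze \<open>x\<^sub>1\<close>).  The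
  frequencies with \<open>k \<le> P < k + 1\<close> contribute a function whose modulus is bounded uniformly in
  \<open>0 < t < 1\<close> by a series free of \<open>t\<close>; Plancherel in the other space variable and Cauchy--Schwarz over
  the level sets of \<open>P\<close>, of length about \<open>1 / \<bar>\<partial>\<^sub>j P\<bar>\<close>, bound its square integral by the
  integral of \<open>\<bar>g\<bar>\<^sup>2 / \<bar>\<partial>\<^sub>j P\<bar>\<close>.  Summing over \<open>k\<close> costs a factor slightly larger than \<open>\<bar>P\<bar>\<close>, and
  \<open>\<bar>P\<bar> / \<bar>\<partial>\<^sub>j P\<bar>\<close> is at most a multiple of the length of \<open>\<xi>\<close>.  Applied to differences of truncated data,
  the estimate also shows that their evolutions converge uniformly in \<open>t\<close> almost everywhere.

  For \<open>s < 1/2\<close> let \<open>g\<close> be a bump on \<open>[R, R + 1/8] \<times> [0, R]\<close> and \<open>t = - x\<^sub>2 / R\<close>: the phase is then almost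
  constant on the support of \<open>g\<close>, so the maximal function exceeds a multiple of \<open>\<surd>R\<close> times the \<open>L\<^sup>2\<close>
  norm of the datum on a fixed set.\<close>

text \<open>The splitting of frequencies is forced by two obstacles.
  \<open>\<partial>\<^sub>1 P\<close> = \<open>\<xi>\<^sub>2 + h'(\<xi>\<^sub>1)\<close> can vanish;
  \<open>\<partial>\<^sub>2 P\<close> = \<open>\<xi>\<^sub>1\<close> cannot for
  \<open>\<bar>\<xi>\<^sub>1\<bar> > 1\<close>, but for large \<open>m\<close> the quotient of
  \<open>P\<close> by it may grow like the power m-1 of \<open>\<xi>\<^sub>1\<close>, beyond the
  length of \<open>\<xi>\<close>. This happens only where \<open>\<xi>\<^sub>2\<close> is small
  against that power, and there \<open>\<partial>\<^sub>1 P\<close> has the size of that power, so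
  the other quotient is of order \<open>\<xi>\<^sub>1\<close>. For m < 2 the second obstacle never
  arises.

  The bands are summed by weighted Cauchy--Schwarz alone, without orthogonality between them. The
  weights \<open>(1 + \<bar>k\<bar>) powr a\<close> need a > 1 for a convergent series, and the
  squared norm then loses slightly more than one derivative: this is the origin of s > 1/2.

  A general datum has no absolutely convergent evolution. The estimates are therefore proved for
  bounded transforms of bounded support, with constants depending on the radius of the disc only,
  and carried over by limits.

  In the counterexample \<open>fourier\<close> is a chosen mean-square limit, so the transform of
  the datum has to be identified by pointwise inversion. This is why the bump is made of
  tents.\<close>

lemma norm_cis_mult [simp]: "cmod (cis a * z) = cmod z"
  by (simp add: norm_mult)

lemma borel_measurable_cis [measurable]: "cis \<in> borel_measurable borel"
  by (intro borel_measurable_continuous_onI) (auto intro!: continuous_intros simp: cis_conv_exp)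

lemma borel_measurable_cnj [measurable]: "cnj \<in> borel_measurable borel"
  by (intro borel_measurable_continuous_onI continuous_intros)

text \<open>A function that is not integrable has Bochner integral 0, so the bound holds for every
  \<open>f\<close> and Cauchy--Schwarz can be carried out entirely in
  \<open>ennreal\<close>.\<close>

lemma norm_integral_le_nn_integral:
  fixes f :: "'a \<Rightarrow> 'b::{banach, second_countable_topology}"
  shows "ennreal (norm (\<integral>x. f x \<partial>M)) \<le> (\<integral>\<^sup>+x. ennreal (norm (f x)) \<partial>M)"
  by (cases "integrable M f")
     (auto simp: not_integrable_integral_eq intro: integral_norm_bound_ennreal)

text \<open>Fatou's lemma in the form that removes a regularisation: \<open>f n\<close> carries a
  Gaussian factor, a truncation or an approximating datum, and the bounds \<open>c n\<close> survive
  in the limit.\<close>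

lemma nn_integral_le_of_tendsto:
  fixes f :: "nat \<Rightarrow> 'a \<Rightarrow> ennreal"
  assumes [measurable]: "\<And>n. f n \<in> borel_measurable M"
    and lim: "AE x in M. (\<lambda>n. f n x) \<longlonglongrightarrow> F x"
    and le: "\<And>n. (\<integral>\<^sup>+x. f n x \<partial>M) \<le> c n" and c: "c \<longlonglongrightarrow> C"
  shows "(\<integral>\<^sup>+x. F x \<partial>M) \<le> C"
proof -
  have "(\<integral>\<^sup>+x. F x \<partial>M) = (\<integral>\<^sup>+x. liminf (\<lambda>n. f n x) \<partial>M)"
    by (rule nn_integral_cong_AE, use lim in eventually_elim)
       (simp add: lim_imp_Liminf)
  also have "\<dots> \<le> liminf (\<lambda>n. \<integral>\<^sup>+x. f n x \<partial>M)"
    by (rule nn_integral_liminf) simp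
  also have "\<dots> \<le> liminf c"
    by (intro Liminf_mono always_eventually allI le)
  also have "\<dots> = C"
    using c by (intro lim_imp_Liminf) auto
  finally show ?thesis .
qed

lemma (in pair_sigma_finite) integrable_mult_prod:
  fixes f :: "_ \<Rightarrow> 'c::{banach, second_countable_topology, real_normed_div_algebra}"
  assumes f: "integrable M1 f" and g: "integrable M2 g"
  shows "integrable (M1 \<Otimes>\<^sub>M M2) (\<lambda>z. f (fst z) * g (snd z))"
proof (rule Fubini_integrable)
  have [measurable]: "f \<in> borel_measurable M1" "g \<in> borel_measurable M2"
    using f g by auto
  show "(\<lambda>z. f (fst z) * g (snd z)) \<in> borel_measurable (M1 \<Otimes>\<^sub>M M2)"
    by measurable
  show "integrable M1 (\<lambda>x. \<integral> y. norm (f (fst (x, y)) * g (snd (x, y))) \<partial>M2)"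
    using f by (simp add: norm_mult)
  show "AE x in M1. integrable M2 (\<lambda>y. f (fst (x, y)) * g (snd (x, y)))"
    using g by simp
qed

section \<open>The Gaussian and Plancherel's inequality on the line\<close>

text \<open>Normalised by height 1 and not by mass, so that it tends to 1 pointwise as
  \<open>n\<close> grows and serves as a convergence factor.\<close>

definition gauss :: "real \<Rightarrow> real \<Rightarrow> real" where
  "gauss n y = exp (- ((y / n)\<^sup>2) / 2)"

text \<open>Positive sign and no constant, as in the evolution integral; hence the factor
  \<open>2 * pi\<close> in Plancherel's inequality and in the inversion formula.\<close>

definition ft :: "(real \<Rightarrow> complex) \<Rightarrow> real \<Rightarrow> complex" where
  "ft H y = (\<integral>\<eta>. cis (y * \<eta>) * H \<eta> \<partial>lborel)"

lemma gauss_measurable [measurable]: "gauss n \<in> borel_measurable borel"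
  unfolding gauss_def by measurable

lemma gauss_eq_normal_density:
  "n > 0 \<Longrightarrow> gauss n y = sqrt (2 * pi) * n * normal_density 0 n y"
  by (simp add: gauss_def normal_density_def real_sqrt_mult power_divide field_simps)

lemma integrable_gauss:
  assumes "n > 0"
  shows "integrable lborel (gauss n)"
proof -
  have "gauss n = (\<lambda>y. sqrt (2 * pi) * n * normal_density 0 n y)"
    using assms by (intro ext gauss_eq_normal_density)
  then show ?thesis using assms by simp
qed

lemma gauss_nonneg: "0 \<le> gauss n y" and gauss_le_1: "gauss n y \<le> 1"
  by (auto simp: gauss_def)

lemma gauss_tendsto: "(\<lambda>n. gauss (Suc n) y) \<longlonglongrightarrow> 1"
proof -
  have "(\<lambda>n. y / real (Suc n)) \<longlonglongrightarrow> 0"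
    using LIMSEQ_Suc[OF lim_const_over_n[of y]] by simp
  then have "(\<lambda>n. exp (- ((y / real (Suc n))\<^sup>2) / 2)) \<longlonglongrightarrow> exp (- (0\<^sup>2) / 2)"
    by (intro tendsto_intros) auto
  then show ?thesis by (simp add: gauss_def)
qed

text \<open>The characteristic function of the standard normal law, rescaled. Up to
  \<open>2 * pi\<close> the transform of the convergence factor is a probability density
  concentrating at 0, so it acts as an approximate identity.\<close>

lemma ft_gauss:
  assumes n: "n > 0"
  shows "ft (\<lambda>y. gauss n y) \<eta> = 2 * pi * normal_density 0 (1 / n) \<eta>"
proof -
  have "exp (- ((n * \<eta>)\<^sup>2) / 2) = char std_normal_distribution (n * \<eta>)"
    by (simp add: char_std_normal_distribution)
  also have "\<dots> = (\<integral>x. std_normal_density x *\<^sub>R cis (n * \<eta> * x) \<partial>lborel)"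
    unfolding char_def by (subst integral_density) (auto simp: cis_conv_exp)
  finally have *: "(\<integral>x. std_normal_density x *\<^sub>R cis (n * \<eta> * x) \<partial>lborel) = exp (- ((n * \<eta>)\<^sup>2) / 2)"
    by simp
  have "ft (\<lambda>y. gauss n y) \<eta> = \<bar>n\<bar> *\<^sub>R (\<integral>x. cis (\<eta> * (0 + n * x)) * gauss n (0 + n * x) \<partial>lborel)"
    unfolding ft_def using n by (intro lborel_integral_real_affine) auto
  also have "\<dots> = n *\<^sub>R (\<integral>x. sqrt (2 * pi) * (std_normal_density x *\<^sub>R cis (n * \<eta> * x)) \<partial>lborel)"
  proof -
    have "complex_of_real (gauss n (n * x)) = of_real (sqrt (2 * pi)) * of_real (std_normal_density x)" for x
    proof -
      have "gauss n (n * x) = sqrt (2 * pi) * std_normal_density x"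
        using n by (simp add: gauss_def std_normal_density_def)
      then show ?thesis by (simp only: of_real_mult)
    qed
    then show ?thesis
      using n by (simp add: scaleR_conv_of_real mult_ac)
  qed
  also have "\<dots> = n * sqrt (2 * pi) * exp (- ((n * \<eta>)\<^sup>2) / 2)"
    by (subst integral_mult_right_zero, subst *) (simp add: scaleR_conv_of_real)
  also have "\<dots> = 2 * pi * normal_density 0 (1 / n) \<eta>"
  proof -
    have "n * sqrt (2 * pi) = 2 * pi * (n / sqrt (2 * pi))"
      by (simp add: field_simps)
    then show ?thesis
      using n by (simp add: normal_density_def real_sqrt_divide real_sqrt_mult power_mult_distrib field_simps flip: of_real_mult of_real_divide)
  qed
  finally show ?thesis .
qed

lemma ft_measurable [measurable (raw)]:
  assumes [measurable]: "H \<in> borel_measurable lborel"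
  shows "ft H \<in> borel_measurable borel"
  unfolding ft_def by measurable

lemma norm_ft_le: "cmod (ft H y) \<le> (\<integral>\<eta>. cmod (H \<eta>) \<partial>lborel)"
proof -
  have "cmod (ft H y) \<le> (\<integral>\<eta>. cmod (cis (y * \<eta>) * H \<eta>) \<partial>lborel)"
    unfolding ft_def by (rule integral_norm_bound)
  then show ?thesis by simp
qed

lemma integrable_cis_mult:
  fixes H :: "'a \<Rightarrow> complex"
  assumes H: "integrable M H" and [measurable]: "f \<in> borel_measurable M"
  shows "integrable M (\<lambda>x. cis (f x) * H x)"
proof (rule Bochner_Integration.integrable_bound[OF H])
  have [measurable]: "H \<in> borel_measurable M" using H by simp
  show "(\<lambda>x. cis (f x) * H x) \<in> borel_measurable M" by measurable
qed simp

text \<open>Fubini, with absolute convergence supplied by the Gaussian. Both transforms have the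
  same sign, so their composition reflects the argument: the kernel sees
  \<open>y + \<eta>\<close>.\<close>

lemma ft_gauss_cutoff:
  fixes H :: "real \<Rightarrow> complex"
  assumes H: "integrable lborel H" and n: "n > 0"
  shows "ft (\<lambda>x. gauss n x * ft H x) y
    = (\<integral>\<eta>. 2 * pi * normal_density 0 (1 / n) (y + \<eta>) * H \<eta> \<partial>lborel)"
proof -
  have [measurable]: "H \<in> borel_measurable lborel" using H by simp
  have G: "integrable lborel (\<lambda>x. complex_of_real (gauss n x))"
    using integrable_gauss[OF n] by simp
  have "integrable (lborel \<Otimes>\<^sub>M lborel) (\<lambda>z. cis ((y + snd z) * fst z) * (gauss n (fst z) * H (snd z)))"
    by (rule integrable_cis_mult[OF lborel_pair.integrable_mult_prod[OF G H]]) measurable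
  then have I: "integrable (lborel \<Otimes>\<^sub>M lborel) (\<lambda>(x, \<eta>). cis ((y + \<eta>) * x) * (gauss n x * H \<eta>))"
    by (simp add: case_prod_unfold)
  have "ft (\<lambda>x. gauss n x * ft H x) y
      = (\<integral>x. (\<integral>\<eta>. cis ((y + \<eta>) * x) * (gauss n x * H \<eta>) \<partial>lborel) \<partial>lborel)"
    unfolding ft_def
    by (subst integral_mult_right_zero[symmetric])+ 
       (simp add: distrib_right distrib_left mult_ac flip: cis_mult)
  also have "\<dots> = (\<integral>\<eta>. (\<integral>x. cis ((y + \<eta>) * x) * (gauss n x * H \<eta>) \<partial>lborel) \<partial>lborel)"
    by (rule lborel_pair.Fubini_integral[OF I, symmetric])
  also have "\<dots> = (\<integral>\<eta>. ft (\<lambda>x. gauss n x) (y + \<eta>) * H \<eta> \<partial>lborel)"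
    unfolding ft_def by (simp flip: integral_mult_left_zero mult.assoc)
  finally show ?thesis by (simp add: ft_gauss[OF n])
qed

text \<open>Writing \<open>cnj (ft H y)\<close> as an integral and exchanging the order turns the
  left side into the quadratic form of \<open>H\<close> with kernel
  \<open>2 * pi * k (\<zeta> - \<eta>)\<close>. As \<open>k\<close> has integral 1 in each variable,
  the bound \<open>2ab \<le> a^2 + b^2\<close> controls the form, as in Schur's test.\<close>

lemma plancherel_gauss:
  assumes H: "integrable lborel H" and n: "n > 0"
  shows "(\<integral>\<^sup>+y. ennreal (gauss n y * (cmod (ft H y))\<^sup>2) \<partial>lborel)
    \<le> ennreal (2 * pi) * (\<integral>\<^sup>+\<eta>. ennreal ((cmod (H \<eta>))\<^sup>2) \<partial>lborel)"
proof -
  have [measurable]: "H \<in> borel_measurable lborel" using H by simp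
  define k where "k = (\<lambda>\<eta>. normal_density 0 (1 / n) \<eta>)"
  have [measurable]: "k \<in> borel_measurable borel" unfolding k_def by measurable
  have k0: "k \<eta> \<ge> 0" and keven: "k (- \<eta>) = k \<eta>" for \<eta> by (auto simp: k_def normal_density_def)
  have kint: "(\<integral>\<^sup>+\<eta>. ennreal (k (\<eta> - a)) \<partial>lborel) = 1" for a
  proof -
    have "(\<integral>\<^sup>+\<eta>. ennreal (k \<eta>) \<partial>lborel) = 1"
      using n unfolding k_def by (subst nn_integral_eq_integral) auto
    then show ?thesis
      by (subst (asm) nn_integral_real_affine[where c=1 and t="-a"]) auto
  qed
  have kint': "(\<integral>\<^sup>+\<eta>. ennreal (k (a - \<eta>)) \<partial>lborel) = 1" for a
    using kint[of a] keven[of "\<eta> - a" for \<eta>] by simp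
  have meas: "(\<lambda>y. ft H y) \<in> borel_measurable lborel" by simp
  \<comment> \<open>\<open>ft H\<close> is bounded by the integral of the modulus of
    \<open>H\<close>, so the Gaussian alone makes the product integrable.\<close>
  have bi: "integrable lborel (\<lambda>y. gauss n y * ft H y)"
  proof (rule Bochner_Integration.integrable_bound)
    show "integrable lborel (\<lambda>y. (\<integral>\<eta>. cmod (H \<eta>) \<partial>lborel) * gauss n y)"
      using integrable_gauss[OF n] by simp
    show "AE x in lborel. cmod (gauss n x * ft H x)
        \<le> norm ((\<integral>\<eta>. cmod (H \<eta>) \<partial>lborel) * gauss n x)"
      using norm_ft_le[of H] gauss_nonneg[of n]
      by (auto simp: norm_mult abs_mult mult.commute intro!: mult_mono)
  qed (use meas in measurable)
  have I2: "integrable (lborel \<Otimes>\<^sub>M lborel)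
      (\<lambda>(y, \<eta>). (gauss n y * ft H y) * (cis (- (y * \<eta>)) * cnj (H \<eta>)))"
  proof -
    have "integrable (lborel \<Otimes>\<^sub>M lborel)
      (\<lambda>z. cis (- (fst z * snd z)) * ((gauss n (fst z) * ft H (fst z)) * cnj (H (snd z))))"
      by (intro integrable_cis_mult lborel_pair.integrable_mult_prod bi) (use H in auto)
    then show ?thesis by (simp add: case_prod_unfold mult_ac)
  qed
  have "(\<integral>\<^sup>+y. ennreal (gauss n y * (cmod (ft H y))\<^sup>2) \<partial>lborel)
      = ennreal (\<integral>y. gauss n y * (cmod (ft H y))\<^sup>2 \<partial>lborel)"
  proof (rule nn_integral_eq_integral)
    have "integrable lborel (\<lambda>y. (gauss n y * ft H y) * cnj (ft H y))"
    proof (rule Bochner_Integration.integrable_bound)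
      show "integrable lborel (\<lambda>y. (\<integral>\<eta>. cmod (H \<eta>) \<partial>lborel) *\<^sub>R (gauss n y * ft H y))"
        using bi by (intro integrable_scaleR_right) auto
      show "AE x in lborel. cmod ((gauss n x * ft H x) * cnj (ft H x))
        \<le> cmod ((\<integral>\<eta>. cmod (H \<eta>) \<partial>lborel) *\<^sub>R (gauss n x * ft H x))"
        using norm_ft_le[of H]
        by (auto simp: norm_mult abs_mult mult.commute intro!: mult_mono)
    qed (use meas in measurable)
    then have "integrable lborel (\<lambda>y. complex_of_real (gauss n y * (cmod (ft H y))\<^sup>2))"
      by (simp add: complex_norm_square mult.assoc del: of_real_power)
    then show "integrable lborel (\<lambda>y. gauss n y * (cmod (ft H y))\<^sup>2)"
      by (simp only: complex_of_real_integrable_eq)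
  qed (simp add: gauss_nonneg)
  also have "(\<integral>y. gauss n y * (cmod (ft H y))\<^sup>2 \<partial>lborel)
      = cmod (\<integral>y. complex_of_real (gauss n y * (cmod (ft H y))\<^sup>2) \<partial>lborel)"
    by (subst integral_complex_of_real) (simp add: integral_nonneg gauss_nonneg)
  also have "(\<integral>y. complex_of_real (gauss n y * (cmod (ft H y))\<^sup>2) \<partial>lborel)
     = (\<integral>y. (\<integral>\<eta>. (gauss n y * ft H y) * (cis (- (y * \<eta>)) * cnj (H \<eta>)) \<partial>lborel) \<partial>lborel)"
  proof (rule Bochner_Integration.integral_cong)
    fix y
    have "complex_of_real (gauss n y * (cmod (ft H y))\<^sup>2) = (gauss n y * ft H y) * cnj (ft H y)"
      by (simp add: complex_norm_square mult.assoc del: of_real_power)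
    also have "cnj (ft H y) = (\<integral>\<eta>. cnj (cis (y * \<eta>) * H \<eta>) \<partial>lborel)"
      unfolding ft_def by (rule Bochner_Integration.integral_cnj[symmetric])
    also have "\<dots> = (\<integral>\<eta>. cis (- (y * \<eta>)) * cnj (H \<eta>) \<partial>lborel)"
      by (simp only: complex_cnj_mult cis_cnj)
    finally show "complex_of_real (gauss n y * (cmod (ft H y))\<^sup>2)
        = (\<integral>\<eta>. (gauss n y * ft H y) * (cis (- (y * \<eta>)) * cnj (H \<eta>)) \<partial>lborel)" by simp
  qed simp
  also have "\<dots> = (\<integral>\<eta>. (\<integral>y. (gauss n y * ft H y) * (cis (- (y * \<eta>)) * cnj (H \<eta>)) \<partial>lborel) \<partial>lborel)"
    by (rule lborel_pair.Fubini_integral[OF I2, symmetric])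
  also have "\<dots> = (\<integral>\<eta>. ft (\<lambda>y. gauss n y * ft H y) (- \<eta>) * cnj (H \<eta>) \<partial>lborel)"
  proof (rule Bochner_Integration.integral_cong)
    fix \<eta>
    have "(\<integral>y. (gauss n y * ft H y) * (cis (- (y * \<eta>)) * cnj (H \<eta>)) \<partial>lborel)
        = (\<integral>y. (cis (- \<eta> * y) * (gauss n y * ft H y)) * cnj (H \<eta>) \<partial>lborel)"
      by (simp add: mult_ac)
    then show "(\<integral>y. (gauss n y * ft H y) * (cis (- (y * \<eta>)) * cnj (H \<eta>)) \<partial>lborel)
        = ft (\<lambda>y. gauss n y * ft H y) (- \<eta>) * cnj (H \<eta>)"
      unfolding ft_def[of "\<lambda>y. gauss n y * ft H y"] by (simp only: integral_mult_left_zero)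
  qed simp
  also have "\<dots> = (\<integral>\<eta>. (\<integral>\<zeta>. 2 * pi * k (\<zeta> - \<eta>) * H \<zeta> \<partial>lborel) * cnj (H \<eta>) \<partial>lborel)"
    by (subst ft_gauss_cutoff[OF H n]) (simp add: k_def)
  also have "ennreal (cmod \<dots>) \<le> (\<integral>\<^sup>+\<eta>. (\<integral>\<^sup>+\<zeta>. ennreal (pi * k (\<zeta> - \<eta>)) *
      (ennreal ((cmod (H \<zeta>))\<^sup>2) + ennreal ((cmod (H \<eta>))\<^sup>2)) \<partial>lborel) \<partial>lborel)" (is "_ \<le> ?R")
  proof -
    have "ennreal (cmod (\<integral>\<eta>. (\<integral>\<zeta>. 2 * pi * k (\<zeta> - \<eta>) * H \<zeta> \<partial>lborel) * cnj (H \<eta>) \<partial>lborel))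
       \<le> (\<integral>\<^sup>+\<eta>. ennreal (cmod ((\<integral>\<zeta>. 2 * pi * k (\<zeta> - \<eta>) * H \<zeta> \<partial>lborel) * cnj (H \<eta>))) \<partial>lborel)"
      by (rule norm_integral_le_nn_integral)
    also have "\<dots> \<le> ?R"
    proof (rule nn_integral_mono)
      fix \<eta>
      have "ennreal (cmod ((\<integral>\<zeta>. 2 * pi * k (\<zeta> - \<eta>) * H \<zeta> \<partial>lborel) * cnj (H \<eta>)))
        = ennreal (cmod (\<integral>\<zeta>. 2 * pi * k (\<zeta> - \<eta>) * H \<zeta> * cnj (H \<eta>) \<partial>lborel))"
        by simp
      also have "\<dots> \<le> (\<integral>\<^sup>+\<zeta>. ennreal (cmod (2 * pi * k (\<zeta> - \<eta>) * H \<zeta> * cnj (H \<eta>))) \<partial>lborel)"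
        by (rule norm_integral_le_nn_integral)
      also have "\<dots> \<le> (\<integral>\<^sup>+\<zeta>. ennreal (pi * k (\<zeta> - \<eta>)) *
      (ennreal ((cmod (H \<zeta>))\<^sup>2) + ennreal ((cmod (H \<eta>))\<^sup>2)) \<partial>lborel)"
      proof (rule nn_integral_mono)
        fix \<zeta>
        have "cmod (2 * pi * k (\<zeta> - \<eta>) * H \<zeta> * cnj (H \<eta>))
          = pi * k (\<zeta> - \<eta>) * (2 * cmod (H \<zeta>) * cmod (H \<eta>))"
          by (simp add: norm_mult k0)
        also have "\<dots> \<le> pi * k (\<zeta> - \<eta>) * ((cmod (H \<zeta>))\<^sup>2 + (cmod (H \<eta>))\<^sup>2)"
          by (intro mult_left_mono sum_squares_bound) (simp add: k0)
        finally show "ennreal (cmod (2 * pi * k (\<zeta> - \<eta>) * H \<zeta> * cnj (H \<eta>)))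
          \<le> ennreal (pi * k (\<zeta> - \<eta>)) * (ennreal ((cmod (H \<zeta>))\<^sup>2) + ennreal ((cmod (H \<eta>))\<^sup>2))"
          by (simp add: k0 flip: ennreal_mult' ennreal_plus)
      qed
      finally show "ennreal (cmod ((\<integral>\<zeta>. 2 * pi * k (\<zeta> - \<eta>) * H \<zeta> \<partial>lborel) * cnj (H \<eta>)))
        \<le> (\<integral>\<^sup>+\<zeta>. ennreal (pi * k (\<zeta> - \<eta>)) *
      (ennreal ((cmod (H \<zeta>))\<^sup>2) + ennreal ((cmod (H \<eta>))\<^sup>2)) \<partial>lborel)" .
    qed
    finally show ?thesis .
  qed
  also have "?R = (\<integral>\<^sup>+\<eta>. (\<integral>\<^sup>+\<zeta>. ennreal (pi * k (\<zeta> - \<eta>)) * ennreal ((cmod (H \<zeta>))\<^sup>2) \<partial>lborel) \<partial>lborel)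
     + (\<integral>\<^sup>+\<eta>. (\<integral>\<^sup>+\<zeta>. ennreal (pi * k (\<zeta> - \<eta>)) * ennreal ((cmod (H \<eta>))\<^sup>2) \<partial>lborel) \<partial>lborel)"
    by (simp add: distrib_left nn_integral_add)
  also have "(\<integral>\<^sup>+\<eta>. (\<integral>\<^sup>+\<zeta>. ennreal (pi * k (\<zeta> - \<eta>)) * ennreal ((cmod (H \<zeta>))\<^sup>2) \<partial>lborel) \<partial>lborel)
      = (\<integral>\<^sup>+\<zeta>. (\<integral>\<^sup>+\<eta>. ennreal (pi * k (\<zeta> - \<eta>)) * ennreal ((cmod (H \<zeta>))\<^sup>2) \<partial>lborel) \<partial>lborel)"
    by (rule lborel_pair.Fubini') measurable
  also have "\<dots> = (\<integral>\<^sup>+\<zeta>. ennreal pi * ennreal ((cmod (H \<zeta>))\<^sup>2) \<partial>lborel)"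
  proof (rule nn_integral_cong)
    fix \<zeta>
    have "(\<integral>\<^sup>+\<eta>. ennreal (pi * k (\<zeta> - \<eta>)) \<partial>lborel) = ennreal pi * 1"
      by (simp only: ennreal_mult'[OF pi_ge_zero], subst nn_integral_cmult) (simp_all only: kint', measurable)
    then show "(\<integral>\<^sup>+\<eta>. ennreal (pi * k (\<zeta> - \<eta>)) * ennreal ((cmod (H \<zeta>))\<^sup>2) \<partial>lborel)
        = ennreal pi * ennreal ((cmod (H \<zeta>))\<^sup>2)"
      by (subst nn_integral_multc) simp_all
  qed
  also have "(\<integral>\<^sup>+\<eta>. (\<integral>\<^sup>+\<zeta>. ennreal (pi * k (\<zeta> - \<eta>)) * ennreal ((cmod (H \<eta>))\<^sup>2) \<partial>lborel) \<partial>lborel)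
     = (\<integral>\<^sup>+\<zeta>. ennreal pi * ennreal ((cmod (H \<zeta>))\<^sup>2) \<partial>lborel)"
  proof (rule nn_integral_cong)
    fix \<eta>
    have "(\<integral>\<^sup>+\<zeta>. ennreal (pi * k (\<zeta> - \<eta>)) \<partial>lborel) = ennreal pi * 1"
      by (simp only: ennreal_mult'[OF pi_ge_zero], subst nn_integral_cmult) (simp_all only: kint, measurable)
    then show "(\<integral>\<^sup>+\<zeta>. ennreal (pi * k (\<zeta> - \<eta>)) * ennreal ((cmod (H \<eta>))\<^sup>2) \<partial>lborel)
        = ennreal pi * ennreal ((cmod (H \<eta>))\<^sup>2)"
      by (subst nn_integral_multc) simp_all
  qed
  also have "\<dots> + \<dots> = ennreal (2 * pi) * (\<integral>\<^sup>+\<eta>. ennreal ((cmod (H \<eta>))\<^sup>2) \<partial>lborel)"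
  proof -
    have "ennreal (2 * pi) = ennreal pi + ennreal pi"
      by (subst ennreal_plus[symmetric]) auto
    then show ?thesis by (simp only: distrib_right) (simp add: nn_integral_cmult)
  qed
  finally show ?thesis .
qed

text \<open>The Gaussian factor is removed by Fatou's lemma, which leaves an inequality; upper
  bounds of this kind are all that the later estimates ask for.\<close>

lemma plancherel:
  assumes H: "integrable lborel H"
  shows "(\<integral>\<^sup>+y. ennreal ((cmod (ft H y))\<^sup>2) \<partial>lborel)
    \<le> ennreal (2 * pi) * (\<integral>\<^sup>+\<eta>. ennreal ((cmod (H \<eta>))\<^sup>2) \<partial>lborel)"
proof (rule nn_integral_le_of_tendsto)
  have [measurable]: "H \<in> borel_measurable lborel" using H by simp
  show "(\<lambda>y. ennreal (gauss (Suc n) y * (cmod (ft H y))\<^sup>2)) \<in> borel_measurable lborel" for n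
    by measurable
  show "AE y in lborel. (\<lambda>n. ennreal (gauss (Suc n) y * (cmod (ft H y))\<^sup>2))
      \<longlonglongrightarrow> ennreal ((cmod (ft H y))\<^sup>2)"
  proof (rule AE_I2)
    fix y
    have "(\<lambda>n. gauss (Suc n) y * (cmod (ft H y))\<^sup>2) \<longlonglongrightarrow> 1 * (cmod (ft H y))\<^sup>2"
      by (intro tendsto_mult gauss_tendsto tendsto_const)
    then show "(\<lambda>n. ennreal (gauss (Suc n) y * (cmod (ft H y))\<^sup>2))
      \<longlonglongrightarrow> ennreal ((cmod (ft H y))\<^sup>2)" by (intro tendsto_ennrealI) simp
  qed
  show "(\<integral>\<^sup>+y. ennreal (gauss (Suc n) y * (cmod (ft H y))\<^sup>2) \<partial>lborel)
    \<le> ennreal (2 * pi) * (\<integral>\<^sup>+\<eta>. ennreal ((cmod (H \<eta>))\<^sup>2) \<partial>lborel)" for n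
    by (rule plancherel_gauss[OF H]) simp
qed simp

section \<open>Square integrals and almost everywhere convergence\<close>

abbreviation l2sq :: "('a::euclidean_space \<Rightarrow> complex) \<Rightarrow> ennreal" where
  "l2sq g \<equiv> \<integral>\<^sup>+x. ennreal ((cmod (g x))\<^sup>2) \<partial>lborel"

lemma cmod_power2_add_le: "(cmod (a + b))\<^sup>2 \<le> 2 * (cmod a)\<^sup>2 + 2 * (cmod b)\<^sup>2"
proof -
  have "(cmod (a + b))\<^sup>2 \<le> (cmod a + cmod b)\<^sup>2"
    by (intro power_mono norm_triangle_ineq) auto
  also have "\<dots> \<le> 2 * (cmod a)\<^sup>2 + 2 * (cmod b)\<^sup>2"
    using sum_squares_bound[of "cmod a" "cmod b"] by (simp add: power2_sum)
  finally show ?thesis .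
qed

lemma l2sq_add_le:
  assumes [measurable]: "f \<in> borel_measurable lborel" "g \<in> borel_measurable lborel"
  shows "l2sq (\<lambda>x. f x + g x) \<le> 2 * l2sq f + 2 * l2sq g"
proof -
  have "l2sq (\<lambda>x. f x + g x) \<le> (\<integral>\<^sup>+x. 2 * ennreal ((cmod (f x))\<^sup>2) + 2 * ennreal ((cmod (g x))\<^sup>2) \<partial>lborel)"
  proof (rule nn_integral_mono)
    fix x
    have "ennreal ((cmod (f x + g x))\<^sup>2) \<le> ennreal (2 * (cmod (f x))\<^sup>2 + 2 * (cmod (g x))\<^sup>2)"
      by (intro ennreal_leI cmod_power2_add_le)
    then show "ennreal ((cmod (f x + g x))\<^sup>2) \<le> 2 * ennreal ((cmod (f x))\<^sup>2) + 2 * ennreal ((cmod (g x))\<^sup>2)"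
      by (simp add: ennreal_mult')
  qed
  then show ?thesis by (simp add: nn_integral_add nn_integral_cmult)
qed

lemma ennreal_power2_le_imp_le:
  fixes x y :: ennreal
  assumes "x\<^sup>2 \<le> y\<^sup>2"
  shows "x \<le> y"
proof (cases "y = top")
  case False
  then have "x \<noteq> top"
    using assms by (auto simp: power2_eq_square ennreal_mult_eq_top_iff top_unique)
  then obtain a b where "x = ennreal a" "y = ennreal b" "a \<ge> 0" "b \<ge> 0"
    using False by (metis ennreal_cases)
  then show ?thesis
    using assms by (auto simp: ennreal_power intro!: ennreal_leI power2_le_imp_le)
qed simp

lemma L2_norm_tendsto_0:
  assumes "((\<lambda>r. l2sq (F r)) \<longlongrightarrow> 0) A"
  shows "((\<lambda>r. L2_norm (F r)) \<longlongrightarrow> 0) A"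
proof (rule order_tendstoI)
  fix a :: ennreal assume "0 < a"
  then have "0 < a\<^sup>2" by (simp add: zero_less_iff_neq_zero)
  with assms have "\<forall>\<^sub>F r in A. l2sq (F r) < a\<^sup>2" by (rule order_tendstoD)
  then show "\<forall>\<^sub>F r in A. L2_norm (F r) < a"
  proof eventually_elim
    case (elim r)
    show ?case
    proof (rule ccontr)
      assume "\<not> L2_norm (F r) < a"
      then have "a\<^sup>2 \<le> (L2_norm (F r))\<^sup>2" by (intro power_mono) auto
      with elim show False by (simp add: L2_norm_squared)
    qed
  qed
qed simp

lemma L2_norm_less_top_iff: "L2_norm g < top \<longleftrightarrow> l2sq g < top"
proof -
  have "L2_norm g < top \<longleftrightarrow> (L2_norm g)\<^sup>2 < top"
    by (auto simp: power2_eq_square ennreal_mult_less_top less_top)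
  then show ?thesis by (simp add: L2_norm_squared)
qed

text \<open>The Riesz--Fischer argument. \<open>D n m\<close> measures the distance of the
  approximations \<open>n\<close> and \<open>m\<close>. Choosing
  \<open>\<delta> (r k) \<le> (1/4) ^ k\<close> makes the sum of
  \<open>2 ^ k * (E k x)\<^sup>2\<close> integrable over each \<open>A j\<close>, hence finite
  almost everywhere. The sets \<open>A j\<close> with their own constants \<open>c j\<close> are
  there because maximal estimates hold only locally in space.\<close>

lemma fast_subsequence:
  fixes D :: "nat \<Rightarrow> nat \<Rightarrow> 'a \<Rightarrow> ennreal" and c :: "nat \<Rightarrow> real"
  assumes [measurable]: "\<And>n m. D n m \<in> borel_measurable M" "\<And>j. A j \<in> sets M"
    and le: "\<And>j n m. n \<le> m \<Longrightarrow> (\<integral>\<^sup>+x\<in>A j. (D n m x)\<^sup>2 \<partial>M) \<le> ennreal (c j) * \<delta> n"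
    and \<delta>: "\<delta> \<longlonglongrightarrow> 0" and A: "(\<Union>j. A j) = space M"
  shows "\<exists>r. strict_mono r \<and> (AE x in M. (\<Sum>k. D (r k) (r (Suc k)) x) < top)"
proof -
  have "\<exists>r. \<forall>k. \<delta> (r k) \<le> ennreal ((1/4) ^ k) \<and> r k < r (Suc k)"
  proof (rule dependent_nat_choice)
    have ev: "\<forall>\<^sub>F n in sequentially. \<delta> n < ennreal ((1/4) ^ k)" for k
      using \<delta> by (rule order_tendstoD) simp
    show "\<exists>n. \<delta> n \<le> ennreal ((1/4) ^ 0)"
      using eventually_happens[OF ev[of 0]] by (auto intro: less_imp_le)
    show "\<exists>n. \<delta> n \<le> ennreal ((1/4) ^ Suc k) \<and> m < n" for m k
    proof -
      have "\<forall>\<^sub>F n in sequentially. \<delta> n < ennreal ((1/4) ^ Suc k) \<and> m < n"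
        using ev eventually_gt_at_top by (rule eventually_conj)
      from eventually_happens[OF this] show ?thesis by (auto intro: less_imp_le)
    qed
  qed
  then obtain r where r: "\<And>k. \<delta> (r k) \<le> ennreal ((1/4) ^ k)" "\<And>k. r k < r (Suc k)" by blast
  have mono: "strict_mono r" using r(2) by (simp add: strict_mono_Suc_iff)
  define E where "E k = D (r k) (r (Suc k))" for k
  have [measurable]: "E k \<in> borel_measurable M" for k by (simp add: E_def)
  have geo: "(\<Sum>k. ennreal ((1/2) ^ k)) < top"
    by (subst suminf_ennreal2) (auto intro!: summable_geometric)
  have "AE x in M. x \<in> A j \<longrightarrow> (\<Sum>k. E k x) < top" for j
  proof -
    have "(\<integral>\<^sup>+x. (\<Sum>k. 2 ^ k * (E k x)\<^sup>2 * indicator (A j) x) \<partial>M)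
        = (\<Sum>k. \<integral>\<^sup>+x. 2 ^ k * (E k x)\<^sup>2 * indicator (A j) x \<partial>M)"
      by (rule nn_integral_suminf) simp
    also have "\<dots> \<le> (\<Sum>k. ennreal (c j) * ennreal ((1/2) ^ k))"
    proof (intro suminf_le summableI)
      fix k
      have "(\<integral>\<^sup>+x. 2 ^ k * (E k x)\<^sup>2 * indicator (A j) x \<partial>M)
          = 2 ^ k * (\<integral>\<^sup>+x\<in>A j. (E k x)\<^sup>2 \<partial>M)"
        by (simp add: nn_integral_cmult mult.assoc)
      also have "\<dots> \<le> 2 ^ k * (ennreal (c j) * \<delta> (r k))"
        unfolding E_def using r(2)[of k] by (intro mult_left_mono le) auto
      also have "\<dots> \<le> 2 ^ k * (ennreal (c j) * ennreal ((1/4) ^ k))"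
        by (intro mult_left_mono r) auto
      also have "\<dots> = ennreal (c j) * (ennreal (2 ^ k) * ennreal ((1/4) ^ k))"
        by (simp add: mult_ac ennreal_power[symmetric])
      also have "ennreal (2 ^ k) * ennreal ((1/4) ^ k) = ennreal ((1/2) ^ k)"
        by (simp flip: ennreal_mult' power_mult_distrib)
      finally show "(\<integral>\<^sup>+x. 2 ^ k * (E k x)\<^sup>2 * indicator (A j) x \<partial>M) \<le> ennreal (c j) * ennreal ((1/2) ^ k)" .
    qed
    also have "\<dots> < top"
      using geo by (simp add: ennreal_suminf_cmult ennreal_mult_less_top)
    finally have "AE x in M. (\<Sum>k. 2 ^ k * (E k x)\<^sup>2 * indicator (A j) x) \<noteq> top"
      using nn_integral_PInf_AE[where f="\<lambda>x. \<Sum>k. 2 ^ k * (E k x)\<^sup>2 * indicator (A j) x" and M=M]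
      by (simp add: infinity_ennreal_def)
    then show ?thesis
    proof eventually_elim
      case (elim x)
      show ?case
      proof
        assume x: "x \<in> A j"
        have "(\<Sum>k. E k x) \<le> (\<Sum>k. ennreal ((1/2) ^ k) + 2 ^ k * (E k x)\<^sup>2)"
        proof (intro suminf_le summableI)
          fix k
          \<comment> \<open>A value above \<open>(1/2) ^ k\<close> is at most its own square divided
            by \<open>(1/2) ^ k\<close>.\<close>
          show "E k x \<le> ennreal ((1/2) ^ k) + 2 ^ k * (E k x)\<^sup>2"
          proof (cases "E k x \<le> ennreal ((1/2) ^ k)")
            case True
            then show ?thesis by (simp add: add_increasing2)
          next
            case False
            have "E k x = ennreal (2 ^ k * (1/2) ^ k) * E k x"
              by (simp flip: power_mult_distrib)
            also have "\<dots> = 2 ^ k * (ennreal ((1/2) ^ k) * E k x)"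
              by (simp add: ennreal_mult' mult_ac ennreal_power[symmetric])
            also have "\<dots> \<le> 2 ^ k * (E k x * E k x)"
              using False by (intro mult_left_mono mult_right_mono) auto
            finally show ?thesis by (simp add: power2_eq_square add_increasing)
          qed
        qed
        also have "\<dots> = (\<Sum>k. ennreal ((1/2) ^ k)) + (\<Sum>k. 2 ^ k * (E k x)\<^sup>2)"
          by (intro suminf_add[symmetric] summableI)
        also have "\<dots> < top"
          using geo elim x by (simp add: less_top)
        finally show "(\<Sum>k. E k x) < top" .
      qed
    qed
  qed
  then have "AE x in M. \<forall>j. x \<in> A j \<longrightarrow> (\<Sum>k. E k x) < top"
    by (subst AE_all_countable) blast
  then have "AE x in M. (\<Sum>k. E k x) < top"
    using AE_space by eventually_elim (use A in blast)
  with mono show ?thesis unfolding E_def by blast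
qed

section \<open>Coordinates in the plane\<close>

abbreviation pt :: "real \<Rightarrow> real \<Rightarrow> real^2" where
  "pt a b \<equiv> vector [a, b]"

lemma norm_plane_power2: "(norm (x :: real^2))\<^sup>2 = (x $ 1)\<^sup>2 + (x $ 2)\<^sup>2"
  by (simp add: norm_vec_def L2_set_def UNIV_2 sum_nonneg)

lemma inner_plane: "(x :: real^2) \<bullet> y = x $ 1 * y $ 1 + x $ 2 * y $ 2"
  by (simp add: inner_vec_def UNIV_2)

lemma pt_eta [simp]: "pt (x $ 1) (x $ 2) = x"
  by (simp add: vec_eq_iff forall_2)

lemma borel_measurable_pt [measurable (raw)]:
  assumes "f \<in> borel_measurable M" "g \<in> borel_measurable M"
  shows "(\<lambda>z. pt (f z) (g z)) \<in> borel_measurable M"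
proof -
  have "(\<lambda>z. pt (f z) (g z)) = (\<lambda>z. f z *\<^sub>R axis 1 1 + g z *\<^sub>R axis 2 1)"
    by (auto simp: vec_eq_iff forall_2 axis_def)
  then show ?thesis using assms by simp
qed

lemma borel_measurable_vec_nth [measurable (raw)]:
  fixes f :: "'a \<Rightarrow> real^'n"
  assumes [measurable]: "f \<in> borel_measurable M"
  shows "(\<lambda>z. f z $ i) \<in> borel_measurable M"
proof -
  have "(\<lambda>z. f z $ i) = (\<lambda>z. f z \<bullet> axis i 1)"
    by (simp add: inner_axis)
  then show ?thesis by simp
qed

lemma Basis_plane: "(Basis :: (real^2) set) = {axis 1 1, axis 2 1}"
  by (auto simp: Basis_vec_def UNIV_2)

text \<open>\<open>real^2\<close> is not a product type, so Fubini is available only through this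
  identification. It suffices to compare the two measures on boxes.\<close>

lemma lborel_plane:
  "(lborel :: (real^2) measure) = distr (lborel \<Otimes>\<^sub>M lborel) borel (\<lambda>z. pt (fst z) (snd z))"
proof (rule lborel_eqI)
  fix l u :: "real^2" assume lu: "\<And>b. b \<in> Basis \<Longrightarrow> l \<bullet> b \<le> u \<bullet> b"
  have le: "l $ 1 \<le> u $ 1" "l $ 2 \<le> u $ 2"
    using lu[of "axis 1 1"] lu[of "axis 2 1"] by (auto simp: Basis_plane inner_axis)
  have "(\<lambda>z. pt (fst z) (snd z)) -` box l u = {l $ 1<..<u $ 1} \<times> {l $ 2<..<u $ 2}"
    by (auto simp: box_def Basis_plane inner_axis)
  then have "emeasure (distr (lborel \<Otimes>\<^sub>M lborel) borel (\<lambda>z. pt (fst z) (snd z))) (box l u)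
    = emeasure (lborel \<Otimes>\<^sub>M lborel) ({l $ 1<..<u $ 1} \<times> {l $ 2<..<u $ 2})"
    by (subst emeasure_distr) (auto simp: space_pair_measure)
  also have "\<dots> = ennreal (u $ 1 - l $ 1) * ennreal (u $ 2 - l $ 2)"
    using le by (subst lborel.emeasure_pair_measure_Times) auto
  also have "\<dots> = ennreal (\<Prod>b\<in>Basis. (u - l) \<bullet> b)"
    using le by (simp add: Basis_plane inner_axis axis_eq_axis ennreal_mult')
  finally show "emeasure (distr (lborel \<Otimes>\<^sub>M lborel) borel (\<lambda>z. pt (fst z) (snd z))) (box l u)
    = ennreal (\<Prod>b\<in>Basis. (u - l) \<bullet> b)" .
qed simp

lemma nn_integral_plane:
  fixes F :: "real^2 \<Rightarrow> ennreal"
  assumes [measurable]: "F \<in> borel_measurable borel"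
  shows "(\<integral>\<^sup>+x. F x \<partial>lborel) = (\<integral>\<^sup>+a. (\<integral>\<^sup>+b. F (pt a b) \<partial>lborel) \<partial>lborel)"
proof -
  have "(\<integral>\<^sup>+x. F x \<partial>lborel) = (\<integral>\<^sup>+z. F (pt (fst z) (snd z)) \<partial>(lborel \<Otimes>\<^sub>M lborel))"
    by (subst lborel_plane, subst nn_integral_distr) auto
  also have "\<dots> = (\<integral>\<^sup>+a. (\<integral>\<^sup>+b. F (pt a b) \<partial>lborel) \<partial>lborel)"
    by (subst lborel.nn_integral_fst[symmetric]) auto
  finally show ?thesis .
qed

lemma nn_integral_plane':
  fixes F :: "real^2 \<Rightarrow> ennreal"
  assumes [measurable]: "F \<in> borel_measurable borel"
  shows "(\<integral>\<^sup>+x. F x \<partial>lborel) = (\<integral>\<^sup>+b. (\<integral>\<^sup>+a. F (pt a b) \<partial>lborel) \<partial>lborel)"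
  unfolding nn_integral_plane[OF assms]
  by (rule lborel_pair.Fubini'[symmetric]) measurable

lemma integrable_plane:
  fixes F :: "real^2 \<Rightarrow> complex"
  assumes "integrable lborel F"
  shows "integrable (lborel \<Otimes>\<^sub>M lborel) (\<lambda>(a, b). F (pt a b))"
proof -
  have [measurable]: "F \<in> borel_measurable borel" using assms by auto
  have "integrable (distr (lborel \<Otimes>\<^sub>M lborel) borel (\<lambda>z. pt (fst z) (snd z))) F"
    using assms by (simp flip: lborel_plane)
  then show ?thesis
    by (subst (asm) integrable_distr_eq) (auto simp: case_prod_unfold)
qed

lemma integral_plane:
  fixes F :: "real^2 \<Rightarrow> complex"
  assumes F: "integrable lborel F"
  shows "(\<integral>x. F x \<partial>lborel) = (\<integral>a. (\<integral>b. F (pt a b) \<partial>lborel) \<partial>lborel)"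
    and "(\<integral>x. F x \<partial>lborel) = (\<integral>b. (\<integral>a. F (pt a b) \<partial>lborel) \<partial>lborel)"
proof -
  have [measurable]: "F \<in> borel_measurable borel" using F by auto
  show 1: "(\<integral>x. F x \<partial>lborel) = (\<integral>a. (\<integral>b. F (pt a b) \<partial>lborel) \<partial>lborel)"
    using lborel_pair.integral_fst[OF integrable_plane[OF F]]
    by (subst lborel_plane, subst integral_distr) (auto simp: case_prod_unfold)
  show "(\<integral>x. F x \<partial>lborel) = (\<integral>b. (\<integral>a. F (pt a b) \<partial>lborel) \<partial>lborel)"
    unfolding 1 by (rule lborel_pair.Fubini_integral[OF integrable_plane[OF F], symmetric])
qed

lemma integrable_bounded_support:
  fixes f :: "'a::euclidean_space \<Rightarrow> complex"
  assumes [measurable]: "f \<in> borel_measurable borel"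
    and B: "\<And>x. cmod (f x) \<le> B" and N: "\<And>x. f x \<noteq> 0 \<Longrightarrow> norm x \<le> N"
  shows "integrable lborel f"
proof (rule Bochner_Integration.integrable_bound)
  show "integrable lborel (\<lambda>x::'a. B * indicator (cball 0 N) x :: real)"
    by (intro integrable_mult_right integrable_real_indicator) (use emeasure_bounded_finite[of "cball (0::'a) N"] in auto)
  show "AE x in lborel. cmod (f x) \<le> norm (B * indicator (cball 0 N) x :: real)"
  proof (rule AE_I2)
    fix x
    have "0 \<le> B" using norm_ge_zero[of "f x"] B[of x] by linarith
    then show "cmod (f x) \<le> norm (B * indicator (cball 0 N) x :: real)"
      using B[of x] N[of x] by (cases "f x = 0") auto
  qed
qed simp

section \<open>The Fourier integral on the plane\<close>

lemma ft_param_measurable [measurable (raw)]: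
  assumes [measurable]: "case_prod H \<in> borel_measurable (M \<Otimes>\<^sub>M lborel)" "f \<in> borel_measurable M"
  shows "(\<lambda>z. ft (H z) (f z)) \<in> borel_measurable M"
  unfolding ft_def by measurable

lemma sets_borel_cball [measurable]: "cball (a :: 'a::metric_space) r \<in> sets borel"
  by (intro borel_closed closed_cball)

text \<open>The sign \<open>\<sigma>\<close> is 1 for the evolution and -1 for the Fourier
  transform, so that both share one theory of mean-square limits.\<close>

definition ft2 :: "real \<Rightarrow> (real^2 \<Rightarrow> complex) \<Rightarrow> real^2 \<Rightarrow> complex" where
  "ft2 \<sigma> g x = (\<integral>\<xi>. cis (\<sigma> * (x \<bullet> \<xi>)) * g \<xi> \<partial>lborel)"

lemma ft2_measurable [measurable]:
  assumes [measurable]: "g \<in> borel_measurable borel"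
  shows "ft2 \<sigma> g \<in> borel_measurable borel"
  unfolding ft2_def by measurable

lemma ft2_add:
  assumes "integrable lborel f" "integrable lborel g"
  shows "ft2 \<sigma> (\<lambda>\<xi>. f \<xi> + g \<xi>) x = ft2 \<sigma> f x + ft2 \<sigma> g x"
  unfolding ft2_def using assms
  by (simp add: distrib_left integrable_cis_mult)

lemma ft2_diff:
  assumes "integrable lborel f" "integrable lborel g"
  shows "ft2 \<sigma> (\<lambda>\<xi>. f \<xi> - g \<xi>) x = ft2 \<sigma> f x - ft2 \<sigma> g x"
  unfolding ft2_def using assms
  by (simp add: right_diff_distrib integrable_cis_mult)

lemma ft2_plane:
  assumes g: "integrable lborel g"
  shows "ft2 1 g (pt x y) = ft (\<lambda>a. ft (\<lambda>b. g (pt a b)) y) x"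
proof -
  have "ft2 1 g (pt x y) = (\<integral>a. (\<integral>b. cis (pt x y \<bullet> pt a b) * g (pt a b) \<partial>lborel) \<partial>lborel)"
    unfolding ft2_def using g
    by (subst integral_plane(1)) (auto intro: integrable_cis_mult)
  also have "\<dots> = ft (\<lambda>a. ft (\<lambda>b. g (pt a b)) y) x"
    unfolding ft_def
    by (subst integral_mult_right_zero[symmetric]) (simp add: inner_plane mult.assoc flip: cis_mult)
  finally show ?thesis .
qed

text \<open>Tame functions are integrable, and their slices and partial transforms are tame again.
  Plancherel on the line can therefore be applied one variable at a time.\<close>

definition tame :: "('a::euclidean_space \<Rightarrow> complex) \<Rightarrow> bool" where
  "tame g \<longleftrightarrow> g \<in> borel_measurable borel \<and> bounded (range g) \<and> bounded {\<xi>. g \<xi> \<noteq> 0}"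

lemma tameI:
  assumes "g \<in> borel_measurable borel" "\<And>\<xi>. cmod (g \<xi>) \<le> B" "\<And>\<xi>. g \<xi> \<noteq> 0 \<Longrightarrow> norm \<xi> \<le> N"
  shows "tame g"
  using assms unfolding tame_def bounded_iff by blast

lemma tameE:
  assumes "tame g"
  obtains B N where "g \<in> borel_measurable borel" "\<And>\<xi>. cmod (g \<xi>) \<le> B"
    "\<And>\<xi>. g \<xi> \<noteq> 0 \<Longrightarrow> norm \<xi> \<le> N" "B > 0" "N > 0"
  using assms unfolding tame_def bounded_pos by auto

lemma tame_measurable: "tame g \<Longrightarrow> g \<in> borel_measurable borel"
  by (simp add: tame_def)

lemma tame_integrable: "tame g \<Longrightarrow> integrable lborel g"
  by (elim tameE) (rule integrable_bounded_support)

lemma tame_mono: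
  assumes g: "tame g" and [measurable]: "f \<in> borel_measurable borel"
    and le: "\<And>\<xi>. cmod (f \<xi>) \<le> C * cmod (g \<xi>)"
  shows "tame f"
proof -
  from g obtain B N where B: "\<And>\<xi>. cmod (g \<xi>) \<le> B" and N: "\<And>\<xi>. g \<xi> \<noteq> 0 \<Longrightarrow> norm \<xi> \<le> N"
    by (rule tameE) blast
  show ?thesis
  proof (rule tameI)
    show "cmod (f \<xi>) \<le> \<bar>C\<bar> * B" for \<xi>
      using le[of \<xi>] B[of \<xi>] by (meson abs_ge_self abs_ge_zero mult_mono norm_ge_zero order_trans)
    show "norm \<xi> \<le> N" if "f \<xi> \<noteq> 0" for \<xi>
      using le[of \<xi>] that by (intro N) auto
  qed fact
qed

lemma norm_pt: "norm (pt a b) = sqrt (a\<^sup>2 + b\<^sup>2)"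
  using norm_plane_power2[of "pt a b"] by (metis norm_ge_zero real_sqrt_unique vector_2)

lemma tame_slice:
  assumes "tame (g :: real^2 \<Rightarrow> complex)"
  shows "tame (\<lambda>b. g (pt a b))" "tame (\<lambda>a. g (pt a b))"
proof -
  from assms obtain B N where [measurable]: "g \<in> borel_measurable borel"
    and B: "\<And>\<xi>. cmod (g \<xi>) \<le> B" and N: "\<And>\<xi>. g \<xi> \<noteq> 0 \<Longrightarrow> norm \<xi> \<le> N"
    by (rule tameE) blast
  have ab: "\<bar>a\<bar> \<le> N" "\<bar>b\<bar> \<le> N" if "g (pt a b) \<noteq> 0" for a b
    using N[OF that] component_le_norm_cart[of "pt a b" 1] component_le_norm_cart[of "pt a b" 2] by auto
  show "tame (\<lambda>b. g (pt a b))" "tame (\<lambda>a. g (pt a b))"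
    using B ab by (auto intro!: tameI[where B=B and N=N])
qed

text \<open>The support in \<open>a\<close> is inherited from \<open>g\<close>, and the slices have
  length at most \<open>2 * N\<close> and height at most \<open>B\<close>. This prepares the second
  application of Plancherel on the line.\<close>

lemma tame_ft_slice:
  assumes g: "tame (g :: real^2 \<Rightarrow> complex)"
  shows "tame (\<lambda>a. ft (\<lambda>b. g (pt a b)) y)"
proof -
  from g obtain B N where [measurable]: "g \<in> borel_measurable borel"
    and B: "\<And>\<xi>. cmod (g \<xi>) \<le> B" and N: "\<And>\<xi>. g \<xi> \<noteq> 0 \<Longrightarrow> norm \<xi> \<le> N" and "B > 0" "N > 0"
    by (rule tameE) blast
  have ab: "\<bar>a\<bar> \<le> N" "\<bar>b\<bar> \<le> N" if "g (pt a b) \<noteq> 0" for a b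
    using N[OF that] component_le_norm_cart[of "pt a b" 1] component_le_norm_cart[of "pt a b" 2] by auto
  show ?thesis
  proof (rule tameI)
    show "(\<lambda>a. ft (\<lambda>b. g (pt a b)) y) \<in> borel_measurable borel"
      unfolding ft_def by measurable
    show "cmod (ft (\<lambda>b. g (pt a b)) y) \<le> B * (2 * N)" for a
    proof -
      have "cmod (ft (\<lambda>b. g (pt a b)) y) \<le> (\<integral>b. cmod (g (pt a b)) \<partial>lborel)"
        by (rule norm_ft_le)
      also have "\<dots> \<le> (\<integral>b. B * indicator {-N..N} b \<partial>lborel)"
      proof (rule integral_mono)
        show "integrable lborel (\<lambda>b. cmod (g (pt a b)))"
          using tame_integrable[OF tame_slice(1)[OF g]] by simp
        show "integrable lborel (\<lambda>b. B * indicator {-N..N} b)"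
          using \<open>N > 0\<close> by (intro integrable_mult_right integrable_real_indicator) auto
        show "cmod (g (pt a b)) \<le> B * indicator {-N..N} b" for b
          using B[of "pt a b"] ab[of a b] by (cases "g (pt a b) = 0") (auto simp: indicator_def abs_le_iff)
      qed
      also have "\<dots> = B * (2 * N)" using \<open>N > 0\<close> by simp
      finally show ?thesis .
    qed
    show "norm a \<le> N" if "ft (\<lambda>b. g (pt a b)) y \<noteq> 0" for a
    proof (rule ccontr)
      assume "\<not> norm a \<le> N"
      then have "g (pt a b) = 0" for b using ab(1)[of a b] by auto
      with that show False by (simp add: ft_def)
    qed
  qed
qed

text \<open>Plancherel on the line in each of the two variables, with Tonelli between them; each
  application contributes one factor \<open>2 * pi\<close>.\<close>

lemma plancherel_tame:
  assumes g: "tame g"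
  shows "l2sq (ft2 1 g) \<le> ennreal ((2 * pi)\<^sup>2) * l2sq g"
proof -
  have pi2: "ennreal ((2 * pi)\<^sup>2) = ennreal (2 * pi) * ennreal (2 * pi)"
    unfolding power2_eq_square by (rule ennreal_mult) auto
  have [measurable]: "g \<in> borel_measurable borel" using g by (rule tame_measurable)
  have [measurable]: "(\<lambda>z. ft (\<lambda>b. g (pt (fst z) b)) (snd z)) \<in> borel_measurable (borel \<Otimes>\<^sub>M borel)"
    unfolding ft_def by measurable
  have "l2sq (ft2 1 g) = (\<integral>\<^sup>+y. l2sq (ft (\<lambda>a. ft (\<lambda>b. g (pt a b)) y)) \<partial>lborel)"
    by (subst nn_integral_plane') (simp_all add: ft2_plane[OF tame_integrable[OF g]])
  also have "\<dots> \<le> (\<integral>\<^sup>+y. ennreal (2 * pi) * l2sq (\<lambda>a. ft (\<lambda>b. g (pt a b)) y) \<partial>lborel)"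
    by (intro nn_integral_mono plancherel tame_integrable tame_ft_slice g)
  also have "\<dots> = ennreal (2 * pi) * (\<integral>\<^sup>+y. l2sq (\<lambda>a. ft (\<lambda>b. g (pt a b)) y) \<partial>lborel)"
    by (rule nn_integral_cmult) measurable
  also have "(\<integral>\<^sup>+y. l2sq (\<lambda>a. ft (\<lambda>b. g (pt a b)) y) \<partial>lborel)
      = (\<integral>\<^sup>+a. l2sq (ft (\<lambda>b. g (pt a b))) \<partial>lborel)"
    by (rule lborel_pair.Fubini') measurable
  also have "\<dots> \<le> (\<integral>\<^sup>+a. ennreal (2 * pi) * l2sq (\<lambda>b. g (pt a b)) \<partial>lborel)"
    by (intro nn_integral_mono plancherel tame_integrable tame_slice g)
  also have "\<dots> = ennreal (2 * pi) * (\<integral>\<^sup>+a. l2sq (\<lambda>b. g (pt a b)) \<partial>lborel)"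
    by (rule nn_integral_cmult) measurable
  also have "(\<integral>\<^sup>+a. l2sq (\<lambda>b. g (pt a b)) \<partial>lborel) = l2sq g"
    by (rule nn_integral_plane[symmetric]) measurable
  also have "ennreal (2 * pi) * (ennreal (2 * pi) * l2sq g) = ennreal ((2 * pi)\<^sup>2) * l2sq g"
    by (simp only: pi2 mult.assoc)
  finally show ?thesis by (simp add: mult_left_mono)
qed

text \<open>Cutting in frequency and in height at once makes every Borel function tame. Large values
  are replaced by 0 and not clipped, so that \<open>g - trunc n g\<close> is pointwise
  \<open>g\<close> or 0.\<close>

definition trunc :: "nat \<Rightarrow> ('a::euclidean_space \<Rightarrow> complex) \<Rightarrow> 'a \<Rightarrow> complex" where
  "trunc n g \<xi> = (if norm \<xi> \<le> real n \<and> cmod (g \<xi>) \<le> real n then g \<xi> else 0)"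

lemma trunc_measurable [measurable (raw)]:
  assumes [measurable]: "g \<in> borel_measurable borel"
  shows "trunc n g \<in> borel_measurable borel"
  unfolding trunc_def[abs_def] by measurable

lemma tame_trunc: "g \<in> borel_measurable borel \<Longrightarrow> tame (trunc n g)"
  by (rule tameI[where B="real n" and N="real n"]) (auto simp: trunc_def split: if_splits)

lemma trunc_eventually: "\<forall>\<^sub>F n in sequentially. trunc n g \<xi> = g \<xi>"
proof -
  have "\<forall>\<^sub>F n in sequentially. max (norm \<xi>) (cmod (g \<xi>)) \<le> real n"
    using eventually_ge_at_top[of "nat \<lceil>max (norm \<xi>) (cmod (g \<xi>))\<rceil>"]
    by eventually_elim (simp add: nat_ceiling_le_eq)
  then show ?thesis by eventually_elim (simp add: trunc_def)
qed

lemma trunc_tendsto: "(\<lambda>n. trunc n g \<xi>) \<longlonglongrightarrow> g \<xi>"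
  by (rule tendsto_eventually[OF trunc_eventually])

lemma norm_trunc_le: "cmod (trunc n g \<xi>) \<le> cmod (g \<xi>)"
  by (simp add: trunc_def)

text \<open>Truncations are nested: where \<open>trunc n g\<close> equals \<open>g\<close>, so does
  \<open>trunc m g\<close>. A Cauchy difference is thus controlled by the tail at \<open>n\<close>
  alone, the form that \<open>fast_subsequence\<close> expects.\<close>

lemma norm_trunc_diff_le: "n \<le> m \<Longrightarrow> cmod (trunc n g \<xi> - trunc m g \<xi>) \<le> cmod (g \<xi> - trunc n g \<xi>)"
  by (auto simp: trunc_def)

lemma ft2_tendsto_trunc:
  assumes g: "integrable lborel g"
  shows "(\<lambda>n. ft2 \<sigma> (trunc n g) x) \<longlonglongrightarrow> ft2 \<sigma> g x"
  unfolding ft2_def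
proof (rule integral_dominated_convergence[where w="\<lambda>\<xi>. cmod (g \<xi>)"])
  have [measurable]: "g \<in> borel_measurable borel" using g by auto
  show "(\<lambda>\<xi>. cis (\<sigma> * (x \<bullet> \<xi>)) * g \<xi>) \<in> borel_measurable lborel"
    "(\<lambda>\<xi>. cis (\<sigma> * (x \<bullet> \<xi>)) * trunc n g \<xi>) \<in> borel_measurable lborel" for n
    by measurable
  show "AE \<xi> in lborel. (\<lambda>n. cis (\<sigma> * (x \<bullet> \<xi>)) * trunc n g \<xi>) \<longlonglongrightarrow> cis (\<sigma> * (x \<bullet> \<xi>)) * g \<xi>"
    by (intro AE_I2 tendsto_mult trunc_tendsto tendsto_const)
qed (use g norm_trunc_le in auto)

lemma plancherel_plane_1:
  assumes g: "integrable lborel g"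
  shows "l2sq (ft2 1 g) \<le> ennreal ((2 * pi)\<^sup>2) * l2sq g"
proof (rule nn_integral_le_of_tendsto)
  have [measurable]: "g \<in> borel_measurable borel" using g by auto
  show "(\<lambda>x. ennreal ((cmod (ft2 1 (trunc n g) x))\<^sup>2)) \<in> borel_measurable lborel" for n
    by measurable
  show "AE x in lborel. (\<lambda>n. ennreal ((cmod (ft2 1 (trunc n g) x))\<^sup>2)) \<longlonglongrightarrow> ennreal ((cmod (ft2 1 g x))\<^sup>2)"
    by (intro AE_I2 tendsto_ennrealI tendsto_power tendsto_norm ft2_tendsto_trunc g)
  show "l2sq (ft2 1 (trunc n g)) \<le> ennreal ((2 * pi)\<^sup>2) * l2sq g" for n
  proof -
    have "l2sq (ft2 1 (trunc n g)) \<le> ennreal ((2 * pi)\<^sup>2) * l2sq (trunc n g)"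
      by (intro plancherel_tame tame_trunc) measurable
    also have "\<dots> \<le> ennreal ((2 * pi)\<^sup>2) * l2sq g"
      by (intro mult_left_mono nn_integral_mono ennreal_leI power_mono norm_trunc_le) auto
    finally show ?thesis .
  qed
qed simp

text \<open>Complex conjugation of \<open>g\<close> and of its transform reduces the negative sign
  to the positive one.\<close>

lemma plancherel_plane:
  assumes g: "integrable lborel g" and \<sigma>: "\<bar>\<sigma>\<bar> = 1"
  shows "l2sq (ft2 \<sigma> g) \<le> ennreal ((2 * pi)\<^sup>2) * l2sq g"
proof (cases "\<sigma> = 1")
  case False
  then have \<sigma>: "\<sigma> = -1" using \<sigma> by linarith
  have "ft2 \<sigma> g x = cnj (ft2 1 (\<lambda>\<xi>. cnj (g \<xi>)) x)" for x
  proof -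
    have "cnj (ft2 1 (\<lambda>\<xi>. cnj (g \<xi>)) x) = (\<integral>\<xi>. cnj (cis (1 * (x \<bullet> \<xi>)) * cnj (g \<xi>)) \<partial>lborel)"
      unfolding ft2_def by (rule Bochner_Integration.integral_cnj[symmetric])
    also have "\<dots> = ft2 \<sigma> g x"
      unfolding ft2_def \<sigma> by (simp only: complex_cnj_mult cis_cnj complex_cnj_cnj mult_minus_left mult_1)
    finally show ?thesis by simp
  qed
  then show ?thesis
    using plancherel_plane_1[of "\<lambda>\<xi>. cnj (g \<xi>)"] g by simp
qed (use plancherel_plane_1[OF g] in simp)

section \<open>Oscillatory integrals as limits in mean square\<close>

lemma indicator_eventually_cball:
  "\<forall>\<^sub>F r in at_top. indicator (cball 0 r) (y :: 'a::real_normed_vector) = (1 :: real)"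
  using eventually_ge_at_top[of "norm y"] by eventually_elim simp

lemma integrable_L2_cutoff:
  fixes g :: "'a::euclidean_space \<Rightarrow> complex"
  assumes [measurable]: "g \<in> borel_measurable borel" and fin: "l2sq g < top"
  shows "integrable lborel (\<lambda>y. indicator (cball 0 r) y *\<^sub>R g y)"
proof (rule integrableI_bounded)
  have "(\<integral>\<^sup>+ x. ennreal (norm (indicator (cball 0 r) x *\<^sub>R g x)) \<partial>lborel)
      \<le> (\<integral>\<^sup>+ x. indicator (cball 0 r) x + ennreal ((cmod (g x))\<^sup>2) \<partial>lborel)"
  proof (rule nn_integral_mono)
    fix x
    have "cmod (g x) \<le> 1 + (cmod (g x))\<^sup>2"
      using zero_le_power2[of "cmod (g x) - 1/2"] by (simp add: power2_diff power_divide)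
    then have "ennreal (cmod (g x)) \<le> 1 + ennreal ((cmod (g x))\<^sup>2)"
      using ennreal_leI[of "cmod (g x)" "1 + (cmod (g x))\<^sup>2"] by simp
    then show "ennreal (norm (indicator (cball 0 r) x *\<^sub>R g x))
        \<le> indicator (cball 0 r) x + ennreal ((cmod (g x))\<^sup>2)"
      by (simp add: indicator_def)
  qed
  also have "\<dots> = emeasure lborel (cball (0::'a) r) + l2sq g"
    by (subst nn_integral_add) auto
  also have "\<dots> < \<infinity>"
    using fin emeasure_bounded_finite[of "cball (0::'a) r"] by simp
  finally show "(\<integral>\<^sup>+ x. ennreal (norm (indicator (cball 0 r) x *\<^sub>R g x)) \<partial>lborel) < \<infinity>" .
qed measurable

lemma L2_cutoff_tendsto_0:
  fixes g :: "'a::euclidean_space \<Rightarrow> complex"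
  assumes [measurable]: "g \<in> borel_measurable borel" and fin: "l2sq g < top"
  shows "((\<lambda>r. l2sq (\<lambda>y. g y - indicator (cball 0 r) y *\<^sub>R g y)) \<longlongrightarrow> 0) at_top"
proof (rule tendsto_at_topI_sequentially)
  fix X :: "nat \<Rightarrow> real" assume X: "filterlim X at_top sequentially"
  have "(\<lambda>n. \<integral>\<^sup>+y. ennreal ((cmod (g y - indicator (cball 0 (X n)) y *\<^sub>R g y))\<^sup>2) \<partial>lborel)
      \<longlonglongrightarrow> (\<integral>\<^sup>+(y::'a). 0 \<partial>lborel)"
  proof (rule nn_integral_dominated_convergence[where w="\<lambda>y. ennreal ((cmod (g y))\<^sup>2)"])
    show "AE y in lborel. ennreal ((cmod (g y - indicator (cball 0 (X n)) y *\<^sub>R g y))\<^sup>2)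
        \<le> ennreal ((cmod (g y))\<^sup>2)" for n
      by (rule AE_I2) (auto simp: indicator_def)
    show "AE y in lborel. (\<lambda>n. ennreal ((cmod (g y - indicator (cball 0 (X n)) y *\<^sub>R g y))\<^sup>2)) \<longlonglongrightarrow> 0"
    proof (rule AE_I2)
      fix y :: 'a
      have "\<forall>\<^sub>F n in sequentially. indicator (cball 0 (X n)) y = (1 :: real)"
        using indicator_eventually_cball X by (rule eventually_compose_filterlim)
      then have "\<forall>\<^sub>F n in sequentially. ennreal ((cmod (g y - indicator (cball 0 (X n)) y *\<^sub>R g y))\<^sup>2) = 0"
        by eventually_elim simp
      then show "(\<lambda>n. ennreal ((cmod (g y - indicator (cball 0 (X n)) y *\<^sub>R g y))\<^sup>2)) \<longlonglongrightarrow> 0"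
        by (rule tendsto_eventually)
    qed
  qed (use fin in auto)
  then show "(\<lambda>n. l2sq (\<lambda>y. g y - indicator (cball 0 (X n)) y *\<^sub>R g y)) \<longlonglongrightarrow> 0" by simp
qed

text \<open>The disc integrals are the transforms of the cutoffs \<open>c r\<close> of
  \<open>g\<close>. Plancherel compares them with the transforms of \<open>h n\<close>; Fatou in
  \<open>n\<close> then bounds the distance of \<open>F\<close> to the disc integrals by the tail of
  \<open>g\<close> outside the disc. The double factor comes from the triangle inequality for
  squares.\<close>

lemma has_L2_integral_limit:
  fixes g :: "real^2 \<Rightarrow> complex"
  assumes [measurable]: "g \<in> borel_measurable borel" and fin: "l2sq g < top" and \<sigma>: "\<bar>\<sigma>\<bar> = 1"
    and gn: "\<And>n. integrable lborel (h n)" and lim: "(\<lambda>n. l2sq (\<lambda>\<xi>. g \<xi> - h n \<xi>)) \<longlonglongrightarrow> 0"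
    and [measurable]: "F \<in> borel_measurable borel"
    and F: "AE x in lborel. (\<lambda>n. ft2 \<sigma> (h n) x) \<longlonglongrightarrow> F x"
  shows "has_L2_integral (\<lambda>x \<xi>. cis (\<sigma> * (x \<bullet> \<xi>)) * g \<xi>) F"
    and "l2sq F \<le> ennreal (2 * (2 * pi)\<^sup>2) * l2sq g"
proof -
  have [measurable]: "h n \<in> borel_measurable borel" for n using gn[of n] by auto
  define c where "c r = (\<lambda>\<xi>. indicator (cball 0 r) \<xi> *\<^sub>R g \<xi>)" for r :: real
  have [measurable]: "c r \<in> borel_measurable borel" for r unfolding c_def by measurable
  have ci: "integrable lborel (c r)" for r unfolding c_def by (intro integrable_L2_cutoff fin) measurable
  have S: "(LINT y:cball 0 r|lborel. cis (\<sigma> * (x \<bullet> y)) * g y) = ft2 \<sigma> (c r) x" for r x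
    unfolding set_lebesgue_integral_def ft2_def c_def by simp
  have le: "l2sq (\<lambda>x. F x - ft2 \<sigma> (c r) x) \<le> ennreal (2 * (2 * pi)\<^sup>2) * l2sq (\<lambda>\<xi>. g \<xi> - c r \<xi>)" for r
  proof (rule nn_integral_le_of_tendsto)
    show "(\<lambda>x. ennreal ((cmod (ft2 \<sigma> (h n) x - ft2 \<sigma> (c r) x))\<^sup>2)) \<in> borel_measurable lborel" for n
      by measurable
    show "AE x in lborel. (\<lambda>n. ennreal ((cmod (ft2 \<sigma> (h n) x - ft2 \<sigma> (c r) x))\<^sup>2))
        \<longlonglongrightarrow> ennreal ((cmod (F x - ft2 \<sigma> (c r) x))\<^sup>2)"
      using F by eventually_elim (intro tendsto_ennrealI tendsto_power tendsto_norm tendsto_diff tendsto_const)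
    show "l2sq (\<lambda>x. ft2 \<sigma> (h n) x - ft2 \<sigma> (c r) x)
        \<le> ennreal ((2 * pi)\<^sup>2) * (2 * l2sq (\<lambda>\<xi>. g \<xi> - h n \<xi>) + 2 * l2sq (\<lambda>\<xi>. g \<xi> - c r \<xi>))" for n
    proof -
      have "l2sq (\<lambda>x. ft2 \<sigma> (h n) x - ft2 \<sigma> (c r) x) = l2sq (ft2 \<sigma> (\<lambda>\<xi>. h n \<xi> - c r \<xi>))"
        by (simp add: ft2_diff[OF gn ci])
      also have "\<dots> \<le> ennreal ((2 * pi)\<^sup>2) * l2sq (\<lambda>\<xi>. h n \<xi> - c r \<xi>)"
        by (intro plancherel_plane Bochner_Integration.integrable_diff gn ci \<sigma>)
      also have "l2sq (\<lambda>\<xi>. h n \<xi> - c r \<xi>) = l2sq (\<lambda>\<xi>. (h n \<xi> - g \<xi>) + (g \<xi> - c r \<xi>))"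
        by simp
      also have "\<dots> \<le> 2 * l2sq (\<lambda>\<xi>. h n \<xi> - g \<xi>) + 2 * l2sq (\<lambda>\<xi>. g \<xi> - c r \<xi>)"
        by (rule l2sq_add_le) measurable
      finally show ?thesis
        by (simp add: norm_minus_commute mult_left_mono)
    qed
    have "(\<lambda>n. ennreal ((2 * pi)\<^sup>2) * (2 * l2sq (\<lambda>\<xi>. g \<xi> - h n \<xi>) + 2 * l2sq (\<lambda>\<xi>. g \<xi> - c r \<xi>)))
      \<longlonglongrightarrow> ennreal ((2 * pi)\<^sup>2) * (2 * 0 + 2 * l2sq (\<lambda>\<xi>. g \<xi> - c r \<xi>))"
      by (intro ennreal_tendsto_cmult tendsto_add lim tendsto_const) auto
    then show "(\<lambda>n. ennreal ((2 * pi)\<^sup>2) * (2 * l2sq (\<lambda>\<xi>. g \<xi> - h n \<xi>) + 2 * l2sq (\<lambda>\<xi>. g \<xi> - c r \<xi>)))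
      \<longlonglongrightarrow> ennreal (2 * (2 * pi)\<^sup>2) * l2sq (\<lambda>\<xi>. g \<xi> - c r \<xi>)"
      by (simp add: ennreal_mult' ac_simps)
  qed
  \<comment> \<open>The disc of radius 0 is a null set, so \<open>le\<close> at \<open>r = 0\<close>
    is the norm bound for \<open>F\<close> itself.\<close>
  have AE0: "AE \<xi> in lborel. c 0 \<xi> = 0"
    using AE_lborel_singleton[of "0 :: real^2"] by eventually_elim (auto simp: c_def)
  have "ft2 \<sigma> (c 0) x = 0" for x
    unfolding ft2_def by (rule integral_eq_zero_AE) (use AE0 in eventually_elim, simp)
  moreover have "l2sq (\<lambda>\<xi>. g \<xi> - c 0 \<xi>) = l2sq g"
    by (rule nn_integral_cong_AE) (use AE0 in eventually_elim, simp)
  ultimately show F_le: "l2sq F \<le> ennreal (2 * (2 * pi)\<^sup>2) * l2sq g"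
    using le[of 0] by simp
  have "((\<lambda>r. L2_norm (\<lambda>x. F x - ft2 \<sigma> (c r) x)) \<longlongrightarrow> 0) at_top"
  proof (rule L2_norm_tendsto_0)
    have "((\<lambda>r. ennreal (2 * (2 * pi)\<^sup>2) * l2sq (\<lambda>\<xi>. g \<xi> - c r \<xi>)) \<longlongrightarrow> ennreal (2 * (2 * pi)\<^sup>2) * 0) at_top"
      unfolding c_def by (intro ennreal_tendsto_cmult L2_cutoff_tendsto_0 fin) auto
    then have lim0: "((\<lambda>r. ennreal (2 * (2 * pi)\<^sup>2) * l2sq (\<lambda>\<xi>. g \<xi> - c r \<xi>)) \<longlongrightarrow> 0) at_top"
      by (simp only: mult_zero_right)
    show "((\<lambda>r. l2sq (\<lambda>x. F x - ft2 \<sigma> (c r) x)) \<longlongrightarrow> 0) at_top"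
      by (rule tendsto_sandwich[OF always_eventually always_eventually tendsto_const lim0])
         (simp_all only: le zero_le simp_thms)
  qed
  moreover have "in_L2 F"
    using le_less_trans[OF F_le, of top] fin
    by (simp add: in_L2_def L2_norm_less_top_iff ennreal_mult_less_top)
  ultimately show "has_L2_integral (\<lambda>x \<xi>. cis (\<sigma> * (x \<bullet> \<xi>)) * g \<xi>) F"
    by (simp add: has_L2_integral_def S)
qed

lemma trunc_weighted_tendsto_0:
  fixes g :: "'a::euclidean_space \<Rightarrow> complex"
  assumes [measurable]: "g \<in> borel_measurable borel" "w \<in> borel_measurable borel"
    and fin: "(\<integral>\<^sup>+\<xi>. ennreal (w \<xi> * (cmod (g \<xi>))\<^sup>2) \<partial>lborel) < top" and w: "\<And>\<xi>. w \<xi> \<ge> 0"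
  shows "(\<lambda>n. \<integral>\<^sup>+\<xi>. ennreal (w \<xi> * (cmod (g \<xi> - trunc n g \<xi>))\<^sup>2) \<partial>lborel) \<longlonglongrightarrow> 0"
proof -
  have "(\<lambda>n. \<integral>\<^sup>+\<xi>. ennreal (w \<xi> * (cmod (g \<xi> - trunc n g \<xi>))\<^sup>2) \<partial>lborel) \<longlonglongrightarrow> (\<integral>\<^sup>+(\<xi>::'a). 0 \<partial>lborel)"
  proof (rule nn_integral_dominated_convergence[where w="\<lambda>\<xi>. ennreal (w \<xi> * (cmod (g \<xi>))\<^sup>2)"])
    show "AE \<xi> in lborel. ennreal (w \<xi> * (cmod (g \<xi> - trunc n g \<xi>))\<^sup>2) \<le> ennreal (w \<xi> * (cmod (g \<xi>))\<^sup>2)" for n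
      by (rule AE_I2) (auto simp: trunc_def w)
    show "AE \<xi> in lborel. (\<lambda>n. ennreal (w \<xi> * (cmod (g \<xi> - trunc n g \<xi>))\<^sup>2)) \<longlonglongrightarrow> 0"
    proof (rule AE_I2)
      fix \<xi> :: 'a
      show "(\<lambda>n. ennreal (w \<xi> * (cmod (g \<xi> - trunc n g \<xi>))\<^sup>2)) \<longlonglongrightarrow> 0"
        by (rule tendsto_eventually, use trunc_eventually[of g \<xi>] in eventually_elim) simp
    qed
  qed (use fin in auto)
  then show ?thesis by simp
qed

lemma convergent_of_summable_steps:
  fixes f :: "nat \<Rightarrow> 'a::banach"
  assumes "(\<Sum>k. ennreal (norm (f (Suc k) - f k))) < top"
  shows "convergent f"
proof -
  have "summable (\<lambda>k. norm (f (Suc k) - f k))"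
    using assms by (intro summable_suminf_not_top) auto
  then have "summable (\<lambda>k. f (Suc k) - f k)" by (rule summable_norm_cancel)
  then have "convergent (\<lambda>n. \<Sum>k<n. f (Suc k) - f k)" by (simp add: summable_iff_convergent)
  then have "convergent (\<lambda>n. f n - f 0)" by (simp add: sum_lessThan_telescope)
  then have "convergent (\<lambda>n. (f n - f 0) + f 0)" by (intro convergent_add convergent_const)
  then show ?thesis by simp
qed

text \<open>Completeness of the space of square-integrable functions, obtained by hand: along a fast
  subsequence the transforms of the truncations converge almost everywhere, and the pointwise limit
  is the required function.\<close>

lemma has_L2_integral_exists:
  fixes g :: "real^2 \<Rightarrow> complex"
  assumes [measurable]: "g \<in> borel_measurable borel" and fin: "l2sq g < top" and \<sigma>: "\<bar>\<sigma>\<bar> = 1"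
  shows "\<exists>F. has_L2_integral (\<lambda>x \<xi>. cis (\<sigma> * (x \<bullet> \<xi>)) * g \<xi>) F"
proof -
  define D where "D n m x = ennreal (cmod (ft2 \<sigma> (trunc m g) x - ft2 \<sigma> (trunc n g) x))" for n m x
  have ti: "integrable lborel (trunc n g)" for n by (intro tame_integrable tame_trunc) measurable
  have lim: "(\<lambda>n. l2sq (\<lambda>\<xi>. g \<xi> - trunc n g \<xi>)) \<longlonglongrightarrow> 0"
    using trunc_weighted_tendsto_0[of g "\<lambda>_. 1"] fin by simp
  have "\<exists>r. strict_mono r \<and> (AE x in lborel. (\<Sum>k. D (r k) (r (Suc k)) x) < top)"
  proof (rule fast_subsequence[where A="\<lambda>_. UNIV" and c="\<lambda>_. (2 * pi)\<^sup>2"])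
    show "D n m \<in> borel_measurable lborel" for n m unfolding D_def by measurable
    show "(\<lambda>n. l2sq (\<lambda>\<xi>. g \<xi> - trunc n g \<xi>)) \<longlonglongrightarrow> 0" by (rule lim)
    show "(\<integral>\<^sup>+x\<in>UNIV. (D n m x)\<^sup>2 \<partial>lborel) \<le> ennreal ((2 * pi)\<^sup>2) * l2sq (\<lambda>\<xi>. g \<xi> - trunc n g \<xi>)"
      if "n \<le> m" for n m
    proof -
      have "(\<integral>\<^sup>+x\<in>UNIV. (D n m x)\<^sup>2 \<partial>lborel) = l2sq (ft2 \<sigma> (\<lambda>\<xi>. trunc m g \<xi> - trunc n g \<xi>))"
        by (simp add: D_def ft2_diff[OF ti ti] ennreal_power)
      also have "\<dots> \<le> ennreal ((2 * pi)\<^sup>2) * l2sq (\<lambda>\<xi>. trunc m g \<xi> - trunc n g \<xi>)"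
        by (intro plancherel_plane Bochner_Integration.integrable_diff ti \<sigma>)
      also have "\<dots> \<le> ennreal ((2 * pi)\<^sup>2) * l2sq (\<lambda>\<xi>. g \<xi> - trunc n g \<xi>)"
        using norm_trunc_diff_le[OF that, of g]
        by (intro mult_left_mono nn_integral_mono ennreal_leI power_mono) (auto simp: norm_minus_commute)
      finally show ?thesis .
    qed
  qed auto
  then obtain r where r: "strict_mono r" and AE: "AE x in lborel. (\<Sum>k. D (r k) (r (Suc k)) x) < top"
    by blast
  define F where "F x = lim (\<lambda>k. ft2 \<sigma> (trunc (r k) g) x)" for x
  have conv: "AE x in lborel. (\<lambda>k. ft2 \<sigma> (trunc (r k) g) x) \<longlonglongrightarrow> F x"
    using AE
  proof eventually_elim
    case (elim x)
    then have "convergent (\<lambda>k. ft2 \<sigma> (trunc (r k) g) x)"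
      unfolding D_def by (rule convergent_of_summable_steps)
    then show ?case unfolding F_def by (simp add: convergent_LIMSEQ_iff)
  qed
  have "has_L2_integral (\<lambda>x \<xi>. cis (\<sigma> * (x \<bullet> \<xi>)) * g \<xi>) F"
  proof (rule has_L2_integral_limit(1)[OF _ fin \<sigma>, of "\<lambda>k. trunc (r k) g"])
    show "(\<lambda>n. l2sq (\<lambda>\<xi>. g \<xi> - trunc (r n) g \<xi>)) \<longlonglongrightarrow> 0"
      using LIMSEQ_subseq_LIMSEQ[OF lim r] by (simp add: o_def)
    show "F \<in> borel_measurable borel" unfolding F_def by measurable
  qed (use ti conv in auto)
  then show ?thesis by blast
qed

text \<open>This makes the choice in \<open>fourier\<close> meaningful: for square-integrable
  \<open>f\<close> the chosen function really is a transform of \<open>f\<close>.\<close>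

lemma is_fourier_exists:
  assumes "in_L2 f"
  shows "\<exists>g. is_fourier f g"
proof -
  have [measurable]: "f \<in> borel_measurable borel" and "l2sq f < top"
    using assms by (auto simp: in_L2_def L2_norm_less_top_iff)
  have "l2sq (\<lambda>x. f x / (2 * pi)\<^sup>2) = (\<integral>\<^sup>+x. ennreal (1 / (2 * pi)^4) * ennreal ((cmod (f x))\<^sup>2) \<partial>lborel)"
  proof (intro nn_integral_cong)
    fix x
    have "cmod (f x / (2 * pi)\<^sup>2) = cmod (f x) / (2 * pi)\<^sup>2"
      by (simp add: norm_divide norm_mult norm_power)
    then have "(cmod (f x / (2 * pi)\<^sup>2))\<^sup>2 = 1 / (2 * pi)^4 * (cmod (f x))\<^sup>2"
      by (simp add: power_divide flip: power_mult)
    then show "ennreal ((cmod (f x / (2 * pi)\<^sup>2))\<^sup>2) = ennreal (1 / (2 * pi)^4) * ennreal ((cmod (f x))\<^sup>2)"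
      by (simp only:) (rule ennreal_mult, auto)
  qed
  also have "\<dots> < top"
    using \<open>l2sq f < top\<close> by (simp add: nn_integral_cmult ennreal_mult_less_top)
  finally have "\<exists>F. has_L2_integral (\<lambda>x \<xi>. cis (- 1 * (x \<bullet> \<xi>)) * (f \<xi> / (2 * pi)\<^sup>2)) F"
    by (intro has_L2_integral_exists) auto
  then show ?thesis by (simp add: is_fourier_def inner_commute)
qed

lemma is_fourier_fourier: "in_L2 f \<Longrightarrow> is_fourier f (fourier f)"
  unfolding fourier_def using someI_ex[OF is_fourier_exists] .

section \<open>The evolution of a tame datum\<close>

text \<open>Parametrised by the transform \<open>g\<close> and not by the datum, so that truncations
  and frequency cutoffs act on \<open>g\<close> directly and the choice hidden in
  \<open>fourier\<close> stays out of the estimates.\<close>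

definition evo :: "(real^2 \<Rightarrow> real) \<Rightarrow> (real^2 \<Rightarrow> complex) \<Rightarrow> real \<Rightarrow> real^2 \<Rightarrow> complex" where
  "evo P g t = ft2 1 (\<lambda>\<xi>. cis (t * P \<xi>) * g \<xi>)"

lemma evo_measurable [measurable]:
  assumes [measurable]: "P \<in> borel_measurable borel" "g \<in> borel_measurable borel"
  shows "evo P g t \<in> borel_measurable borel"
  unfolding evo_def by measurable

lemma evo_diff:
  assumes "P \<in> borel_measurable borel" "integrable lborel f" "integrable lborel g"
  shows "evo P (\<lambda>\<xi>. f \<xi> - g \<xi>) t x = evo P f t x - evo P g t x"
proof -
  have "(\<lambda>\<xi>. cis (t * P \<xi>) * (f \<xi> - g \<xi>)) = (\<lambda>\<xi>. cis (t * P \<xi>) * f \<xi> - cis (t * P \<xi>) * g \<xi>)"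
    by (simp add: right_diff_distrib)
  then show ?thesis
    unfolding evo_def using assms by (simp add: ft2_diff integrable_cis_mult)
qed

lemma evo_add:
  assumes "P \<in> borel_measurable borel" "integrable lborel f" "integrable lborel g"
  shows "evo P (\<lambda>\<xi>. f \<xi> + g \<xi>) t x = evo P f t x + evo P g t x"
proof -
  have "(\<lambda>\<xi>. cis (t * P \<xi>) * (f \<xi> + g \<xi>)) = (\<lambda>\<xi>. cis (t * P \<xi>) * f \<xi> + cis (t * P \<xi>) * g \<xi>)"
    by (simp add: distrib_left)
  then show ?thesis
    unfolding evo_def using assms by (simp add: ft2_add integrable_cis_mult)
qed

lemma evo_sum:
  assumes "P \<in> borel_measurable borel" "\<And>k. k \<in> F \<Longrightarrow> integrable lborel (g k)"
  shows "evo P (\<lambda>\<xi>. \<Sum>k\<in>F. g k \<xi>) t x = (\<Sum>k\<in>F. evo P (g k) t x)"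
  using assms(2)
proof (induction F rule: infinite_finite_induct)
  case (insert k F)
  have "evo P (\<lambda>\<xi>. g k \<xi> + (\<Sum>k\<in>F. g k \<xi>)) t x = evo P (g k) t x + evo P (\<lambda>\<xi>. \<Sum>k\<in>F. g k \<xi>) t x"
    using insert.prems by (intro evo_add assms(1) Bochner_Integration.integrable_sum) auto
  then show ?case using insert by simp
qed (simp_all add: evo_def ft2_def)

lemma continuous_on_evo:
  assumes [measurable]: "P \<in> borel_measurable borel" and g: "integrable lborel g"
  shows "continuous_on T (\<lambda>t. evo P g t x)"
proof (rule continuous_on_sequentiallyI)
  fix X :: "nat \<Rightarrow> real" and a assume X: "X \<longlonglongrightarrow> a"
  have [measurable]: "g \<in> borel_measurable borel" using g by auto
  show "(\<lambda>n. evo P g (X n) x) \<longlonglongrightarrow> evo P g a x"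
    unfolding evo_def ft2_def
  proof (rule integral_dominated_convergence[where w="\<lambda>\<xi>. cmod (g \<xi>)"])
    show "(\<lambda>\<xi>. cis (1 * (x \<bullet> \<xi>)) * (cis (a * P \<xi>) * g \<xi>)) \<in> borel_measurable lborel"
      "(\<lambda>\<xi>. cis (1 * (x \<bullet> \<xi>)) * (cis (X n * P \<xi>) * g \<xi>)) \<in> borel_measurable lborel" for n
      by measurable
    show "AE \<xi> in lborel. (\<lambda>n. cis (1 * (x \<bullet> \<xi>)) * (cis (X n * P \<xi>) * g \<xi>))
        \<longlonglongrightarrow> cis (1 * (x \<bullet> \<xi>)) * (cis (a * P \<xi>) * g \<xi>)"
    proof (rule AE_I2)
      fix \<xi>
      show "(\<lambda>n. cis (1 * (x \<bullet> \<xi>)) * (cis (X n * P \<xi>) * g \<xi>))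
        \<longlonglongrightarrow> cis (1 * (x \<bullet> \<xi>)) * (cis (a * P \<xi>) * g \<xi>)"
        unfolding cis_conv_exp by (intro tendsto_intros X)
    qed
  qed (use g in auto)
qed

lemma maximal_eq_rat:
  assumes "continuous_on {0<..<1} (\<lambda>t. u t x)"
  shows "maximal u x = (SUP t\<in>\<rat> \<inter> {0<..<1}. ennreal (cmod (u t x)))"
proof (rule antisym)
  show "(SUP t\<in>\<rat> \<inter> {0<..<1}. ennreal (cmod (u t x))) \<le> maximal u x"
    unfolding maximal_def by (rule SUP_subset_mono) auto
  show "maximal u x \<le> (SUP t\<in>\<rat> \<inter> {0<..<1}. ennreal (cmod (u t x)))"
    unfolding maximal_def
  proof (rule SUP_least)
    fix t :: real assume t: "t \<in> {0<..<1}"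
    have "t \<in> closure (\<rat> \<inter> {0<..<1})"
      unfolding closure_approachable
    proof (intro allI impI)
      fix e :: real assume "e > 0"
      with t obtain q where "q \<in> \<rat>" "max 0 (t - e) < q" "q < t"
        using Rats_dense_in_real[of "max 0 (t - e)" t] by auto
      with t show "\<exists>y\<in>\<rat> \<inter> {0<..<1}. dist y t < e"
        by (intro bexI[of _ q]) (auto simp: dist_real_def)
    qed
    then obtain q where q: "\<And>n. q n \<in> \<rat> \<inter> {0<..<1}" "q \<longlonglongrightarrow> t"
      unfolding closure_sequential by blast
    have "(\<lambda>n. u (q n) x) \<longlonglongrightarrow> u t x"
      using q(1) by (intro continuous_on_tendsto_compose[OF assms q(2) t]) simp
    then have "(\<lambda>n. ennreal (cmod (u (q n) x))) \<longlonglongrightarrow> ennreal (cmod (u t x))"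
      by (intro tendsto_ennrealI tendsto_norm)
    then show "ennreal (cmod (u t x)) \<le> (SUP t\<in>\<rat> \<inter> {0<..<1}. ennreal (cmod (u t x)))"
    proof (rule LIMSEQ_le_const2, intro exI allI impI)
      fix n
      show "ennreal (cmod (u (q n) x)) \<le> (SUP t\<in>\<rat> \<inter> {0<..<1}. ennreal (cmod (u t x)))"
        by (rule SUP_upper[OF q(1)])
    qed
  qed
qed

lemma borel_measurable_maximal:
  assumes [measurable]: "\<And>t. u t \<in> borel_measurable borel"
    and "\<And>x. continuous_on {0<..<1} (\<lambda>t. u t x)"
  shows "maximal u \<in> borel_measurable borel"
proof -
  have "maximal u = (\<lambda>x. SUP t\<in>\<rat> \<inter> {0<..<1}. ennreal (cmod (u t x)))"
    using maximal_eq_rat assms(2) by blast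
  moreover have "countable (\<rat> \<inter> {0<..<1::real})" using countable_rat by blast
  ultimately show ?thesis by simp
qed

lemma borel_measurable_maximal_evo [measurable]:
  assumes "P \<in> borel_measurable borel" "integrable lborel g"
  shows "maximal (evo P g) \<in> borel_measurable borel"
  using assms by (intro borel_measurable_maximal evo_measurable continuous_on_evo) auto

section \<open>Freezing one space variable\<close>

text \<open>With \<open>x $ 2\<close> frozen, Plancherel in the first variable and Cauchy--Schwarz in the second
  one against the weight \<open>\<rho>\<close> replace the local smoothing estimate.\<close>

lemma freeze_plancherel:
  assumes g: "tame g" and [measurable]: "\<rho> \<in> borel_measurable borel"
    and pos: "\<And>\<xi>. g \<xi> \<noteq> 0 \<Longrightarrow> \<rho> \<xi> > 0" and A: "A \<ge> 0"
    and level: "\<And>a. (\<integral>\<^sup>+b. ennreal (if g (pt a b) \<noteq> 0 then \<rho> (pt a b) else 0) \<partial>lborel) \<le> ennreal A"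
  shows "(\<integral>\<^sup>+y. ennreal ((cmod (ft2 1 g (pt y z)))\<^sup>2) \<partial>lborel)
    \<le> ennreal (2 * pi * A) * (\<integral>\<^sup>+\<xi>. ennreal ((cmod (g \<xi>))\<^sup>2 / \<rho> \<xi>) \<partial>lborel)"
proof -
  have [measurable]: "g \<in> borel_measurable borel" using g by (rule tame_measurable)
  have "(\<integral>\<^sup>+y. ennreal ((cmod (ft2 1 g (pt y z)))\<^sup>2) \<partial>lborel)
    \<le> ennreal (2 * pi) * l2sq (\<lambda>a. ft (\<lambda>b. g (pt a b)) z)"
    using plancherel[OF tame_integrable[OF tame_ft_slice[OF g, of z]]]
    by (simp add: ft2_plane[OF tame_integrable[OF g]])
  also have "l2sq (\<lambda>a. ft (\<lambda>b. g (pt a b)) z)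
      \<le> (\<integral>\<^sup>+a. ennreal A * (\<integral>\<^sup>+b. ennreal ((cmod (g (pt a b)))\<^sup>2 / \<rho> (pt a b)) \<partial>lborel) \<partial>lborel)"
  proof (rule nn_integral_mono)
    fix a
    \<comment> \<open>The slice of \<open>g\<close> is factored as \<open>sqrt \<rho>\<close> times
      the modulus of \<open>g\<close> over \<open>sqrt \<rho>\<close>. The first factor is set to 0
      off the support, so that its square integrates to the quantity in
      \<open>level\<close>.\<close>
    define p where "p b = ennreal (sqrt (if g (pt a b) \<noteq> 0 then \<rho> (pt a b) else 0))" for b
    define q where "q b = ennreal (cmod (g (pt a b)) / sqrt (\<rho> (pt a b)))" for b
    have [measurable]: "p \<in> borel_measurable borel" "q \<in> borel_measurable borel"
      unfolding p_def[abs_def] q_def[abs_def] by measurable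
    have "ennreal (cmod (ft (\<lambda>b. g (pt a b)) z)) \<le> (\<integral>\<^sup>+b. ennreal (cmod (cis (z * b) * g (pt a b))) \<partial>lborel)"
      unfolding ft_def by (rule norm_integral_le_nn_integral)
    also have "\<dots> = (\<integral>\<^sup>+b. p b * q b \<partial>lborel)"
    proof (rule nn_integral_cong)
      fix b
      show "ennreal (cmod (cis (z * b) * g (pt a b))) = p b * q b"
      proof (cases "g (pt a b) = 0")
        case False
        then have "\<rho> (pt a b) > 0" by (rule pos)
        then show ?thesis using False by (simp add: p_def q_def flip: ennreal_mult)
      qed (simp add: q_def)
    qed
    finally have "(ennreal (cmod (ft (\<lambda>b. g (pt a b)) z)))\<^sup>2 \<le> (\<integral>\<^sup>+b. p b * q b \<partial>lborel)\<^sup>2"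
      by (rule power_mono) simp
    also have "\<dots> \<le> (\<integral>\<^sup>+b. (p b)\<^sup>2 \<partial>lborel) * (\<integral>\<^sup>+b. (q b)\<^sup>2 \<partial>lborel)"
      by (rule Cauchy_Schwarz_nn_integral) auto
    also have "(\<integral>\<^sup>+b. (p b)\<^sup>2 \<partial>lborel) = (\<integral>\<^sup>+b. ennreal (if g (pt a b) \<noteq> 0 then \<rho> (pt a b) else 0) \<partial>lborel)"
    proof (rule nn_integral_cong)
      fix b
      show "(p b)\<^sup>2 = ennreal (if g (pt a b) \<noteq> 0 then \<rho> (pt a b) else 0)"
        using pos[of "pt a b"] by (auto simp: p_def ennreal_power)
    qed
    also have "(\<integral>\<^sup>+b. (q b)\<^sup>2 \<partial>lborel) = (\<integral>\<^sup>+b. ennreal ((cmod (g (pt a b)))\<^sup>2 / \<rho> (pt a b)) \<partial>lborel)"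
    proof (rule nn_integral_cong)
      fix b
      show "(q b)\<^sup>2 = ennreal ((cmod (g (pt a b)))\<^sup>2 / \<rho> (pt a b))"
      proof (cases "g (pt a b) = 0")
        case False
        then have "\<rho> (pt a b) > 0" by (rule pos)
        then show ?thesis using False by (simp add: q_def ennreal_power power_divide)
      qed (simp add: q_def)
    qed
    also have "(\<integral>\<^sup>+b. ennreal (if g (pt a b) \<noteq> 0 then \<rho> (pt a b) else 0) \<partial>lborel)
        * (\<integral>\<^sup>+b. ennreal ((cmod (g (pt a b)))\<^sup>2 / \<rho> (pt a b)) \<partial>lborel)
        \<le> ennreal A * (\<integral>\<^sup>+b. ennreal ((cmod (g (pt a b)))\<^sup>2 / \<rho> (pt a b)) \<partial>lborel)"
      by (intro mult_right_mono level) simp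
    finally show "ennreal ((cmod (ft (\<lambda>b. g (pt a b)) z))\<^sup>2)
        \<le> ennreal A * (\<integral>\<^sup>+b. ennreal ((cmod (g (pt a b)))\<^sup>2 / \<rho> (pt a b)) \<partial>lborel)"
      by (simp add: ennreal_power)
  qed
  also have "\<dots> = ennreal A * (\<integral>\<^sup>+\<xi>. ennreal ((cmod (g \<xi>))\<^sup>2 / \<rho> \<xi>) \<partial>lborel)"
    by (subst nn_integral_cmult, measurable) (simp add: nn_integral_plane)
  finally show ?thesis
    using A by (simp add: ennreal_mult mult_left_mono mult.assoc)
qed

text \<open>Over \<open>count_space\<close> one statement serves both sums: the Taylor series in
  \<open>j\<close> with weights \<open>fact j\<close>, and the finite sum over bands
  \<open>k\<close> with weights \<open>(1 + \<bar>k\<bar>) powr a\<close>.\<close>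

lemma weighted_Cauchy_Schwarz:
  fixes w :: "'i \<Rightarrow> real" and F :: "'i \<Rightarrow> ennreal"
  assumes w: "\<And>i. w i > 0"
  shows "(\<integral>\<^sup>+i. F i \<partial>count_space I)\<^sup>2
    \<le> (\<integral>\<^sup>+i. ennreal (1 / w i) \<partial>count_space I) * (\<integral>\<^sup>+i. ennreal (w i) * (F i)\<^sup>2 \<partial>count_space I)"
proof -
  have "(\<integral>\<^sup>+i. ennreal (sqrt (1 / w i)) * (ennreal (sqrt (w i)) * F i) \<partial>count_space I)\<^sup>2
    \<le> (\<integral>\<^sup>+i. (ennreal (sqrt (1 / w i)))\<^sup>2 \<partial>count_space I)
      * (\<integral>\<^sup>+i. (ennreal (sqrt (w i)) * F i)\<^sup>2 \<partial>count_space I)"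
    by (rule Cauchy_Schwarz_nn_integral) auto
  moreover have "ennreal (sqrt (1 / w i)) * (ennreal (sqrt (w i)) * F i) = F i" for i
    using w[of i] by (simp add: real_sqrt_divide flip: mult.assoc ennreal_mult)
  moreover have "(ennreal (sqrt (1 / w i)))\<^sup>2 = ennreal (1 / w i)"
    "(ennreal (sqrt (w i)) * F i)\<^sup>2 = ennreal (w i) * (F i)\<^sup>2" for i
    using w[of i] by (simp_all add: ennreal_power power_mult_distrib)
  ultimately show ?thesis by simp
qed

lemma tame_mult_bounded:
  assumes g: "tame g" and [measurable]: "h \<in> borel_measurable borel"
    and "\<And>\<xi>. g \<xi> \<noteq> 0 \<Longrightarrow> cmod (h \<xi>) \<le> C"
  shows "tame (\<lambda>\<xi>. h \<xi> * g \<xi>)"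
proof (rule tame_mono[OF g])
  have [measurable]: "g \<in> borel_measurable borel" using g by (rule tame_measurable)
  show "(\<lambda>\<xi>. h \<xi> * g \<xi>) \<in> borel_measurable borel" by measurable
  show "cmod (h \<xi> * g \<xi>) \<le> C * cmod (g \<xi>)" for \<xi>
    using assms(3)[of \<xi>] by (cases "g \<xi> = 0") (auto simp: norm_mult intro: mult_right_mono)
qed

lemma band_power:
  fixes Q :: "real^2 \<Rightarrow> real"
  assumes g: "tame g" and [measurable]: "Q \<in> borel_measurable borel"
    and band: "\<And>\<xi>. g \<xi> \<noteq> 0 \<Longrightarrow> k \<le> Q \<xi> \<and> Q \<xi> \<le> k + 1"
  shows "cmod (of_real ((Q \<xi> - k) ^ j) * g \<xi>) \<le> cmod (g \<xi>)"
    and "tame (\<lambda>\<xi>. of_real ((Q \<xi> - k) ^ j) * g \<xi>)"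
proof -
  have [measurable]: "g \<in> borel_measurable borel" using g by (rule tame_measurable)
  have le: "cmod (of_real ((Q \<xi> - k) ^ j) * g \<xi>) \<le> cmod (g \<xi>)" for \<xi>
  proof (cases "g \<xi> = 0")
    case False
    then have "\<bar>Q \<xi> - k\<bar> ^ j \<le> 1" using band[of \<xi>] by (intro power_le_one) auto
    then show ?thesis
      using mult_right_mono[of "\<bar>Q \<xi> - k\<bar> ^ j" 1 "cmod (g \<xi>)"]
      by (simp only: norm_mult norm_of_real power_abs norm_ge_zero mult_1)
  qed simp
  then show "cmod (of_real ((Q \<xi> - k) ^ j) * g \<xi>) \<le> cmod (g \<xi>)" .
  show "tame (\<lambda>\<xi>. of_real ((Q \<xi> - k) ^ j) * g \<xi>)"
    using le by (intro tame_mono[OF g, of _ 1]) auto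
qed

text \<open>Where \<open>k \<le> Q \<le> k + 1\<close> the factor \<open>cis (t * (Q - k))\<close> is a power series in \<open>t \<in> {0..1}\<close>,
  which bounds the evolution uniformly in time by integrals free of \<open>t\<close>.\<close>

lemma evo_band_bound:
  assumes g: "tame g" and [measurable]: "Q \<in> borel_measurable borel"
    and band: "\<And>\<xi>. g \<xi> \<noteq> 0 \<Longrightarrow> k \<le> Q \<xi> \<and> Q \<xi> \<le> k + 1" and t: "t \<in> {0..1}"
  shows "ennreal (cmod (evo Q g t x))
    \<le> (\<Sum>j. ennreal (1 / fact j * cmod (ft2 1 (\<lambda>\<xi>. of_real ((Q \<xi> - k) ^ j) * g \<xi>) x)))"
proof -
  have [measurable]: "g \<in> borel_measurable borel" using g by (rule tame_measurable)
  define h where "h j \<xi> = of_real ((Q \<xi> - k) ^ j) * g \<xi>" for j \<xi>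
  have hle: "cmod (h j \<xi>) \<le> cmod (g \<xi>)" and th: "tame (h j)" for j \<xi>
    unfolding h_def by (rule band_power[OF g _ band]; measurable)+
  have [measurable]: "h j \<in> borel_measurable borel" for j using th by (rule tame_measurable)
  define f where "f j \<xi> = ((\<i> * of_real t) ^ j / fact j) * (cis (x \<bullet> \<xi>) * h j \<xi>)" for j \<xi>
  have f_int: "integrable lborel (f j)" for j
    unfolding f_def by (intro integrable_mult_right integrable_cis_mult tame_integrable th) auto
  have fnorm: "norm (f j \<xi>) \<le> (1 / fact j) * cmod (h j \<xi>)" for j \<xi>
  proof -
    have "norm (f j \<xi>) = t ^ j * ((1 / fact j) * cmod (h j \<xi>))"
      using t by (simp add: f_def norm_mult norm_divide norm_power)
    also have "\<dots> \<le> (1 / fact j) * cmod (h j \<xi>)"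
      using t by (intro mult_left_le_one_le) (auto intro: power_le_one)
    finally show ?thesis .
  qed
  have fnorm': "norm (f j \<xi>) \<le> cmod (g \<xi>) * (1 / fact j)" for j \<xi>
    using fnorm[of j \<xi>] mult_left_mono[OF hle[of j \<xi>], of "1 / fact j"] by (simp add: mult.commute)
  have se: "summable (\<lambda>j. 1 / fact j :: real)"
    using summable_exp[of 1] by (simp add: divide_inverse)
  have fsum: "(\<lambda>j. f j \<xi>) sums (cis (x \<bullet> \<xi>) * (cis (t * (Q \<xi> - k)) * g \<xi>))" for \<xi>
  proof -
    have "(\<lambda>j. (\<i> * of_real (t * (Q \<xi> - k))) ^ j /\<^sub>R fact j) sums exp (\<i> * of_real (t * (Q \<xi> - k)))"
      by (rule exp_converges)
    then have "(\<lambda>j. (\<i> * of_real (t * (Q \<xi> - k))) ^ j /\<^sub>R fact j * (cis (x \<bullet> \<xi>) * g \<xi>))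
      sums (exp (\<i> * of_real (t * (Q \<xi> - k))) * (cis (x \<bullet> \<xi>) * g \<xi>))"
      by (rule sums_mult2)
    moreover have "(\<i> * of_real (t * (Q \<xi> - k))) ^ j /\<^sub>R fact j * (cis (x \<bullet> \<xi>) * g \<xi>) = f j \<xi>" for j
      by (simp add: f_def h_def scaleR_conv_of_real power_mult_distrib divide_inverse mult_ac)
    ultimately show ?thesis by (simp add: cis_conv_exp mult_ac)
  qed
  \<comment> \<open>Termwise integration of the exponential series; \<open>fnorm'\<close> dominates
    the terms by \<open>cmod (g \<xi>) / fact j\<close>.\<close>
  have "(\<lambda>j. integral\<^sup>L lborel (f j)) sums (\<integral>\<xi>. (\<Sum>j. f j \<xi>) \<partial>lborel)"
  proof (rule sums_integral[OF f_int])
    show "AE \<xi> in lborel. summable (\<lambda>j. norm (f j \<xi>))"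
    proof (rule AE_I2)
      fix \<xi>
      show "summable (\<lambda>j. norm (f j \<xi>))"
        using fnorm'[of _ \<xi>] by (intro summable_comparison_test'[OF summable_mult[OF se, of "cmod (g \<xi>)"], of 0]) auto
    qed
    show "summable (\<lambda>j. \<integral>\<xi>. norm (f j \<xi>) \<partial>lborel)"
    proof (rule summable_comparison_test'[OF summable_mult[OF se, of "\<integral>\<xi>. cmod (g \<xi>) \<partial>lborel"], of 0])
      fix j :: nat
      have "(\<integral>\<xi>. norm (f j \<xi>) \<partial>lborel) \<le> (\<integral>\<xi>. cmod (g \<xi>) * (1 / fact j) \<partial>lborel)"
        using f_int tame_integrable[OF g] fnorm'
        by (intro integral_mono integrable_norm integrable_mult_left) auto
      then show "norm (\<integral>\<xi>. norm (f j \<xi>) \<partial>lborel) \<le> (\<integral>\<xi>. cmod (g \<xi>) \<partial>lborel) * (1 / fact j)"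
        by simp
    qed
  qed
  \<comment> \<open>Centring the phase at \<open>k\<close> costs a constant of modulus 1, which
    disappears from the bound.\<close>
  moreover have "(\<integral>\<xi>. (\<Sum>j. f j \<xi>) \<partial>lborel) = cis (- (t * k)) * evo Q g t x"
  proof -
    have "(\<integral>\<xi>. (\<Sum>j. f j \<xi>) \<partial>lborel) = (\<integral>\<xi>. cis (- (t * k)) * (cis (1 * (x \<bullet> \<xi>)) * (cis (t * Q \<xi>) * g \<xi>)) \<partial>lborel)"
    proof (rule Bochner_Integration.integral_cong)
      fix \<xi>
      have "cis (t * (Q \<xi> - k)) = cis (- (t * k)) * cis (t * Q \<xi>)"
        by (simp add: cis_mult algebra_simps)
      then show "(\<Sum>j. f j \<xi>) = cis (- (t * k)) * (cis (1 * (x \<bullet> \<xi>)) * (cis (t * Q \<xi>) * g \<xi>))"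
        using sums_unique[OF fsum[of \<xi>]] by (simp add: mult_ac)
    qed simp
    then show ?thesis unfolding evo_def ft2_def by (simp only: integral_mult_right_zero)
  qed
  moreover have "integral\<^sup>L lborel (f j) = (\<i> * of_real t) ^ j / fact j * ft2 1 (h j) x" for j
    unfolding f_def ft2_def by (subst integral_mult_right_zero) simp
  ultimately have sums: "(\<lambda>j. (\<i> * of_real t) ^ j / fact j * ft2 1 (h j) x) sums (cis (- (t * k)) * evo Q g t x)"
    by simp
  have le1: "norm ((\<i> * of_real t) ^ j / fact j * ft2 1 (h j) x) \<le> 1 / fact j * cmod (ft2 1 (h j) x)" for j
  proof -
    have "norm ((\<i> * of_real t) ^ j / fact j * ft2 1 (h j) x) = t ^ j * (1 / fact j * cmod (ft2 1 (h j) x))"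
      using t by (simp add: norm_mult norm_divide norm_power)
    also have "\<dots> \<le> 1 / fact j * cmod (ft2 1 (h j) x)"
      using t by (intro mult_left_le_one_le) (auto intro: power_le_one)
    finally show ?thesis .
  qed
  have hb: "cmod (ft2 1 (h j) x) \<le> (\<integral>\<xi>. cmod (g \<xi>) \<partial>lborel)" for j
  proof -
    have "cmod (ft2 1 (h j) x) \<le> (\<integral>\<xi>. cmod (cis (1 * (x \<bullet> \<xi>)) * h j \<xi>) \<partial>lborel)"
      unfolding ft2_def by (rule integral_norm_bound)
    also have "\<dots> \<le> (\<integral>\<xi>. cmod (g \<xi>) \<partial>lborel)"
      using tame_integrable[OF g] tame_integrable[OF th] hle by (intro integral_mono) auto
    finally show ?thesis .
  qed
  have summ: "summable (\<lambda>j. 1 / fact j * cmod (ft2 1 (h j) x))"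
  proof (rule summable_comparison_test'[OF summable_mult2[OF se, of "\<integral>\<xi>. cmod (g \<xi>) \<partial>lborel"], of 0])
    fix j :: nat
    show "norm (1 / fact j * cmod (ft2 1 (h j) x)) \<le> 1 / fact j * (\<integral>\<xi>. cmod (g \<xi>) \<partial>lborel)"
      using mult_left_mono[OF hb[of j], of "1 / fact j"] by simp
  qed
  have "cmod (evo Q g t x) = norm (\<Sum>j. (\<i> * of_real t) ^ j / fact j * ft2 1 (h j) x)"
    using sums_unique[OF sums] by (metis norm_cis_mult)
  also have "\<dots> \<le> (\<Sum>j. 1 / fact j * cmod (ft2 1 (h j) x))"
    by (rule norm_suminf_le[OF le1 summ])
  finally have "ennreal (cmod (evo Q g t x)) \<le> ennreal (\<Sum>j. 1 / fact j * cmod (ft2 1 (h j) x))"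
    by (rule ennreal_leI)
  also have "\<dots> = (\<Sum>j. ennreal (1 / fact j * cmod (ft2 1 (h j) x)))"
    using summ by (subst suminf_ennreal2) auto
  finally show ?thesis unfolding h_def .
qed

lemma suminf_inverse_fact: "(\<Sum>j. ennreal (1 / fact j)) = ennreal (exp 1)"
proof -
  have "(\<lambda>j. 1 / fact j :: real) sums exp 1"
    using exp_converges[of "1::real"] by (simp add: divide_inverse)
  then show ?thesis
    by (rule suminf_ennreal_eq[rotated]) simp
qed

text \<open>Every Taylor coefficient \<open>(Q - k) ^ j * g\<close> is supported where
  \<open>g\<close> is and bounded by it, so \<open>freeze_plancherel\<close> applies with constants
  independent of \<open>j\<close>. The series of \<open>1 / fact j\<close> is summed twice, once in
  Cauchy--Schwarz and once in the resulting bound, whence \<open>(exp 1)\<^sup>2\<close>. The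
  majorant \<open>M\<close> is free of \<open>t\<close>, as the later sum over bands
  requires.\<close>

lemma freeze_band:
  assumes g: "tame g" and [measurable]: "Q \<in> borel_measurable borel" "\<rho> \<in> borel_measurable borel"
    and band: "\<And>\<xi>. g \<xi> \<noteq> 0 \<Longrightarrow> k \<le> Q \<xi> \<and> Q \<xi> \<le> k + 1"
    and pos: "\<And>\<xi>. g \<xi> \<noteq> 0 \<Longrightarrow> \<rho> \<xi> > 0" and A: "A \<ge> 0"
    and level: "\<And>a. (\<integral>\<^sup>+b. ennreal (if g (pt a b) \<noteq> 0 then \<rho> (pt a b) else 0) \<partial>lborel) \<le> ennreal A"
  shows "\<exists>M\<in>borel_measurable borel. (\<forall>t\<in>{0..1}. \<forall>y. ennreal (cmod (evo Q g t (pt y z))) \<le> M y) \<and>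
    (\<integral>\<^sup>+y. (M y)\<^sup>2 \<partial>lborel) \<le> ennreal (2 * pi * (exp 1)\<^sup>2 * A) * (\<integral>\<^sup>+\<xi>. ennreal ((cmod (g \<xi>))\<^sup>2 / \<rho> \<xi>) \<partial>lborel)"
proof -
  have [measurable]: "g \<in> borel_measurable borel" using g by (rule tame_measurable)
  define h where "h j \<xi> = of_real ((Q \<xi> - k) ^ j) * g \<xi>" for j \<xi>
  have hle: "cmod (h j \<xi>) \<le> cmod (g \<xi>)" and th: "tame (h j)" for j \<xi>
    unfolding h_def by (rule band_power[OF g _ band]; measurable)+
  have [measurable]: "h j \<in> borel_measurable borel" for j using th by (rule tame_measurable)
  have h0: "g \<xi> \<noteq> 0" if "h j \<xi> \<noteq> 0" for j \<xi> using that by (auto simp: h_def)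
  define I where "I = (\<integral>\<^sup>+\<xi>. ennreal ((cmod (g \<xi>))\<^sup>2 / \<rho> \<xi>) \<partial>lborel)"
  define V where "V j y = ennreal (cmod (ft2 1 (h j) (pt y z)))" for j y
  have [measurable]: "V j \<in> borel_measurable borel" for j unfolding V_def[abs_def] by measurable
  have V: "(\<integral>\<^sup>+y. (V j y)\<^sup>2 \<partial>lborel) \<le> ennreal (2 * pi * A) * I" for j
  proof -
    have "(\<integral>\<^sup>+y. (V j y)\<^sup>2 \<partial>lborel) \<le> ennreal (2 * pi * A) * (\<integral>\<^sup>+\<xi>. ennreal ((cmod (h j \<xi>))\<^sup>2 / \<rho> \<xi>) \<partial>lborel)"
      unfolding V_def ennreal_power[OF norm_ge_zero]
    proof (rule freeze_plancherel[OF th])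
      fix a
      have "(\<integral>\<^sup>+b. ennreal (if h j (pt a b) \<noteq> 0 then \<rho> (pt a b) else 0) \<partial>lborel)
          \<le> (\<integral>\<^sup>+b. ennreal (if g (pt a b) \<noteq> 0 then \<rho> (pt a b) else 0) \<partial>lborel)"
        using h0[of j] by (intro nn_integral_mono) auto
      then show "(\<integral>\<^sup>+b. ennreal (if h j (pt a b) \<noteq> 0 then \<rho> (pt a b) else 0) \<partial>lborel) \<le> ennreal A"
        using level[of a] by (rule order_trans)
    qed (use pos h0 A in auto)
    also have "\<dots> \<le> ennreal (2 * pi * A) * I"
      unfolding I_def
    proof (intro mult_left_mono nn_integral_mono ennreal_leI)
      fix \<xi>
      show "(cmod (h j \<xi>))\<^sup>2 / \<rho> \<xi> \<le> (cmod (g \<xi>))\<^sup>2 / \<rho> \<xi>"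
        using pos[of \<xi>] hle[of j \<xi>] by (cases "g \<xi> = 0") (auto simp: h_def intro!: divide_right_mono power_mono)
    qed simp
    finally show ?thesis .
  qed
  define M where "M y = (\<Sum>j. ennreal (1 / fact j) * V j y)" for y
  have [measurable]: "M \<in> borel_measurable borel" unfolding M_def[abs_def] by measurable
  have "ennreal (cmod (evo Q g t (pt y z))) \<le> M y" if "t \<in> {0..1}" for t y
  proof -
    have eq: "ennreal (1 / fact j * cmod (ft2 1 (h j) (pt y z))) = ennreal (1 / fact j) * V j y" for j
      unfolding V_def by (rule ennreal_mult) auto
    have "ennreal (cmod (evo Q g t (pt y z))) \<le> (\<Sum>j. ennreal (1 / fact j * cmod (ft2 1 (h j) (pt y z))))"
      unfolding h_def by (rule evo_band_bound[OF g _ _ that]) (use band in auto)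
    then show ?thesis unfolding M_def by (simp only: eq)
  qed
  moreover have "(\<integral>\<^sup>+y. (M y)\<^sup>2 \<partial>lborel) \<le> ennreal (2 * pi * (exp 1)\<^sup>2 * A) * I"
  proof -
    have "(M y)\<^sup>2 \<le> ennreal (exp 1) * (\<Sum>j. ennreal (1 / fact j) * (V j y)\<^sup>2)" for y
    proof -
      have eq: "ennreal (fact j) * (ennreal (1 / fact j) * V j y)\<^sup>2 = ennreal (1 / fact j) * (V j y)\<^sup>2" for j
      proof -
        have "ennreal (fact j) * (ennreal (1 / fact j) * V j y)\<^sup>2
          = (ennreal (fact j) * ennreal (1 / fact j)) * (ennreal (1 / fact j) * (V j y)\<^sup>2)"
          by (simp only: power2_eq_square mult_ac)
        also have "ennreal (fact j) * ennreal (1 / fact j) = 1"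
          by (simp flip: ennreal_mult)
        finally show ?thesis by simp
      qed
      have "(M y)\<^sup>2 \<le> (\<Sum>j. ennreal (1 / fact j)) * (\<Sum>j. ennreal (fact j) * (ennreal (1 / fact j) * V j y)\<^sup>2)"
        using weighted_Cauchy_Schwarz[of "fact :: nat \<Rightarrow> real" UNIV "\<lambda>j. ennreal (1 / fact j) * V j y", OF fact_gt_zero]
        unfolding M_def nn_integral_count_space_nat .
      then show ?thesis by (simp only: eq suminf_inverse_fact)
    qed
    then have "(\<integral>\<^sup>+y. (M y)\<^sup>2 \<partial>lborel) \<le> (\<integral>\<^sup>+y. ennreal (exp 1) * (\<Sum>j. ennreal (1 / fact j) * (V j y)\<^sup>2) \<partial>lborel)"
      by (intro nn_integral_mono)
    also have "\<dots> = ennreal (exp 1) * (\<Sum>j. ennreal (1 / fact j) * (\<integral>\<^sup>+y. (V j y)\<^sup>2 \<partial>lborel))"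
      by (simp add: nn_integral_cmult nn_integral_suminf)
    also have "\<dots> \<le> ennreal (exp 1) * (\<Sum>j. ennreal (1 / fact j) * (ennreal (2 * pi * A) * I))"
      by (intro mult_left_mono suminf_le summableI V) auto
    also have "\<dots> = ennreal (exp 1) * (ennreal (exp 1) * (ennreal (2 * pi * A) * I))"
      by (simp only: ennreal_suminf_multc suminf_inverse_fact)
    also have "\<dots> = (ennreal (exp 1) * ennreal (exp 1) * ennreal (2 * pi * A)) * I"
      by (simp only: mult.assoc)
    also have "ennreal (exp 1) * ennreal (exp 1) * ennreal (2 * pi * A) = ennreal (2 * pi * (exp 1)\<^sup>2 * A)"
    proof -
      have c: "2 * pi * (exp 1)\<^sup>2 * A = exp 1 * exp 1 * (2 * pi * A)"
        by (simp add: power2_eq_square)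
      have "ennreal (exp 1 * exp 1 * (2 * pi * A)) = ennreal (exp 1 * exp 1) * ennreal (2 * pi * A)"
        using A by (intro ennreal_mult) auto
      also have "ennreal (exp 1 * exp 1 :: real) = ennreal (exp 1) * ennreal (exp 1)"
        by (intro ennreal_mult) auto
      finally show ?thesis by (simp only: c)
    qed
    finally show ?thesis .
  qed
  ultimately show ?thesis
    unfolding I_def by (intro bexI[of _ M] conjI ballI allI) simp_all
qed

text \<open>Uniformity in \<open>K\<close> is the point: how many bands a tame datum meets depends
  on its support, while the maximal estimate must not.\<close>

lemma sum_abs_int_powr_bound:
  fixes a :: real
  assumes a: "a > 1"
  shows "(\<Sum>k\<in>{- int K..int K}. (1 + \<bar>real_of_int k\<bar>) powr - a) \<le> 2 * (\<Sum>n. (1 + real n) powr - a)"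
proof -
  define f where "f k = (1 + \<bar>real_of_int k\<bar>) powr - a" for k
  have s: "summable (\<lambda>n. (1 + real n) powr - a)"
    using a summable_real_powr_iff[of "- a"] summable_Suc_iff[of "\<lambda>n. real n powr - a"] by (simp add: add.commute)
  have le: "(\<Sum>n\<le>K. (1 + real n) powr - a) \<le> (\<Sum>n. (1 + real n) powr - a)"
    by (rule sum_le_suminf[OF s]) auto
  have "{- int K..int K} \<subseteq> int ` {..K} \<union> (\<lambda>n. - int n) ` {..K}"
  proof
    fix k assume "k \<in> {- int K..int K}"
    then show "k \<in> int ` {..K} \<union> (\<lambda>n. - int n) ` {..K}"
      by (cases "k \<ge> 0") (auto intro: rev_image_eqI[of "nat k"] rev_image_eqI[of "nat (- k)"])
  qed
  then have "sum f {- int K..int K} \<le> sum f (int ` {..K} \<union> (\<lambda>n. - int n) ` {..K})"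
    by (intro sum_mono2) (auto simp: f_def)
  also have "\<dots> \<le> sum f (int ` {..K}) + sum f ((\<lambda>n. - int n) ` {..K})"
    by (subst sum_Un) (auto simp: f_def intro!: sum_nonneg)
  also have "sum f (int ` {..K}) = (\<Sum>n\<le>K. (1 + real n) powr - a)"
    by (subst sum.reindex) (auto simp: f_def)
  also have "sum f ((\<lambda>n. - int n) ` {..K}) = (\<Sum>n\<le>K. (1 + real n) powr - a)"
    by (subst sum.reindex) (auto simp: f_def inj_on_def)
  finally show ?thesis using le unfolding f_def by linarith
qed

text \<open>Ensures that the support of a tame function meets only finitely many bands, so that the
  decomposition into bands is a finite sum.\<close>

definition locally_bounded :: "(real^2 \<Rightarrow> real) \<Rightarrow> bool" where
  "locally_bounded Q \<longleftrightarrow> (\<forall>N. \<exists>K. \<forall>\<xi>. norm \<xi> \<le> N \<longrightarrow> \<bar>Q \<xi>\<bar> \<le> K)"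

text \<open>The weight \<open>\<rho>\<close> plays the role of \<open>\<bar>\<partial>Q / \<partial>\<xi>\<^sub>2\<bar>\<close>.\<close>

definition freeze_const :: "real \<Rightarrow> real" where
  "freeze_const a = 4 * pi * (exp 1)\<^sup>2 * (\<Sum>n. (1 + real n) powr - a)"

lemma powr_series_nonneg:
  assumes "a > 1"
  shows "0 \<le> (\<Sum>n. (1 + real n) powr - a)"
  using sum_abs_int_powr_bound[OF assms, of 0] by simp

lemma freeze_const_nonneg: "a > 1 \<Longrightarrow> 0 \<le> freeze_const a"
  by (simp add: freeze_const_def powr_series_nonneg)

lemma freeze_maximal:
  assumes a: "a > 1" and [measurable]: "Q \<in> borel_measurable borel" and lb: "locally_bounded Q"
    and g: "tame g" and [measurable]: "\<rho> \<in> borel_measurable borel"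
    and pos: "\<And>\<xi>. g \<xi> \<noteq> 0 \<Longrightarrow> \<rho> \<xi> > 0" and A: "A \<ge> 0"
    and level: "\<And>k a. (\<integral>\<^sup>+b. ennreal (if g (pt a b) \<noteq> 0 \<and> \<lfloor>Q (pt a b)\<rfloor> = k then \<rho> (pt a b) else 0) \<partial>lborel)
      \<le> ennreal A"
  shows "(\<integral>\<^sup>+y. (maximal (evo Q g) (pt y z))\<^sup>2 \<partial>lborel) \<le> ennreal (freeze_const a * A)
    * (\<integral>\<^sup>+\<xi>. ennreal ((2 + \<bar>Q \<xi>\<bar>) powr a * (cmod (g \<xi>))\<^sup>2 / \<rho> \<xi>) \<partial>lborel)"
proof -
  define S where "S = 2 * (\<Sum>n. (1 + real n) powr - a)"
  have S0: "S \<ge> 0" using powr_series_nonneg[OF a] by (simp add: S_def)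
  have [measurable]: "g \<in> borel_measurable borel" using g by (rule tame_measurable)
  from g obtain N where N: "\<And>\<xi>. g \<xi> \<noteq> 0 \<Longrightarrow> norm \<xi> \<le> N" by (rule tameE) blast
  obtain K0 where K0: "\<And>\<xi>. norm \<xi> \<le> N \<Longrightarrow> \<bar>Q \<xi>\<bar> \<le> K0"
    using lb unfolding locally_bounded_def by blast
  \<comment> \<open>The added 1 allows for rounding down: the integer part of a value near
    \<open>-K0\<close> may lie below \<open>-K0\<close>.\<close>
  define K where "K = nat \<lceil>\<bar>K0\<bar> + 1\<rceil>"
  define F where "F = {- int K..int K}"
  have fl: "\<lfloor>Q \<xi>\<rfloor> \<in> F" if "g \<xi> \<noteq> 0" for \<xi>
    using K0[OF N[OF that]] unfolding F_def K_def by (auto simp: floor_le_iff le_floor_iff) linarith+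
  define gk where "gk k \<xi> = (if \<lfloor>Q \<xi>\<rfloor> = k then 1 else 0) * g \<xi>" for k \<xi>
  have gk0: "gk k \<xi> \<noteq> 0 \<longleftrightarrow> g \<xi> \<noteq> 0 \<and> \<lfloor>Q \<xi>\<rfloor> = k" for k \<xi> by (auto simp: gk_def)
  have tk: "tame (gk k)" for k
    unfolding gk_def
  proof (rule tame_mult_bounded[OF g, of _ 1])
    show "(\<lambda>\<xi>. if \<lfloor>Q \<xi>\<rfloor> = k then 1 else 0 :: complex) \<in> borel_measurable borel"
      unfolding floor_eq_iff by measurable
  qed auto
  have [measurable]: "gk k \<in> borel_measurable borel" for k using tk by (rule tame_measurable)
  have gsum: "g \<xi> = (\<Sum>k\<in>F. gk k \<xi>)" for \<xi>
  proof (cases "g \<xi> = 0")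
    case False
    have "(\<Sum>k\<in>F. gk k \<xi>) = (\<Sum>k\<in>{\<lfloor>Q \<xi>\<rfloor>}. gk k \<xi>)"
      using fl[OF False] by (intro sum.mono_neutral_right) (auto simp: F_def gk_def)
    then show ?thesis by (simp add: gk_def)
  qed (simp add: gk_def)
  define I where "I k = (\<integral>\<^sup>+\<xi>. ennreal ((cmod (gk k \<xi>))\<^sup>2 / \<rho> \<xi>) \<partial>lborel)" for k
  define c where "c = 2 * pi * (exp 1)\<^sup>2 * A"
  have c0: "c \<ge> 0" using A by (simp add: c_def)
  have "\<exists>M\<in>borel_measurable borel. (\<forall>t\<in>{0..1}. \<forall>y. ennreal (cmod (evo Q (gk k) t (pt y z))) \<le> M y) \<and>
    (\<integral>\<^sup>+y. (M y)\<^sup>2 \<partial>lborel) \<le> ennreal c * I k" for k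
    unfolding I_def c_def
  proof (rule freeze_band[OF tk, where k="real_of_int k"])
    show "real_of_int k \<le> Q \<xi> \<and> Q \<xi> \<le> real_of_int k + 1" if "gk k \<xi> \<noteq> 0" for \<xi>
      using that unfolding gk0 by linarith
    show "0 < \<rho> \<xi>" if "gk k \<xi> \<noteq> 0" for \<xi>
      using that pos by (auto simp: gk0)
    show "(\<integral>\<^sup>+b. ennreal (if gk k (pt a b) \<noteq> 0 then \<rho> (pt a b) else 0) \<partial>lborel) \<le> ennreal A" for a
      unfolding gk0 using level by blast
  qed (use A in auto)
  then obtain M where [measurable]: "\<And>k. M k \<in> borel_measurable borel"
    and M: "\<And>k t y. t \<in> {0..1} \<Longrightarrow> ennreal (cmod (evo Q (gk k) t (pt y z))) \<le> M k y"
    and MI: "\<And>k. (\<integral>\<^sup>+y. (M k y)\<^sup>2 \<partial>lborel) \<le> ennreal c * I k"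
    by metis
  define w where "w k = (1 + \<bar>real_of_int k\<bar>) powr a" for k
  have w0: "w k > 0" for k by (simp add: w_def)
  have max_le: "(maximal (evo Q g) (pt y z))\<^sup>2 \<le> ennreal S * (\<Sum>k\<in>F. ennreal (w k) * (M k y)\<^sup>2)" for y
  proof -
    have "maximal (evo Q g) (pt y z) \<le> (\<Sum>k\<in>F. M k y)"
      unfolding maximal_def
    proof (rule SUP_least)
      fix t :: real assume t: "t \<in> {0<..<1}"
      have "evo Q g t (pt y z) = (\<Sum>k\<in>F. evo Q (gk k) t (pt y z))"
        using evo_sum[of Q F gk t "pt y z"] tame_integrable[OF tk] by (simp flip: gsum)
      then have "ennreal (cmod (evo Q g t (pt y z))) \<le> ennreal (\<Sum>k\<in>F. cmod (evo Q (gk k) t (pt y z)))"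
        by (intro ennreal_leI) (simp add: norm_sum)
      also have "\<dots> = (\<Sum>k\<in>F. ennreal (cmod (evo Q (gk k) t (pt y z))))"
        by (rule sum_ennreal[symmetric]) simp
      also have "\<dots> \<le> (\<Sum>k\<in>F. M k y)"
        using t by (intro sum_mono M) auto
      finally show "ennreal (cmod (evo Q g t (pt y z))) \<le> (\<Sum>k\<in>F. M k y)" .
    qed
    then have "(maximal (evo Q g) (pt y z))\<^sup>2 \<le> (\<Sum>k\<in>F. M k y)\<^sup>2"
      by (intro power_mono) auto
    also have "\<dots> \<le> (\<Sum>k\<in>F. ennreal (1 / w k)) * (\<Sum>k\<in>F. ennreal (w k) * (M k y)\<^sup>2)"
      using weighted_Cauchy_Schwarz[of w F "\<lambda>k. M k y", OF w0]
      by (simp add: nn_integral_count_space_finite F_def)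
    also have "(\<Sum>k\<in>F. ennreal (1 / w k)) = ennreal (\<Sum>k\<in>F. 1 / w k)"
      using w0 by (intro sum_ennreal) (simp add: less_imp_le)
    also have "\<dots> \<le> ennreal S"
      using sum_abs_int_powr_bound[OF a, of K]
      by (intro ennreal_leI) (simp add: S_def F_def w_def powr_minus_divide)
    finally show ?thesis by (simp add: mult_right_mono)
  qed
  have "(\<integral>\<^sup>+y. (maximal (evo Q g) (pt y z))\<^sup>2 \<partial>lborel)
      \<le> (\<integral>\<^sup>+y. ennreal S * (\<Sum>k\<in>F. ennreal (w k) * (M k y)\<^sup>2) \<partial>lborel)"
    by (intro nn_integral_mono max_le)
  also have "\<dots> = ennreal S * (\<Sum>k\<in>F. ennreal (w k) * (\<integral>\<^sup>+y. (M k y)\<^sup>2 \<partial>lborel))"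
    by (simp add: nn_integral_cmult nn_integral_sum)
  also have "\<dots> \<le> ennreal S * (\<Sum>k\<in>F. ennreal (w k) * (ennreal c * I k))"
    by (intro mult_left_mono sum_mono MI) auto
  also have "\<dots> = ennreal S * (ennreal c * (\<Sum>k\<in>F. ennreal (w k) * I k))"
    by (simp add: sum_distrib_left mult_ac)
  also have "(\<Sum>k\<in>F. ennreal (w k) * I k)
      = (\<integral>\<^sup>+\<xi>. (\<Sum>k\<in>F. ennreal (w k) * ennreal ((cmod (gk k \<xi>))\<^sup>2 / \<rho> \<xi>)) \<partial>lborel)"
    unfolding I_def by (simp add: nn_integral_cmult nn_integral_sum)
  also have "\<dots> \<le> (\<integral>\<^sup>+\<xi>. ennreal ((2 + \<bar>Q \<xi>\<bar>) powr a * (cmod (g \<xi>))\<^sup>2 / \<rho> \<xi>) \<partial>lborel)"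
  proof (rule nn_integral_mono)
    fix \<xi>
    show "(\<Sum>k\<in>F. ennreal (w k) * ennreal ((cmod (gk k \<xi>))\<^sup>2 / \<rho> \<xi>))
      \<le> ennreal ((2 + \<bar>Q \<xi>\<bar>) powr a * (cmod (g \<xi>))\<^sup>2 / \<rho> \<xi>)"
    proof (cases "g \<xi> = 0")
      case False
      have p: "\<rho> \<xi> > 0" using pos False by blast
      have "(\<Sum>k\<in>F. ennreal (w k) * ennreal ((cmod (gk k \<xi>))\<^sup>2 / \<rho> \<xi>))
        = (\<Sum>k\<in>{\<lfloor>Q \<xi>\<rfloor>}. ennreal (w k) * ennreal ((cmod (gk k \<xi>))\<^sup>2 / \<rho> \<xi>))"
        using fl[OF False] by (intro sum.mono_neutral_right) (auto simp: F_def gk_def)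
      also have "\<dots> = ennreal (w \<lfloor>Q \<xi>\<rfloor> * ((cmod (g \<xi>))\<^sup>2 / \<rho> \<xi>))"
        using w0[of "\<lfloor>Q \<xi>\<rfloor>"] p by (subst ennreal_mult) (simp_all add: gk_def)
      also have "\<dots> \<le> ennreal ((2 + \<bar>Q \<xi>\<bar>) powr a * ((cmod (g \<xi>))\<^sup>2 / \<rho> \<xi>))"
      proof (intro ennreal_leI mult_right_mono)
        \<comment> \<open>Rounding down can increase the modulus by at most 1; hence the 2 in the
          weight.\<close>
        have "1 + \<bar>real_of_int \<lfloor>Q \<xi>\<rfloor>\<bar> \<le> 2 + \<bar>Q \<xi>\<bar>" by linarith
        then show "w \<lfloor>Q \<xi>\<rfloor> \<le> (2 + \<bar>Q \<xi>\<bar>) powr a"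
          unfolding w_def using a by (intro powr_mono2) auto
      qed (use p in simp)
      finally show ?thesis by simp
    qed (simp add: gk_def)
  qed
  finally have "(\<integral>\<^sup>+y. (maximal (evo Q g) (pt y z))\<^sup>2 \<partial>lborel) \<le> ennreal S * (ennreal c *
      (\<integral>\<^sup>+\<xi>. ennreal ((2 + \<bar>Q \<xi>\<bar>) powr a * (cmod (g \<xi>))\<^sup>2 / \<rho> \<xi>) \<partial>lborel))"
    by (simp add: mult_left_mono)
  also have "\<dots> = ennreal (freeze_const a * A) *
      (\<integral>\<^sup>+\<xi>. ennreal ((2 + \<bar>Q \<xi>\<bar>) powr a * (cmod (g \<xi>))\<^sup>2 / \<rho> \<xi>) \<partial>lborel)"
  proof -
    have "freeze_const a * A = S * c" by (simp add: c_def S_def freeze_const_def)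
    then show ?thesis by (simp only: ennreal_mult[OF S0 c0] mult.assoc)
  qed
  finally show ?thesis .
qed

section \<open>Maximal estimates on frequency regions\<close>

text \<open>The square of the multiplier in \<open>sobolev_norm\<close>, which explains the exponent
  \<open>s\<close> in place of \<open>s / 2\<close>; the estimates are all for squared
  norms.\<close>

definition weight :: "real \<Rightarrow> real^2 \<Rightarrow> real" where
  "weight s \<xi> = (1 + (norm \<xi>)\<^sup>2) powr s"

lemma weight_measurable [measurable]: "weight s \<in> borel_measurable borel"
  unfolding weight_def[abs_def] by measurable

lemma weight_pos: "weight s \<xi> > 0"
proof -
  have "1 + (norm \<xi>)\<^sup>2 > 0" by (simp add: add_pos_nonneg)
  then show ?thesis unfolding weight_def by simp
qed

abbreviation wsq :: "real \<Rightarrow> (real^2 \<Rightarrow> complex) \<Rightarrow> ennreal" where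
  "wsq s g \<equiv> \<integral>\<^sup>+\<xi>. ennreal (weight s \<xi> * (cmod (g \<xi>))\<^sup>2) \<partial>lborel"

definition good_region :: "(real^2 \<Rightarrow> real) \<Rightarrow> real \<Rightarrow> (real^2) set \<Rightarrow> bool" where
  "good_region P s T \<longleftrightarrow> (\<exists>C\<ge>0. \<forall>g r. tame g \<longrightarrow> (\<forall>\<xi>. g \<xi> \<noteq> 0 \<longrightarrow> \<xi> \<in> T) \<longrightarrow> r \<ge> 0 \<longrightarrow>
    (\<integral>\<^sup>+x\<in>cball 0 r. (maximal (evo P g) x)\<^sup>2 \<partial>lborel)
      \<le> ennreal (C * r) * wsq s g)"

text \<open>The datum is cut by the indicator of \<open>T\<close>, frequencies in the overlap going
  to \<open>T\<close>; the maximal function is subadditive.\<close>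

lemma good_region_Un:
  assumes [measurable]: "P \<in> borel_measurable borel" "T \<in> sets borel"
    and T: "good_region P s T" and U: "good_region P s U"
  shows "good_region P s (T \<union> U)"
proof -
  from T obtain C where C: "C \<ge> 0" "\<And>g r. tame g \<Longrightarrow> (\<And>\<xi>. g \<xi> \<noteq> 0 \<Longrightarrow> \<xi> \<in> T) \<Longrightarrow> r \<ge> 0 \<Longrightarrow>
    (\<integral>\<^sup>+x\<in>cball 0 r. (maximal (evo P g) x)\<^sup>2 \<partial>lborel)
      \<le> ennreal (C * r) * wsq s g"
    unfolding good_region_def by blast
  from U obtain D where D: "D \<ge> 0" "\<And>g r. tame g \<Longrightarrow> (\<And>\<xi>. g \<xi> \<noteq> 0 \<Longrightarrow> \<xi> \<in> U) \<Longrightarrow> r \<ge> 0 \<Longrightarrow>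
    (\<integral>\<^sup>+x\<in>cball 0 r. (maximal (evo P g) x)\<^sup>2 \<partial>lborel)
      \<le> ennreal (D * r) * wsq s g"
    unfolding good_region_def by blast
  show ?thesis
    unfolding good_region_def
  proof (intro exI[of _ "2 * C + 2 * D"] conjI allI impI)
    show "0 \<le> 2 * C + 2 * D" using C(1) D(1) by simp
    fix g :: "real^2 \<Rightarrow> complex" and r :: real
    assume g: "tame g" and TU: "\<forall>\<xi>. g \<xi> \<noteq> 0 \<longrightarrow> \<xi> \<in> T \<union> U" and r: "r \<ge> 0"
    define W where "W = wsq s g"
    define g1 where "g1 \<xi> = indicator T \<xi> * g \<xi>" for \<xi>
    define g2 where "g2 \<xi> = indicator (- T) \<xi> * g \<xi>" for \<xi>
    have t1: "tame g1" and t2: "tame g2"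
      unfolding g1_def g2_def by (rule tame_mult_bounded[OF g, of _ 1]; auto simp: indicator_def)+
    have [measurable]: "integrable lborel g1" "integrable lborel g2" using t1 t2 by (auto intro: tame_integrable)
    have g12: "g = (\<lambda>\<xi>. g1 \<xi> + g2 \<xi>)" by (auto simp: g1_def g2_def indicator_def)
    have W1: "wsq s g1 \<le> W"
      and W2: "wsq s g2 \<le> W"
      unfolding W_def g1_def g2_def
      by (intro nn_integral_mono ennreal_leI mult_left_mono power_mono;
          simp add: indicator_def less_imp_le[OF weight_pos])+
    have pt: "(maximal (evo P g) x)\<^sup>2 \<le> 2 * (maximal (evo P g1) x)\<^sup>2 + 2 * (maximal (evo P g2) x)\<^sup>2" for x
    proof -
      have "maximal (evo P g) x \<le> maximal (evo P g1) x + maximal (evo P g2) x"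
        unfolding maximal_def
      proof (rule SUP_least)
        fix t :: real assume t: "t \<in> {0<..<1}"
        have "evo P g t x = evo P g1 t x + evo P g2 t x"
          unfolding g12 using t1 t2 by (intro evo_add tame_integrable) auto
        then have "ennreal (cmod (evo P g t x)) \<le> ennreal (cmod (evo P g1 t x)) + ennreal (cmod (evo P g2 t x))"
          by (simp add: norm_triangle_ineq flip: ennreal_plus)
        also have "\<dots> \<le> (SUP t\<in>{0<..<1}. ennreal (cmod (evo P g1 t x))) + (SUP t\<in>{0<..<1}. ennreal (cmod (evo P g2 t x)))"
          using t by (intro add_mono SUP_upper)
        finally show "ennreal (cmod (evo P g t x)) \<le> \<dots>" .
      qed
      then have "(maximal (evo P g) x)\<^sup>2 \<le> (maximal (evo P g1) x + maximal (evo P g2) x)\<^sup>2"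
        by (rule power_mono) simp
      also have "\<dots> \<le> 2 * (maximal (evo P g1) x)\<^sup>2 + 2 * (maximal (evo P g2) x)\<^sup>2"
      proof (cases "maximal (evo P g1) x = top \<or> maximal (evo P g2) x = top")
        case False
        then obtain a b where "maximal (evo P g1) x = ennreal a" "a \<ge> 0" "maximal (evo P g2) x = ennreal b" "b \<ge> 0"
          by (metis ennreal_cases)
        moreover have "(a + b)\<^sup>2 \<le> 2 * a\<^sup>2 + 2 * b\<^sup>2"
          using sum_squares_bound[of a b] by (simp add: power2_sum)
        then have "ennreal ((a + b)\<^sup>2) \<le> ennreal (2 * a\<^sup>2 + 2 * b\<^sup>2)" by (rule ennreal_leI)
        moreover have "ennreal (2 * a\<^sup>2 + 2 * b\<^sup>2) = 2 * ennreal (a\<^sup>2) + 2 * ennreal (b\<^sup>2)"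
          by (simp add: ennreal_mult')
        ultimately show ?thesis
          by (simp add: ennreal_power flip: ennreal_plus)
      qed (auto simp: power2_eq_square ennreal_mult_top)
      finally show ?thesis .
    qed
    have "(\<integral>\<^sup>+x\<in>cball 0 r. (maximal (evo P g) x)\<^sup>2 \<partial>lborel)
      \<le> (\<integral>\<^sup>+x. 2 * ((maximal (evo P g1) x)\<^sup>2 * indicator (cball 0 r) x)
            + 2 * ((maximal (evo P g2) x)\<^sup>2 * indicator (cball 0 r) x) \<partial>lborel)"
    proof (rule nn_integral_mono)
      fix x show "(maximal (evo P g) x)\<^sup>2 * indicator (cball 0 r) x
        \<le> 2 * ((maximal (evo P g1) x)\<^sup>2 * indicator (cball 0 r) x)
            + 2 * ((maximal (evo P g2) x)\<^sup>2 * indicator (cball 0 r) x)"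
        using pt[of x] by (simp add: indicator_def)
    qed
    also have "\<dots> = 2 * (\<integral>\<^sup>+x\<in>cball 0 r. (maximal (evo P g1) x)\<^sup>2 \<partial>lborel)
        + 2 * (\<integral>\<^sup>+x\<in>cball 0 r. (maximal (evo P g2) x)\<^sup>2 \<partial>lborel)"
      by (subst nn_integral_add, measurable) (simp add: nn_integral_cmult)
    also have "\<dots> \<le> 2 * (ennreal (C * r) * W) + 2 * (ennreal (D * r) * W)"
    proof (intro add_mono mult_left_mono)
      show "(\<integral>\<^sup>+x\<in>cball 0 r. (maximal (evo P g1) x)\<^sup>2 \<partial>lborel) \<le> ennreal (C * r) * W"
        by (rule order_trans[OF C(2)[OF t1 _ r] mult_left_mono[OF W1]]) (auto simp: g1_def indicator_def split: if_splits)
      show "(\<integral>\<^sup>+x\<in>cball 0 r. (maximal (evo P g2) x)\<^sup>2 \<partial>lborel) \<le> ennreal (D * r) * W"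
        by (rule order_trans[OF D(2)[OF t2 _ r] mult_left_mono[OF W2]])
           (use TU in \<open>auto simp: g2_def indicator_def split: if_splits\<close>)
    qed auto
    also have "\<dots> = ennreal ((2 * C + 2 * D) * r) * W"
      using C(1) D(1) r by (simp add: distrib_right ennreal_mult' ennreal_plus mult.assoc)
    finally show "(\<integral>\<^sup>+x\<in>cball 0 r. (maximal (evo P g) x)\<^sup>2 \<partial>lborel)
      \<le> ennreal ((2 * C + 2 * D) * r) * wsq s g"
      unfolding W_def .
  qed
qed

text \<open>The space variable \<open>x $ 2\<close> is frozen and \<open>\<rho>\<close> stands for
  the modulus of the derivative of \<open>P\<close> in the second frequency. The slice bound is
  integrated over the interval \<open>{-r..r}\<close> of frozen values. The hypothesis
  \<open>weight\<close> is where the loss of \<open>P\<close> over its derivative is paid for by the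
  Sobolev weight.\<close>

lemma good_region_freeze2:
  fixes P \<rho> :: "real^2 \<Rightarrow> real"
  assumes a: "a > 1" and [measurable]: "P \<in> borel_measurable borel" and lb: "locally_bounded P"
    and [measurable]: "\<rho> \<in> borel_measurable borel" and pos: "\<And>\<xi>. \<xi> \<in> T \<Longrightarrow> \<rho> \<xi> > 0" and A: "A \<ge> 0"
    and level: "\<And>k a. (\<integral>\<^sup>+b. ennreal (if pt a b \<in> T \<and> \<lfloor>P (pt a b)\<rfloor> = k then \<rho> (pt a b) else 0) \<partial>lborel) \<le> ennreal A"
    and E: "E \<ge> 0" and weight: "\<And>\<xi>. \<xi> \<in> T \<Longrightarrow> (2 + \<bar>P \<xi>\<bar>) powr a / \<rho> \<xi> \<le> E * weight s \<xi>"
  shows "good_region P s T"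
proof -
  define C where "C = freeze_const a"
  have C0: "C \<ge> 0" unfolding C_def by (rule freeze_const_nonneg[OF a])
  show ?thesis
    unfolding good_region_def
  proof (intro exI[of _ "2 * (C * A * E)"] conjI allI impI)
    show "0 \<le> 2 * (C * A * E)" using C0 A E by simp
    fix g :: "real^2 \<Rightarrow> complex" and r :: real
    assume g: "tame g" and T: "\<forall>\<xi>. g \<xi> \<noteq> 0 \<longrightarrow> \<xi> \<in> T" and r: "r \<ge> 0"
    have [measurable]: "g \<in> borel_measurable borel" "integrable lborel g"
      using g by (auto intro: tame_measurable tame_integrable)
    define W where "W = wsq s g"
    have slice: "(\<integral>\<^sup>+y. (maximal (evo P g) (pt y z))\<^sup>2 \<partial>lborel) \<le> ennreal (C * A * E) * W" for z
    proof -
      have "(\<integral>\<^sup>+y. (maximal (evo P g) (pt y z))\<^sup>2 \<partial>lborel)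
          \<le> ennreal (C * A) * (\<integral>\<^sup>+\<xi>. ennreal ((2 + \<bar>P \<xi>\<bar>) powr a * (cmod (g \<xi>))\<^sup>2 / \<rho> \<xi>) \<partial>lborel)"
        unfolding C_def
      proof (rule freeze_maximal[OF a _ lb g])
        fix k a
        show "(\<integral>\<^sup>+b. ennreal (if g (pt a b) \<noteq> 0 \<and> \<lfloor>P (pt a b)\<rfloor> = k then \<rho> (pt a b) else 0) \<partial>lborel) \<le> ennreal A"
        proof -
          have "(\<integral>\<^sup>+b. ennreal (if g (pt a b) \<noteq> 0 \<and> \<lfloor>P (pt a b)\<rfloor> = k then \<rho> (pt a b) else 0) \<partial>lborel)
            \<le> (\<integral>\<^sup>+b. ennreal (if pt a b \<in> T \<and> \<lfloor>P (pt a b)\<rfloor> = k then \<rho> (pt a b) else 0) \<partial>lborel)"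
            using T by (intro nn_integral_mono) auto
          then show "(\<integral>\<^sup>+b. ennreal (if g (pt a b) \<noteq> 0 \<and> \<lfloor>P (pt a b)\<rfloor> = k then \<rho> (pt a b) else 0) \<partial>lborel) \<le> ennreal A"
            using level by (rule order_trans)
        qed
      qed (use T pos A in auto)
      also have "(\<integral>\<^sup>+\<xi>. ennreal ((2 + \<bar>P \<xi>\<bar>) powr a * (cmod (g \<xi>))\<^sup>2 / \<rho> \<xi>) \<partial>lborel)
          \<le> (\<integral>\<^sup>+\<xi>. ennreal E * ennreal (weight s \<xi> * (cmod (g \<xi>))\<^sup>2) \<partial>lborel)"
      proof (rule nn_integral_mono)
        fix \<xi>
        have "(2 + \<bar>P \<xi>\<bar>) powr a * (cmod (g \<xi>))\<^sup>2 / \<rho> \<xi> \<le> E * (weight s \<xi> * (cmod (g \<xi>))\<^sup>2)"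
        proof (cases "g \<xi> = 0")
          case False
          then have "(2 + \<bar>P \<xi>\<bar>) powr a / \<rho> \<xi> * (cmod (g \<xi>))\<^sup>2 \<le> E * weight s \<xi> * (cmod (g \<xi>))\<^sup>2"
            using T by (intro mult_right_mono weight) auto
          then show ?thesis by (simp add: mult.assoc)
        qed simp
        then have "ennreal ((2 + \<bar>P \<xi>\<bar>) powr a * (cmod (g \<xi>))\<^sup>2 / \<rho> \<xi>) \<le> ennreal (E * (weight s \<xi> * (cmod (g \<xi>))\<^sup>2))"
          by (rule ennreal_leI)
        also have "\<dots> = ennreal E * ennreal (weight s \<xi> * (cmod (g \<xi>))\<^sup>2)"
          using E by (rule ennreal_mult') 
        finally show "ennreal ((2 + \<bar>P \<xi>\<bar>) powr a * (cmod (g \<xi>))\<^sup>2 / \<rho> \<xi>) \<le> \<dots>" .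
      qed
      also have "\<dots> = ennreal E * W"
        unfolding W_def by (rule nn_integral_cmult) measurable
      also have "ennreal (C * A) * (ennreal E * W) = ennreal (C * A * E) * W"
        using C0 A E by (simp only: ennreal_mult'[of "C * A" E, OF mult_nonneg_nonneg] mult.assoc[of _ _ W])
      finally show ?thesis by (simp add: mult_left_mono)
    qed
    have "(\<integral>\<^sup>+x\<in>cball 0 r. (maximal (evo P g) x)\<^sup>2 \<partial>lborel)
      = (\<integral>\<^sup>+z. (\<integral>\<^sup>+y. (maximal (evo P g) (pt y z))\<^sup>2 * indicator (cball 0 r) (pt y z) \<partial>lborel) \<partial>lborel)"
      by (rule nn_integral_plane') measurable
    also have "\<dots> \<le> (\<integral>\<^sup>+z. (ennreal (C * A * E) * W) * indicator {-r..r} z \<partial>lborel)"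
    proof (rule nn_integral_mono)
      fix z :: real
      show "(\<integral>\<^sup>+y. (maximal (evo P g) (pt y z))\<^sup>2 * indicator (cball 0 r) (pt y z) \<partial>lborel)
        \<le> (ennreal (C * A * E) * W) * indicator {-r..r} z"
      proof (cases "z \<in> {-r..r}")
        case True
        have "(\<integral>\<^sup>+y. (maximal (evo P g) (pt y z))\<^sup>2 * indicator (cball 0 r) (pt y z) \<partial>lborel)
          \<le> (\<integral>\<^sup>+y. (maximal (evo P g) (pt y z))\<^sup>2 \<partial>lborel)"
          by (intro nn_integral_mono) (simp add: indicator_def)
        then show ?thesis using slice[of z] True by simp
      next
        case False
        have "pt y z \<notin> cball 0 r" for y
        proof
          assume "pt y z \<in> cball 0 r"
          then have "\<bar>z\<bar> \<le> r" using component_le_norm_cart[of "pt y z" 2] by simp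
          with False show False by auto
        qed
        then show ?thesis by simp
      qed
    qed
    also have "\<dots> = (ennreal (C * A * E) * W) * ennreal (2 * r)"
      using r by (subst nn_integral_cmult_indicator) auto
    also have "\<dots> = ennreal (2 * (C * A * E) * r) * W"
    proof -
      have "2 * (C * A * E) * r = (C * A * E) * (2 * r)" by simp
      then have "ennreal (2 * (C * A * E) * r) = ennreal (C * A * E) * ennreal (2 * r)"
        using C0 A E r by (simp only:) (rule ennreal_mult; simp)
      then show ?thesis by (simp only: mult_ac)
    qed
    finally show "(\<integral>\<^sup>+x\<in>cball 0 r. (maximal (evo P g) x)\<^sup>2 \<partial>lborel)
      \<le> ennreal (2 * (C * A * E) * r) * wsq s g"
      unfolding W_def .
  qed
qed

section \<open>Exchange of the two coordinates\<close>

abbreviation swap :: "real^2 \<Rightarrow> real^2" where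
  "swap \<xi> \<equiv> pt (\<xi> $ 2) (\<xi> $ 1)"

lemma norm_swap: "norm (swap \<xi>) = norm \<xi>"
  by (simp add: norm_pt norm_eq_sqrt_inner inner_plane power2_eq_square add.commute)

lemma nn_integral_swap:
  assumes [measurable]: "F \<in> borel_measurable borel"
  shows "(\<integral>\<^sup>+x. F (swap x) \<partial>lborel) = (\<integral>\<^sup>+x. F x \<partial>lborel)"
  by (subst nn_integral_plane, measurable) (simp add: nn_integral_plane')

lemma integral_swap:
  fixes F :: "real^2 \<Rightarrow> complex"
  assumes "integrable lborel F" "integrable lborel (\<lambda>x. F (swap x))"
  shows "(\<integral>x. F (swap x) \<partial>lborel) = (\<integral>x. F x \<partial>lborel)"
  by (subst integral_plane(1)[OF assms(2)]) (simp add: integral_plane(2)[OF assms(1)])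

lemma tame_swap: 
  assumes "tame g"
  shows "tame (\<lambda>\<xi>. g (swap \<xi>))"
proof -
  from assms obtain B N where [measurable]: "g \<in> borel_measurable borel"
    and B: "\<And>\<xi>. cmod (g \<xi>) \<le> B" and N: "\<And>\<xi>. g \<xi> \<noteq> 0 \<Longrightarrow> norm \<xi> \<le> N"
    by (rule tameE) blast
  show ?thesis
  proof (rule tameI)
    show "norm \<xi> \<le> N" if "g (swap \<xi>) \<noteq> 0" for \<xi>
      using N[OF that] by (simp only: norm_swap)
  qed (use B in auto)
qed

text \<open>Lebesgue measure, the inner product, the discs and the Sobolev weight are invariant
  under the exchange, so freezing \<open>x $ 1\<close> reduces to freezing \<open>x $ 2\<close> for
  the exchanged phase.\<close>

lemma good_region_swap:
  assumes [measurable]: "P \<in> borel_measurable borel"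
    and G: "good_region (\<lambda>\<xi>. P (swap \<xi>)) s {\<xi>. swap \<xi> \<in> T}"
  shows "good_region P s T"
proof -
  from G obtain C where C0: "C \<ge> 0" and C: "\<And>g r. tame g \<Longrightarrow> (\<And>\<xi>. g \<xi> \<noteq> 0 \<Longrightarrow> swap \<xi> \<in> T) \<Longrightarrow> r \<ge> 0 \<Longrightarrow>
    (\<integral>\<^sup>+x\<in>cball 0 r. (maximal (evo (\<lambda>\<xi>. P (swap \<xi>)) g) x)\<^sup>2 \<partial>lborel)
      \<le> ennreal (C * r) * wsq s g"
    unfolding good_region_def by blast
  show ?thesis
    unfolding good_region_def
  proof (intro exI[of _ C] conjI allI impI C0)
    fix g :: "real^2 \<Rightarrow> complex" and r :: real
    assume g: "tame g" and T: "\<forall>\<xi>. g \<xi> \<noteq> 0 \<longrightarrow> \<xi> \<in> T" and r: "r \<ge> 0"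
    have [measurable]: "g \<in> borel_measurable borel" using g by (rule tame_measurable)
    have evo: "evo (\<lambda>\<xi>. P (swap \<xi>)) (\<lambda>\<xi>. g (swap \<xi>)) t (swap x) = evo P g t x" for t x
    proof -
      have "evo P g t x = (\<integral>\<xi>. cis (x \<bullet> swap \<xi>) * (cis (t * P (swap \<xi>)) * g (swap \<xi>)) \<partial>lborel)"
        unfolding evo_def ft2_def mult_1_left
        by (rule integral_swap[symmetric, of "\<lambda>\<xi>. cis (x \<bullet> \<xi>) * (cis (t * P \<xi>) * g \<xi>)"])
           (intro integrable_cis_mult tame_integrable g tame_swap; measurable)+
      moreover have "x \<bullet> swap \<xi> = swap x \<bullet> \<xi>" for \<xi> by (simp add: inner_plane)
      ultimately show ?thesis by (simp add: evo_def ft2_def)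
    qed
    have mx: "maximal (evo P g) x = maximal (evo (\<lambda>\<xi>. P (swap \<xi>)) (\<lambda>\<xi>. g (swap \<xi>))) (swap x)" for x
      by (simp add: maximal_def evo)
    have [measurable]: "integrable lborel (\<lambda>\<xi>. g (swap \<xi>))" by (intro tame_integrable tame_swap g)
    have "(\<integral>\<^sup>+x\<in>cball 0 r. (maximal (evo P g) x)\<^sup>2 \<partial>lborel)
      = (\<integral>\<^sup>+x. (maximal (evo (\<lambda>\<xi>. P (swap \<xi>)) (\<lambda>\<xi>. g (swap \<xi>))) (swap x))\<^sup>2 * indicator (cball 0 r) (swap x) \<partial>lborel)"
      by (intro nn_integral_cong) (simp add: mx indicator_def norm_swap)
    also have "\<dots> = (\<integral>\<^sup>+x\<in>cball 0 r. (maximal (evo (\<lambda>\<xi>. P (swap \<xi>)) (\<lambda>\<xi>. g (swap \<xi>))) x)\<^sup>2 \<partial>lborel)"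
      by (rule nn_integral_swap) measurable
    also have "\<dots> \<le> ennreal (C * r) * wsq s (\<lambda>\<xi>. g (swap \<xi>))"
      using T by (intro C tame_swap g r) auto
    also have "wsq s (\<lambda>\<xi>. g (swap \<xi>))
        = (\<integral>\<^sup>+\<xi>. ennreal (weight s (swap \<xi>) * (cmod (g (swap \<xi>)))\<^sup>2) \<partial>lborel)"
      by (simp add: weight_def norm_swap)
    also have "\<dots> = wsq s g"
      by (rule nn_integral_swap) measurable
    finally show "(\<integral>\<^sup>+x\<in>cball 0 r. (maximal (evo P g) x)\<^sup>2 \<partial>lborel)
      \<le> ennreal (C * r) * wsq s g" .
  qed
qed

lemma good_region_freeze1:
  fixes P \<rho> :: "real^2 \<Rightarrow> real"
  assumes a: "a > 1" and [measurable]: "P \<in> borel_measurable borel" and lb: "locally_bounded P"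
    and [measurable]: "\<rho> \<in> borel_measurable borel" and pos: "\<And>\<xi>. \<xi> \<in> T \<Longrightarrow> \<rho> \<xi> > 0" and A: "A \<ge> 0"
    and level: "\<And>k b. (\<integral>\<^sup>+a. ennreal (if pt a b \<in> T \<and> \<lfloor>P (pt a b)\<rfloor> = k then \<rho> (pt a b) else 0) \<partial>lborel) \<le> ennreal A"
    and E: "E \<ge> 0" and weight: "\<And>\<xi>. \<xi> \<in> T \<Longrightarrow> (2 + \<bar>P \<xi>\<bar>) powr a / \<rho> \<xi> \<le> E * weight s \<xi>"
  shows "good_region P s T"
proof (rule good_region_swap, measurable, rule good_region_freeze2[where \<rho>="\<lambda>\<xi>. \<rho> (swap \<xi>)" and A=A and E=E, OF a])
  show "locally_bounded (\<lambda>\<xi>. P (swap \<xi>))"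
    using lb unfolding locally_bounded_def by (metis norm_swap)
  show "(\<integral>\<^sup>+b. ennreal (if pt a b \<in> {\<xi>. swap \<xi> \<in> T} \<and> \<lfloor>P (swap (pt a b))\<rfloor> = k then \<rho> (swap (pt a b)) else 0) \<partial>lborel) \<le> ennreal A" for k a
    using level[of a k] by (simp cong del: if_weak_cong)
  show "(2 + \<bar>P (swap \<xi>)\<bar>) powr a / \<rho> (swap \<xi>) \<le> E * weight s \<xi>" if "\<xi> \<in> {\<xi>. swap \<xi> \<in> T}" for \<xi>
    using weight[of "swap \<xi>"] that by (simp add: weight_def norm_swap)
qed (use pos A E in auto)

section \<open>The phases of the theorem\<close>

lemma phase_measurable [measurable]:
  assumes [measurable]: "h \<in> borel_measurable borel"
  shows "phase h \<in> borel_measurable borel"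
  unfolding phase_def[abs_def] by measurable

lemma locally_bounded_phase:
  assumes "\<And>N. \<exists>K. \<forall>y. \<bar>y\<bar> \<le> N \<longrightarrow> \<bar>h y\<bar> \<le> K"
  shows "locally_bounded (phase h)"
  unfolding locally_bounded_def
proof
  fix N
  from assms[of N] obtain K where K: "\<And>y. \<bar>y\<bar> \<le> N \<Longrightarrow> \<bar>h y\<bar> \<le> K" by blast
  show "\<exists>K. \<forall>\<xi>. norm \<xi> \<le> N \<longrightarrow> \<bar>phase h \<xi>\<bar> \<le> K"
  proof (intro exI[of _ "N * N + K"] allI impI)
    fix \<xi> :: "real^2" assume \<xi>: "norm \<xi> \<le> N"
    then have 12: "\<bar>\<xi> $ 1\<bar> \<le> N" "\<bar>\<xi> $ 2\<bar> \<le> N"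
      using component_le_norm_cart[of \<xi> 1] component_le_norm_cart[of \<xi> 2] by auto
    then have "\<bar>\<xi> $ 1 * \<xi> $ 2\<bar> \<le> N * N" unfolding abs_mult by (intro mult_mono) auto
    then show "\<bar>phase h \<xi>\<bar> \<le> N * N + K" using K[OF 12(1)] unfolding phase_def by linarith
  qed
qed

lemma weight_eq_powr_sqrt: "weight s \<xi> = sqrt (1 + (norm \<xi>)\<^sup>2) powr (2 * s)"
proof -
  have "sqrt (1 + (norm \<xi>)\<^sup>2) = (1 + (norm \<xi>)\<^sup>2) powr (1 / 2)"
    by (rule powr_half_sqrt[symmetric]) simp
  then show ?thesis by (simp add: weight_def powr_powr)
qed

lemma component_le_bracket: "\<bar>\<xi> $ i\<bar> \<le> sqrt (1 + (norm (\<xi> :: real^2))\<^sup>2)"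
  using component_le_norm_cart[of \<xi> i]
  by (intro real_le_rsqrt) (smt (verit) power2_abs power2_le_iff_abs_le abs_norm_cancel power_mono abs_ge_zero)

lemma bracket_ge_1: "1 \<le> sqrt (1 + (norm (\<xi> :: real^2))\<^sup>2)"
  by simp

text \<open>The width 2 of the strip replaces a bound on level sets, with \<open>\<rho>\<close>
  constant. Since the phase grows at most linearly on the strip, \<open>a = 2 * s\<close> turns its
  power into exactly the Sobolev weight.\<close>

lemma good_region_low:
  assumes [measurable]: "h \<in> borel_measurable borel" and hb: "\<And>N. \<exists>K. \<forall>y. \<bar>y\<bar> \<le> N \<longrightarrow> \<bar>h y\<bar> \<le> K"
    and s: "s > 1/2"
  shows "good_region (phase h) s {\<xi>. \<bar>\<xi> $ 1\<bar> \<le> 1}"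
proof -
  obtain K where K: "\<And>y. \<bar>y\<bar> \<le> 1 \<Longrightarrow> \<bar>h y\<bar> \<le> K" using hb[of 1] by blast
  have "K \<ge> 0" using K[of 0] by simp
  show ?thesis
  proof (rule good_region_freeze1[where a="2 * s" and \<rho>="\<lambda>_. 1" and A=2 and E="(3 + K) powr (2 * s)"])
    show "(\<integral>\<^sup>+a. ennreal (if pt a b \<in> {\<xi>. \<bar>\<xi> $ 1\<bar> \<le> 1} \<and> \<lfloor>phase h (pt a b)\<rfloor> = k then 1 else 0) \<partial>lborel) \<le> ennreal 2" for k b
    proof -
      have "(\<integral>\<^sup>+a. ennreal (if pt a b \<in> {\<xi>. \<bar>\<xi> $ 1\<bar> \<le> 1} \<and> \<lfloor>phase h (pt a b)\<rfloor> = k then 1 else 0) \<partial>lborel)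
        \<le> (\<integral>\<^sup>+a. indicator {-1..1::real} a \<partial>lborel)"
        by (intro nn_integral_mono) (auto simp: indicator_def)
      then show ?thesis by simp
    qed
    show "(2 + \<bar>phase h \<xi>\<bar>) powr (2 * s) / 1 \<le> (3 + K) powr (2 * s) * weight s \<xi>"
      if "\<xi> \<in> {\<xi>. \<bar>\<xi> $ 1\<bar> \<le> 1}" for \<xi>
    proof -
      define X where "X = sqrt (1 + (norm \<xi>)\<^sup>2)"
      have X: "1 \<le> X" "\<bar>\<xi> $ 2\<bar> \<le> X" unfolding X_def by (rule bracket_ge_1, rule component_le_bracket)
      have "\<bar>\<xi> $ 1 * \<xi> $ 2\<bar> \<le> 1 * X" unfolding abs_mult using that X by (intro mult_mono) auto
      then have "\<bar>phase h \<xi>\<bar> \<le> X + K" using K[of "\<xi> $ 1"] that unfolding phase_def by simp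
      moreover have "2 + X + K \<le> (3 + K) * X"
        using X(1) \<open>K \<ge> 0\<close> mult_left_mono[of 1 X "2 + K"] by (simp add: algebra_simps)
      ultimately have "2 + \<bar>phase h \<xi>\<bar> \<le> (3 + K) * X" by linarith
      then have "(2 + \<bar>phase h \<xi>\<bar>) powr (2 * s) \<le> ((3 + K) * X) powr (2 * s)"
        using s by (intro powr_mono2) auto
      also have "\<dots> = (3 + K) powr (2 * s) * weight s \<xi>"
        using X \<open>K \<ge> 0\<close> by (simp add: powr_mult weight_eq_powr_sqrt X_def)
      finally show ?thesis by simp
    qed
  qed (use s \<open>K \<ge> 0\<close> in \<open>auto intro: locally_bounded_phase hb\<close>)
qed

text \<open>The phase is affine in the second frequency with slope \<open>\<xi> $ 1\<close>, so a
  band meets each line in an interval of length \<open>1 / \<bar>a\<bar>\<close>. On this region the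
  phase is at most a multiple of \<open>b * X\<close>, where \<open>X\<close> is the bracket of
  \<open>\<xi>\<close>. With \<open>a = s + 1/2\<close>, dividing by \<open>b\<close> leaves
  \<open>b powr (s - 1/2) * X powr (s + 1/2)\<close>, at most \<open>X powr (2 * s)\<close> because
  \<open>b \<le> X\<close>.\<close>

lemma good_region_linear:
  assumes [measurable]: "h \<in> borel_measurable borel" and hb: "\<And>N. \<exists>K. \<forall>y. \<bar>y\<bar> \<le> N \<longrightarrow> \<bar>h y\<bar> \<le> K"
    and s: "s > 1/2" and D: "D \<ge> 0"
  shows "good_region (phase h) s {\<xi>. 1 < \<bar>\<xi> $ 1\<bar> \<and> \<bar>h (\<xi> $ 1)\<bar> \<le> D * \<bar>\<xi> $ 1\<bar> * (\<bar>\<xi> $ 1\<bar> + \<bar>\<xi> $ 2\<bar>)}"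
    (is "good_region _ _ ?T")
proof (rule good_region_freeze2[where a="s + 1/2" and \<rho>="\<lambda>\<xi>. \<bar>\<xi> $ 1\<bar>" and A=1 and E="(3 + 2 * D) powr (s + 1/2)"])
  show "(\<integral>\<^sup>+b. ennreal (if pt a b \<in> ?T \<and> \<lfloor>phase h (pt a b)\<rfloor> = k then \<bar>pt a b $ 1\<bar> else 0) \<partial>lborel) \<le> ennreal 1" for k a
  proof (cases "1 < \<bar>a\<bar>")
    case True
    \<comment> \<open>The left end of the interval of admissible \<open>b\<close>; division by a
      negative slope interchanges the two ends.\<close>
    define c where "c = (if a > 0 then (of_int k - h a) / a else (of_int k + 1 - h a) / a)"
    have "(\<integral>\<^sup>+b. ennreal (if pt a b \<in> ?T \<and> \<lfloor>phase h (pt a b)\<rfloor> = k then \<bar>pt a b $ 1\<bar> else 0) \<partial>lborel)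
      \<le> (\<integral>\<^sup>+b. ennreal \<bar>a\<bar> * indicator {c..c + 1 / \<bar>a\<bar>} b \<partial>lborel)"
    proof (intro nn_integral_mono)
      fix b
      have "b \<in> {c..c + 1 / \<bar>a\<bar>}" if "\<lfloor>phase h (pt a b)\<rfloor> = k"
      proof -
        have *: "of_int k - h a \<le> a * b" "a * b \<le> of_int k + 1 - h a"
          using that by (auto simp: phase_def floor_eq_iff)
        show ?thesis
        proof (cases "a > 0")
          case True
          then show ?thesis using * by (auto simp: c_def field_simps)
        next
          case False
          then have "a < 0" using \<open>1 < \<bar>a\<bar>\<close> by auto
          then have "c + 1 / \<bar>a\<bar> = (of_int k - h a) / a"
            by (simp add: c_def diff_divide_distrib add_divide_distrib)
          with \<open>a < 0\<close> show ?thesis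
            using * by (auto simp: c_def neg_le_divide_eq neg_divide_le_eq mult.commute)
        qed
      qed
      then show "ennreal (if pt a b \<in> ?T \<and> \<lfloor>phase h (pt a b)\<rfloor> = k then \<bar>pt a b $ 1\<bar> else 0)
        \<le> ennreal \<bar>a\<bar> * indicator {c..c + 1 / \<bar>a\<bar>} b"
        by (auto simp: indicator_def)
    qed
    also have "\<dots> = ennreal \<bar>a\<bar> * ennreal (1 / \<bar>a\<bar>)"
      by (subst nn_integral_cmult_indicator) auto
    also have "\<dots> = ennreal (\<bar>a\<bar> * (1 / \<bar>a\<bar>))" by (rule ennreal_mult[symmetric]) auto
    also have "\<bar>a\<bar> * (1 / \<bar>a\<bar>) = 1" using True by simp
    finally show ?thesis .
  qed simp
  show "(2 + \<bar>phase h \<xi>\<bar>) powr (s + 1/2) / \<bar>\<xi> $ 1\<bar> \<le> (3 + 2 * D) powr (s + 1/2) * weight s \<xi>"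
    if T: "\<xi> \<in> ?T" for \<xi>
  proof -
    define X where "X = sqrt (1 + (norm \<xi>)\<^sup>2)"
    define b where "b = \<bar>\<xi> $ 1\<bar>"
    have X: "1 \<le> X" "\<bar>\<xi> $ 2\<bar> \<le> X" "b \<le> X" unfolding X_def b_def
      by (rule bracket_ge_1, rule component_le_bracket, rule component_le_bracket)
    have b: "1 < b" using T by (simp add: b_def)
    have "\<bar>\<xi> $ 1 * \<xi> $ 2\<bar> \<le> b * X" unfolding abs_mult b_def using X by (intro mult_mono) auto
    moreover have "\<bar>h (\<xi> $ 1)\<bar> \<le> D * b * (2 * X)"
    proof -
      have "\<bar>h (\<xi> $ 1)\<bar> \<le> D * b * (b + \<bar>\<xi> $ 2\<bar>)" using T by (simp add: b_def)
      also have "\<dots> \<le> D * b * (2 * X)" using X D b by (intro mult_left_mono) auto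
      finally show ?thesis .
    qed
    \<comment> \<open>The constant \<open>3 + 2 * D\<close> collects 2 from here, 1 from the product
      of the components and \<open>2 * D\<close> from \<open>h\<close>.\<close>
    moreover have "2 \<le> 2 * (b * X)" using mult_mono[of 1 b 1 X] b X by simp
    ultimately have "2 + \<bar>phase h \<xi>\<bar> \<le> (3 + 2 * D) * (b * X)"
      unfolding phase_def by (simp add: algebra_simps)
    then have "(2 + \<bar>phase h \<xi>\<bar>) powr (s + 1/2) \<le> ((3 + 2 * D) * (b * X)) powr (s + 1/2)"
      using s by (intro powr_mono2) auto
    also have "\<dots> = (3 + 2 * D) powr (s + 1/2) * (b powr (s + 1/2) * X powr (s + 1/2))"
      using X b D by (simp add: powr_mult)
    also have "b powr (s + 1/2) = b powr (s - 1/2) * b"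
      using b powr_add[of b "s - 1/2" 1] by (simp add: add.commute)
    finally have "(2 + \<bar>phase h \<xi>\<bar>) powr (s + 1/2) / b
        \<le> (3 + 2 * D) powr (s + 1/2) * (b powr (s - 1/2) * X powr (s + 1/2))"
      using b by (simp add: field_simps)
    also have "\<dots> \<le> (3 + 2 * D) powr (s + 1/2) * (X powr (s - 1/2) * X powr (s + 1/2))"
      using X b s by (intro mult_left_mono mult_right_mono powr_mono2) auto
    also have "X powr (s - 1/2) * X powr (s + 1/2) = weight s \<xi>"
      by (simp add: weight_eq_powr_sqrt X_def flip: powr_add)
    finally show ?thesis by (simp add: b_def)
  qed
qed (use s in \<open>auto intro: locally_bounded_phase hb\<close>)

section \<open>Level sets where the power of the first frequency dominates\<close>

lemma power_Suc_diff_ge: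
  fixes a b :: real
  assumes "0 \<le> a" "a \<le> b"
  shows "real (Suc n) * a ^ n * (b - a) \<le> b ^ Suc n - a ^ Suc n"
proof (induction n)
  case (Suc n)
  have "real (Suc (Suc n)) * a ^ Suc n * (b - a)
      = a * (real (Suc n) * a ^ n * (b - a)) + a ^ Suc n * (b - a)"
    by (simp add: algebra_simps)
  also have "\<dots> \<le> a * (b ^ Suc n - a ^ Suc n) + a ^ Suc n * (b - a)"
    using Suc assms by (intro add_right_mono mult_left_mono)
  also have "\<dots> \<le> b * (b ^ Suc n - a ^ Suc n) + a ^ Suc n * (b - a)"
    using assms power_mono[of a b "Suc n"] by (intro add_right_mono mult_right_mono) auto
  also have "\<dots> = b ^ Suc (Suc n) - a ^ Suc (Suc n)" by (simp add: algebra_simps)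
  finally show ?case .
qed simp

text \<open>On the interval from \<open>x\<close> to \<open>y\<close> the derivative of the phase is
  at least \<open>x ^ n\<close> from the power minus \<open>x ^ n / 2\<close> from
  \<open>\<eta>\<close>. Half of the growth of the power survives, whence the factor 2.\<close>

lemma phase_nat_separation:
  fixes x y \<eta> :: real
  assumes "0 \<le> x" "x \<le> y" "\<bar>\<eta>\<bar> \<le> x ^ n / 2"
  shows "x ^ n * (y - x) \<le> 2 * ((y * \<eta> + h_nat (Suc n) y) - (x * \<eta> + h_nat (Suc n) x))"
proof -
  define A E H where "A = x ^ n * (y - x)" and "E = \<eta> * (y - x)" and "H = h_nat (Suc n) y - h_nat (Suc n) x"
  have "A \<le> (y ^ Suc n - x ^ Suc n) / real (Suc n)"
    using power_Suc_diff_ge[OF assms(1,2), of n]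
    by (simp add: A_def pos_le_divide_eq mult_ac del: of_nat_Suc power_Suc)
  also have "\<dots> = H"
    by (simp add: H_def h_nat_def diff_divide_distrib)
  finally have "A \<le> H" .
  moreover have "- (x ^ n / 2) * (y - x) \<le> E"
    unfolding E_def using assms by (intro mult_right_mono) auto
  then have "- (A / 2) \<le> E" by (simp add: A_def)
  moreover have "2 * ((y * \<eta> + h_nat (Suc n) y) - (x * \<eta> + h_nat (Suc n) x)) = 2 * E + 2 * H"
    by (simp add: E_def H_def algebra_simps)
  ultimately have "A \<le> 2 * ((y * \<eta> + h_nat (Suc n) y) - (x * \<eta> + h_nat (Suc n) x))" by linarith
  then show ?thesis by (simp only: A_def)
qed

text \<open>With \<open>m = Inf L\<close>, separation confines \<open>L\<close> to an interval of
  length \<open>2 / m ^ n\<close> starting at \<open>m\<close>. As \<open>1 \<le> m\<close>, this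
  length is at most \<open>2 * m\<close>, so \<open>x \<le> 3 * m\<close> on \<open>L\<close>, and
  height times length is \<open>(3 * m) ^ n * (2 / m ^ n)\<close>.\<close>

lemma level_set_power_integral:
  fixes L :: "real set"
  assumes L: "\<And>x. x \<in> L \<Longrightarrow> 1 < x"
    and sep: "\<And>x y. x \<in> L \<Longrightarrow> y \<in> L \<Longrightarrow> x \<le> y \<Longrightarrow> x ^ n * (y - x) \<le> 2"
  shows "(\<integral>\<^sup>+x. ennreal (if x \<in> L then x ^ n else 0) \<partial>lborel) \<le> ennreal (2 * 3 ^ n)"
proof (cases "L = {}")
  case False
  define m where "m = Inf L"
  have bdd: "bdd_below L" using L by (intro bdd_belowI[of _ 1]) (auto intro: less_imp_le)
  have m1: "1 \<le> m" unfolding m_def using False L by (intro cInf_greatest) (auto intro: less_imp_le)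
  have mn: "1 \<le> m ^ n" using m1 by simp
  have up: "y \<le> m + 2 / m ^ n" if y: "y \<in> L" for y
  proof -
    have "y - 2 / m ^ n \<le> m"
      unfolding m_def
    proof (rule cInf_greatest[OF False])
      fix x assume x: "x \<in> L"
      have mx: "m \<le> x" unfolding m_def using x bdd by (rule cInf_lower)
      show "y - 2 / Inf L ^ n \<le> x"
      proof (cases "x \<le> y")
        case True
        have "m ^ n * (y - x) \<le> x ^ n * (y - x)"
          using mx m1 True by (intro mult_right_mono power_mono) auto
        then have "m ^ n * (y - x) \<le> 2" using sep[OF x y True] by linarith
        then have "y - x \<le> 2 / m ^ n" using mn by (simp add: pos_le_divide_eq mult.commute)
        then show ?thesis unfolding m_def by linarith
      next
        case False
        have "0 \<le> 2 / m ^ n" using mn by simp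
        then show ?thesis using False unfolding m_def by linarith
      qed
    qed
    then show ?thesis by linarith
  qed
  have "(\<integral>\<^sup>+x. ennreal (if x \<in> L then x ^ n else 0) \<partial>lborel)
    \<le> (\<integral>\<^sup>+x. ennreal ((3 * m) ^ n) * indicator {m..m + 2 / m ^ n} x \<partial>lborel)"
  proof (rule nn_integral_mono)
    fix x
    show "ennreal (if x \<in> L then x ^ n else 0) \<le> ennreal ((3 * m) ^ n) * indicator {m..m + 2 / m ^ n} x"
    proof (cases "x \<in> L")
      case True
      have mx: "m \<le> x" unfolding m_def using True bdd by (rule cInf_lower)
      have "2 / m ^ n \<le> 2 * m" using mn m1 divide_left_mono[of 1 "m ^ n" 2] by simp
      then have "x \<le> 3 * m" using up[OF True] by linarith
      then have "x ^ n \<le> (3 * m) ^ n" using mx m1 by (intro power_mono) auto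
      then show ?thesis using True mx up[OF True] by (simp add: ennreal_leI)
    qed simp
  qed
  also have "\<dots> = ennreal ((3 * m) ^ n) * ennreal (2 / m ^ n)"
    using mn by (subst nn_integral_cmult_indicator) auto
  also have "\<dots> = ennreal ((3 * m) ^ n * (2 / m ^ n))"
    using m1 by (intro ennreal_mult[symmetric]) auto
  also have "(3 * m) ^ n * (2 / m ^ n) = 2 * 3 ^ n"
    using m1 by (simp add: power_mult_distrib)
  finally show ?thesis .
qed simp

text \<open>Here the derivative of the phase in the first frequency, \<open>\<xi>\<^sub>2\<close>
  plus the power \<open>n\<close> of \<open>\<xi>\<^sub>1\<close>, is comparable with that power,
  which is therefore the weight \<open>\<rho>\<close>, and \<open>x $ 1\<close> is frozen.\<close>

lemma good_region_power:
  assumes s: "s > 1/2"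
  shows "good_region (phase (h_nat (Suc n))) s {\<xi>. 1 < \<bar>\<xi> $ 1\<bar> \<and> \<bar>\<xi> $ 2\<bar> \<le> \<bar>\<xi> $ 1\<bar> ^ n / 2}"
    (is "good_region ?P s ?T")
proof -
  \<comment> \<open>Chosen so that \<open>Suc n * p = n + 2 * s\<close>: the phase has size
    \<open>b ^ Suc n\<close>, and dividing its power \<open>p\<close> by
    \<open>\<rho> = b ^ n\<close> leaves \<open>b powr (2 * s)\<close>.\<close>
  define p where "p = 1 + (2 * s - 1) / real (Suc n)"
  have p: "p > 1" using s by (simp add: p_def)
  have hm [measurable]: "h_nat (Suc n) \<in> borel_measurable borel" unfolding h_nat_def[abs_def] by measurable
  show ?thesis
  proof (rule good_region_freeze1[OF p, where \<rho>="\<lambda>\<xi>. \<bar>\<xi> $ 1\<bar> ^ n" and A="4 * 3 ^ n" and E="4 powr p"])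
    show "locally_bounded ?P"
    proof (rule locally_bounded_phase)
      fix N :: real
      show "\<exists>K. \<forall>y. \<bar>y\<bar> \<le> N \<longrightarrow> \<bar>h_nat (Suc n) y\<bar> \<le> K"
        by (intro exI[of _ "1 / real (Suc n) * N ^ Suc n"] allI impI)
           (auto simp: h_nat_def abs_mult power_abs simp del: power_Suc intro!: divide_right_mono power_mono)
    qed
    show "(\<integral>\<^sup>+a. ennreal (if pt a b \<in> ?T \<and> \<lfloor>?P (pt a b)\<rfloor> = k then \<bar>pt a b $ 1\<bar> ^ n else 0) \<partial>lborel) \<le> ennreal (4 * 3 ^ n)" for k b
    proof -
      \<comment> \<open>The negative half-line is parametrised by \<open>x = - a\<close>, so both
        halves become level sets in \<open>x > 1\<close>. Their two contributions
        \<open>2 * 3 ^ n\<close> give the constant \<open>4 * 3 ^ n\<close>.\<close>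
      define L1 where "L1 = {x. 1 < x \<and> \<bar>b\<bar> \<le> x ^ n / 2 \<and> \<lfloor>?P (pt x b)\<rfloor> = k}"
      define L2 where "L2 = {x. 1 < x \<and> \<bar>b\<bar> \<le> x ^ n / 2 \<and> \<lfloor>?P (pt (- x) b)\<rfloor> = k}"
      have P: "?P (pt x b) = x * b + h_nat (Suc n) x" for x by (simp add: phase_def)
      have floor_close: "\<bar>u - v\<bar> \<le> 1" if "\<lfloor>u\<rfloor> = k" "\<lfloor>v\<rfloor> = k" for u v :: real
        using that by linarith
      have L1: "(\<integral>\<^sup>+x. ennreal (if x \<in> L1 then x ^ n else 0) \<partial>lborel) \<le> ennreal (2 * 3 ^ n)"
      proof (rule level_set_power_integral)
        fix x y assume "x \<in> L1" "y \<in> L1" "x \<le> y"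
        then show "x ^ n * (y - x) \<le> 2"
          using phase_nat_separation[of x y b n] floor_close[of "?P (pt y b)" "?P (pt x b)"]
          unfolding L1_def P by auto
      qed (auto simp: L1_def)
      have L2: "(\<integral>\<^sup>+x. ennreal (if x \<in> L2 then x ^ n else 0) \<partial>lborel) \<le> ennreal (2 * 3 ^ n)"
      proof (rule level_set_power_integral)
        fix x y assume xy: "x \<in> L2" "y \<in> L2" "x \<le> y"
        then have c: "\<bar>?P (pt (- y) b) - ?P (pt (- x) b)\<bar> \<le> 1"
          by (intro floor_close) (auto simp: L2_def)
        show "x ^ n * (y - x) \<le> 2"
        \<comment> \<open>Reflection either keeps the power and changes the sign of
          \<open>b\<close>, or changes the sign of the whole phase. In both cases
          \<open>phase_nat_separation\<close> applies, since the condition on \<open>b\<close>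
          concerns its modulus only.\<close>
        proof (cases "even (Suc n)")
          case True
          then have "h_nat (Suc n) (- z) = h_nat (Suc n) z" for z
            unfolding h_nat_def by (simp only: power_minus_even)
          then show ?thesis
            using phase_nat_separation[of x y "- b" n] xy c unfolding L2_def P by auto
        next
          case False
          then have "h_nat (Suc n) (- z) = - h_nat (Suc n) z" for z
            unfolding h_nat_def using power_minus_odd[OF False, of z] by (simp del: power_Suc)
          then show ?thesis
            using phase_nat_separation[of x y b n] xy c unfolding L2_def P by auto
        qed
      qed (auto simp: L2_def)
      have meas: "(\<lambda>x. ennreal (if x \<in> L1 then x ^ n else 0)) \<in> borel_measurable borel"
        "(\<lambda>x. ennreal (if x \<in> L2 then x ^ n else 0)) \<in> borel_measurable borel"
        unfolding L1_def L2_def P mem_Collect_eq floor_eq_iff by measurable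
      note [measurable] = meas
      have "(\<integral>\<^sup>+a. ennreal (if pt a b \<in> ?T \<and> \<lfloor>?P (pt a b)\<rfloor> = k then \<bar>pt a b $ 1\<bar> ^ n else 0) \<partial>lborel)
        \<le> (\<integral>\<^sup>+a. ennreal (if a \<in> L1 then a ^ n else 0) + ennreal (if - a \<in> L2 then (- a) ^ n else 0) \<partial>lborel)"
      proof (rule nn_integral_mono)
        fix a
        show "ennreal (if pt a b \<in> ?T \<and> \<lfloor>?P (pt a b)\<rfloor> = k then \<bar>pt a b $ 1\<bar> ^ n else 0)
          \<le> ennreal (if a \<in> L1 then a ^ n else 0) + ennreal (if - a \<in> L2 then (- a) ^ n else 0)"
          by (cases "a > 0") (auto simp: L1_def L2_def)
      qed
      also have "\<dots> = (\<integral>\<^sup>+a. ennreal (if a \<in> L1 then a ^ n else 0) \<partial>lborel)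
          + (\<integral>\<^sup>+a. ennreal (if - a \<in> L2 then (- a) ^ n else 0) \<partial>lborel)"
        using measurable_compose[OF borel_measurable_uminus[OF measurable_ident_sets[OF refl]] meas(2)]
        by (intro nn_integral_add) (simp_all add: meas)
      also have "(\<integral>\<^sup>+a. ennreal (if - a \<in> L2 then (- a) ^ n else 0) \<partial>lborel)
          = (\<integral>\<^sup>+a. ennreal (if a \<in> L2 then a ^ n else 0) \<partial>lborel)"
        using nn_integral_real_affine[OF meas(2), of "-1" 0] by (simp cong del: if_weak_cong)
      also have "(\<integral>\<^sup>+a. ennreal (if a \<in> L1 then a ^ n else 0) \<partial>lborel) + \<dots>
          \<le> ennreal (2 * 3 ^ n) + ennreal (2 * 3 ^ n)"
        by (intro add_mono L1 L2)
      also have "\<dots> = ennreal (2 * 3 ^ n + 2 * 3 ^ n)"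
        by (rule ennreal_plus[symmetric]) auto
      also have "2 * 3 ^ n + 2 * 3 ^ n = (4 * 3 ^ n :: real)" by simp
      finally show ?thesis .
    qed
    show "(2 + \<bar>?P \<xi>\<bar>) powr p / \<bar>\<xi> $ 1\<bar> ^ n \<le> 4 powr p * weight s \<xi>" if T: "\<xi> \<in> ?T" for \<xi>
    proof -
      define X where "X = sqrt (1 + (norm \<xi>)\<^sup>2)"
      define b where "b = \<bar>\<xi> $ 1\<bar>"
      have X: "b \<le> X" unfolding X_def b_def by (rule component_le_bracket)
      have b: "1 < b" and b2: "\<bar>\<xi> $ 2\<bar> \<le> b ^ n / 2" using T by (auto simp: b_def)
      have bS: "b ^ Suc n > 1" using b by (rule one_less_power) simp
      have "\<bar>\<xi> $ 1 * \<xi> $ 2\<bar> \<le> b * (b ^ n / 2)"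
        unfolding abs_mult b_def[symmetric] using b b2 by (intro mult_left_mono) auto
      moreover have "\<bar>h_nat (Suc n) (\<xi> $ 1)\<bar> = b ^ Suc n / real (Suc n)"
        by (simp add: h_nat_def b_def abs_mult power_abs del: power_Suc)
      moreover have "b ^ Suc n / real (Suc n) \<le> b ^ Suc n"
        using bS by (simp add: divide_le_eq mult_left_mono del: power_Suc)
      ultimately have "2 + \<bar>?P \<xi>\<bar> \<le> 4 * b ^ Suc n"
        using bS unfolding phase_def by simp
      then have "(2 + \<bar>?P \<xi>\<bar>) powr p \<le> (4 * b ^ Suc n) powr p"
        using p by (intro powr_mono2) auto
      also have "\<dots> = 4 powr p * (b powr real (Suc n)) powr p"
        using b by (simp only: powr_mult powr_realpow)
      also have "(b powr real (Suc n)) powr p = b powr (real n + 2 * s)"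
      proof -
        have "real (Suc n) * p = real (Suc n) + (2 * s - 1)"
          by (simp add: p_def distrib_left del: of_nat_Suc)
        also have "\<dots> = real n + 2 * s" by simp
        finally show ?thesis by (simp only: powr_powr)
      qed
      also have "\<dots> = b ^ n * b powr (2 * s)"
        using b by (simp add: powr_add powr_realpow)
      finally have "(2 + \<bar>?P \<xi>\<bar>) powr p / b ^ n \<le> 4 powr p * b powr (2 * s)"
        using b by (simp add: field_simps)
      also have "\<dots> \<le> 4 powr p * X powr (2 * s)"
        using b X s by (intro mult_left_mono powr_mono2) auto
      also have "X powr (2 * s) = weight s \<xi>" by (simp add: weight_eq_powr_sqrt X_def)
      finally show ?thesis by (simp add: b_def)
    qed
  qed (use hm in auto)
qed

lemma locally_bounded_h_nat: "\<exists>K. \<forall>y. \<bar>y\<bar> \<le> N \<longrightarrow> \<bar>h_nat m y\<bar> \<le> K"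
  by (intro exI[of _ "1 / real m * N ^ m"] allI impI)
     (auto simp: h_nat_def abs_mult power_abs intro!: divide_right_mono power_mono)

lemma h_nat_measurable [measurable]: "h_nat m \<in> borel_measurable borel"
  unfolding h_nat_def[abs_def] by measurable

lemma h_real_measurable [measurable]: "h_real m \<in> borel_measurable borel"
  unfolding h_real_def[abs_def] by measurable

lemma locally_bounded_h_real:
  assumes "m > 0"
  shows "\<exists>K. \<forall>y. \<bar>y\<bar> \<le> N \<longrightarrow> \<bar>h_real m y\<bar> \<le> K"
  using assms
  by (intro exI[of _ "1 / m * N powr m"] allI impI)
     (auto simp: h_real_def abs_mult intro!: divide_right_mono powr_mono2)

text \<open>Beyond the strip, a frequency that violates the condition of
  \<open>good_region_power\<close> satisfies
  \<open>\<bar>\<xi> $ 1\<bar> ^ n < 2 * \<bar>\<xi> $ 2\<bar>\<close>. Then the power in the phase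
  is at most twice the product of the components, so it falls under
  \<open>good_region_linear\<close> with \<open>D = 2\<close>.\<close>

lemma good_region_h_nat:
  assumes m: "m \<ge> 1" and s: "s > 1/2"
  shows "good_region (phase (h_nat m)) s UNIV"
proof -
  obtain n where n: "m = Suc n" using m by (cases m) auto
  define A where "A = {\<xi> :: real^2. \<bar>\<xi> $ 1\<bar> \<le> 1}"
  define B where "B = {\<xi> :: real^2. 1 < \<bar>\<xi> $ 1\<bar> \<and> \<bar>h_nat m (\<xi> $ 1)\<bar> \<le> 2 * \<bar>\<xi> $ 1\<bar> * (\<bar>\<xi> $ 1\<bar> + \<bar>\<xi> $ 2\<bar>)}"
  define C where "C = {\<xi> :: real^2. 1 < \<bar>\<xi> $ 1\<bar> \<and> \<bar>\<xi> $ 2\<bar> \<le> \<bar>\<xi> $ 1\<bar> ^ n / 2}"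
  have [measurable]: "A \<in> sets borel" "B \<in> sets borel"
    unfolding A_def B_def by measurable
  have "good_region (phase (h_nat m)) s ((A \<union> B) \<union> C)"
    unfolding n
  proof (intro good_region_Un)
    show "good_region (phase (h_nat (Suc n))) s A"
      unfolding A_def by (intro good_region_low locally_bounded_h_nat s) measurable
    show "good_region (phase (h_nat (Suc n))) s B"
      unfolding B_def n by (intro good_region_linear locally_bounded_h_nat s) auto
    show "good_region (phase (h_nat (Suc n))) s C"
      unfolding C_def by (rule good_region_power[OF s])
  qed measurable
  moreover have "(A \<union> B) \<union> C = UNIV"
  proof -
    have "\<xi> \<in> B" if "1 < \<bar>\<xi> $ 1\<bar>" "\<not> \<bar>\<xi> $ 2\<bar> \<le> \<bar>\<xi> $ 1\<bar> ^ n / 2" for \<xi>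
    proof -
      define b where "b = \<bar>\<xi> $ 1\<bar>"
      have b: "1 < b" using that by (simp add: b_def)
      have "\<bar>h_nat m (\<xi> $ 1)\<bar> = b ^ Suc n / real (Suc n)"
        by (simp add: n h_nat_def b_def abs_mult power_abs del: power_Suc)
      also have "\<dots> \<le> b ^ Suc n"
        using b by (simp add: divide_le_eq mult_left_mono del: power_Suc)
      also have "\<dots> \<le> 2 * b * \<bar>\<xi> $ 2\<bar>"
        using that b mult_left_mono[of "b ^ n" "2 * \<bar>\<xi> $ 2\<bar>" b] by (simp add: b_def)
      also have "\<dots> \<le> 2 * b * (b + \<bar>\<xi> $ 2\<bar>)"
        using b by (intro mult_left_mono) auto
      finally show ?thesis using that by (simp add: B_def b_def)
    qed
    then have "\<xi> \<in> (A \<union> B) \<union> C" for \<xi>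
      by (cases "1 < \<bar>\<xi> $ 1\<bar>"; cases "\<bar>\<xi> $ 2\<bar> \<le> \<bar>\<xi> $ 1\<bar> ^ n / 2") (auto simp: A_def C_def)
    then show ?thesis by blast
  qed
  ultimately show ?thesis by simp
qed

text \<open>Since \<open>m < 2\<close>, \<open>h_real m\<close> is at most the square of the first
  frequency outside the strip, so all of these frequencies fall under
  \<open>good_region_linear\<close> with \<open>D = 1\<close>.\<close>

lemma good_region_h_real:
  assumes m: "1 < m" "m < 2" and s: "s > 1/2"
  shows "good_region (phase (h_real m)) s UNIV"
proof -
  define A where "A = {\<xi> :: real^2. \<bar>\<xi> $ 1\<bar> \<le> 1}"
  define B where "B = {\<xi> :: real^2. 1 < \<bar>\<xi> $ 1\<bar> \<and> \<bar>h_real m (\<xi> $ 1)\<bar> \<le> 1 * \<bar>\<xi> $ 1\<bar> * (\<bar>\<xi> $ 1\<bar> + \<bar>\<xi> $ 2\<bar>)}"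
  have [measurable]: "A \<in> sets borel" unfolding A_def by measurable
  have "good_region (phase (h_real m)) s (A \<union> B)"
  proof (intro good_region_Un)
    show "good_region (phase (h_real m)) s A"
      unfolding A_def using m by (intro good_region_low locally_bounded_h_real s) auto
    show "good_region (phase (h_real m)) s B"
      unfolding B_def using m by (intro good_region_linear locally_bounded_h_real s) auto
  qed measurable
  moreover have "A \<union> B = UNIV"
  proof -
    have "\<xi> \<in> B" if "1 < \<bar>\<xi> $ 1\<bar>" for \<xi>
    proof -
      define b where "b = \<bar>\<xi> $ 1\<bar>"
      have b: "1 < b" using that by (simp add: b_def)
      have "\<bar>h_real m (\<xi> $ 1)\<bar> = b powr m / m"
        using m by (simp add: h_real_def b_def abs_mult)
      also have "\<dots> \<le> b powr m" using m mult_left_mono[of 1 m "b powr m"] by (simp add: divide_le_eq)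
      also have "\<dots> \<le> b powr 2" using m b by (intro powr_mono) auto
      also have "\<dots> = 1 * b * b" using b by (simp add: powr_numeral power2_eq_square)
      also have "\<dots> \<le> 1 * b * (b + \<bar>\<xi> $ 2\<bar>)" using b by (intro mult_left_mono) auto
      finally show ?thesis using that by (simp add: B_def b_def)
    qed
    then have "\<xi> \<in> A \<union> B" for \<xi> by (cases "1 < \<bar>\<xi> $ 1\<bar>") (auto simp: A_def)
    then show ?thesis by blast
  qed
  ultimately show ?thesis by simp
qed

section \<open>Existence of the evolution and the maximal estimate\<close>

lemma sobolev_norm_squared:
  "(sobolev_norm s f)\<^sup>2 = wsq s (fourier f)"
proof -
  have "((1 + (norm \<xi>)\<^sup>2) powr (s / 2))\<^sup>2 = weight s \<xi>" for \<xi> :: "real^2"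
    by (simp add: weight_def power2_eq_square flip: powr_add)
  then show ?thesis
    unfolding sobolev_norm_def L2_norm_squared by (simp add: norm_mult power_mult_distrib)
qed

text \<open>One evolution is constructed as a limit of evolutions of tame functions and estimated.
  By \<open>is_evolution_unique\<close> any other evolution of the same datum has the same maximal
  function almost everywhere, so the bound holds for all of them.\<close>

theorem maximal_estimate:
  assumes [measurable]: "P \<in> borel_measurable borel" and good: "good_region P s UNIV" and s: "s \<ge> 0"
  shows "\<exists>C::real. C > 0 \<and> (\<forall>f. in_sobolev s f \<longrightarrow> (\<exists>u. is_evolution P f u) \<and>
    (\<forall>u. is_evolution P f u \<longrightarrow> L2_norm_on (ball 0 1) (maximal u) \<le> ennreal C * sobolev_norm s f))"
proof -
  from good obtain C where C0: "C \<ge> 0" and C: "\<And>g r. tame g \<Longrightarrow> r \<ge> 0 \<Longrightarrow>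
    (\<integral>\<^sup>+x\<in>cball 0 r. (maximal (evo P g) x)\<^sup>2 \<partial>lborel)
      \<le> ennreal (C * r) * wsq s g"
    unfolding good_region_def by blast
  \<comment> \<open>The root comes from passing from squares to norms; 1 is added because
    \<open>C\<close> may be 0 while a positive constant is asserted.\<close>
  have main: "(\<exists>u. is_evolution P f u) \<and> (\<forall>u. is_evolution P f u \<longrightarrow>
      L2_norm_on (ball 0 1) (maximal u) \<le> ennreal (sqrt C + 1) * sobolev_norm s f)"
    if f: "in_sobolev s f" for f
  proof -
    define g where "g = fourier f"
    have "is_fourier f g"
      using f unfolding g_def in_sobolev_def by (intro is_fourier_fourier) simp
    then have [measurable]: "g \<in> borel_measurable borel" and g2: "l2sq g < top"
      by (auto simp: is_fourier_def has_L2_integral_def in_L2_def L2_norm_less_top_iff)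
    define W where "W = wsq s g"
    have W: "W = (sobolev_norm s f)\<^sup>2" by (simp add: W_def g_def sobolev_norm_squared)
    have Wfin: "W < top"
      using f unfolding W in_sobolev_def by (simp add: power2_eq_square ennreal_mult_less_top)
    define \<delta> where "\<delta> n = wsq s (\<lambda>\<xi>. g \<xi> - trunc n g \<xi>)" for n
    have \<delta>: "\<delta> \<longlonglongrightarrow> 0"
      unfolding \<delta>_def using Wfin unfolding W_def
      by (intro trunc_weighted_tendsto_0) (auto intro: less_imp_le weight_pos)
    have lim: "(\<lambda>n. l2sq (\<lambda>\<xi>. g \<xi> - trunc n g \<xi>)) \<longlonglongrightarrow> 0"
      using trunc_weighted_tendsto_0[of g "\<lambda>_. 1"] g2 by simp
    have tt: "tame (trunc n g)" for n by (intro tame_trunc) measurable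
    have ti: "integrable lborel (trunc n g)" for n by (intro tame_integrable tt)
    have td: "tame (\<lambda>\<xi>. trunc m g \<xi> - trunc n g \<xi>)" for n m
    proof (rule tameI[where B="real m + real n" and N="real m + real n"])
      show "cmod (trunc m g \<xi> - trunc n g \<xi>) \<le> real m + real n" for \<xi>
        by (rule order_trans[OF norm_triangle_ineq4]) (auto simp: trunc_def)
    qed (auto simp: trunc_def split: if_splits)
    have [measurable]: "integrable lborel (\<lambda>\<xi>. trunc m g \<xi> - trunc n g \<xi>)" for n m
      by (rule tame_integrable[OF td])
    define D where "D n m = maximal (evo P (\<lambda>\<xi>. trunc m g \<xi> - trunc n g \<xi>))" for n m
    \<comment> \<open>The discs \<open>cball 0 (real j)\<close> exhaust the plane:
      \<open>is_evolution\<close> demands continuity for almost every \<open>x\<close>, not only in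
      the unit ball.\<close>
    have "\<exists>r. strict_mono r \<and> (AE x in lborel. (\<Sum>k. D (r k) (r (Suc k)) x) < top)"
    proof (rule fast_subsequence[where A="\<lambda>j. cball 0 (real j)" and c="\<lambda>j. C * real j", OF _ _ _ \<delta>])
      show "D n m \<in> borel_measurable lborel" for n m
        unfolding D_def by measurable
      show "(\<integral>\<^sup>+x\<in>cball 0 (real j). (D n m x)\<^sup>2 \<partial>lborel) \<le> ennreal (C * real j) * \<delta> n" if "n \<le> m" for j n m
      proof -
        have "(\<integral>\<^sup>+x\<in>cball 0 (real j). (D n m x)\<^sup>2 \<partial>lborel)
          \<le> ennreal (C * real j) * wsq s (\<lambda>\<xi>. trunc m g \<xi> - trunc n g \<xi>)"
          unfolding D_def by (intro C td) simp
        also have "\<dots> \<le> ennreal (C * real j) * \<delta> n"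
          unfolding \<delta>_def using norm_trunc_diff_le[OF that, of g]
          by (intro mult_left_mono nn_integral_mono ennreal_leI power_mono)
             (auto simp: norm_minus_commute less_imp_le[OF weight_pos])
        finally show ?thesis .
      qed
      show "(\<Union>j. cball 0 (real j)) = space (lborel :: (real^2) measure)"
        by (auto simp: real_arch_simple)
    qed simp
    then obtain r where r: "strict_mono r" and AE: "AE x in lborel. (\<Sum>k. D (r k) (r (Suc k)) x) < top"
      by blast
    define e where "e k = evo P (trunc (r k) g)" for k
    have e_meas [measurable]: "e k t \<in> borel_measurable borel" for k t
      unfolding e_def by measurable
    define v where "v t x = lim (\<lambda>k. e k t x)" for t x
    have good_x: "AE x in lborel. (\<forall>t\<in>{0<..<1}. (\<lambda>k. e k t x) \<longlonglongrightarrow> v t x) \<and> continuous_on {0<..<1} (\<lambda>t. v t x)"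
      using AE
    proof eventually_elim
      case (elim x)
      define d where "d k = enn2real (D (r k) (r (Suc k)) x)" for k
      have fin: "D (r k) (r (Suc k)) x < top" for k
      proof -
        have "D (r k) (r (Suc k)) x \<le> (\<Sum>k. D (r k) (r (Suc k)) x)"
          using sum_le_suminf[of "\<lambda>k. D (r k) (r (Suc k)) x" "{k}"] by simp
        then show ?thesis using elim by (rule le_less_trans)
      qed
      have Dd: "D (r k) (r (Suc k)) x = ennreal (d k)" for k
        using fin[of k] by (simp add: d_def less_top)
      have "summable d"
        using elim unfolding Dd by (intro summable_suminf_not_top) (auto simp: d_def)
      have le: "cmod (e (Suc k) t x - e k t x) \<le> d k" if t: "t \<in> {0<..<1}" for k t
      proof -
        have "ennreal (cmod (e (Suc k) t x - e k t x))
            = ennreal (cmod (evo P (\<lambda>\<xi>. trunc (r (Suc k)) g \<xi> - trunc (r k) g \<xi>) t x))"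
          unfolding e_def by (simp add: evo_diff[OF _ ti ti])
        also have "\<dots> \<le> D (r k) (r (Suc k)) x"
          unfolding D_def maximal_def using t by (rule SUP_upper)
        finally show ?thesis unfolding Dd by (simp add: d_def)
      qed
      define S where "S t = (\<Sum>k. e (Suc k) t x - e k t x)" for t
      \<comment> \<open>The supremum over \<open>t\<close> is already contained in \<open>d\<close>,
        so its summability at \<open>x\<close> gives convergence uniform in time, and continuity in
        \<open>t\<close> passes to the limit.\<close>
      have unif: "uniform_limit {0<..<1} (\<lambda>n t. \<Sum>k<n. e (Suc k) t x - e k t x) S sequentially"
        unfolding S_def by (rule Weierstrass_m_test[OF le \<open>summable d\<close>])
      have tel: "(\<Sum>k<n. e (Suc k) t x - e k t x) = e n t x - e 0 t x" for n t
        by (rule sum_lessThan_telescope)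
      have conv: "(\<lambda>k. e k t x) \<longlonglongrightarrow> S t + e 0 t x" if t: "t \<in> {0<..<1}" for t
      proof -
        have "(\<lambda>n. (e n t x - e 0 t x) + e 0 t x) \<longlonglongrightarrow> S t + e 0 t x"
          using tendsto_uniform_limitI[OF unif t] unfolding tel by (intro tendsto_add tendsto_const)
        then show ?thesis by simp
      qed
      have v: "v t x = S t + e 0 t x" if "t \<in> {0<..<1}" for t
        unfolding v_def using conv[OF that] by (rule limI)
      have ce: "continuous_on {0<..<1} (\<lambda>t. e k t x)" for k
        unfolding e_def by (intro continuous_on_evo ti) measurable
      have "continuous_on {0<..<1} S"
        by (rule uniform_limit_theorem[OF _ unif])
           (auto simp: tel intro!: always_eventually continuous_on_diff ce)
      then have "continuous_on {0<..<1} (\<lambda>t. S t + e 0 t x)"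
        by (intro continuous_on_add ce)
      then have "continuous_on {0<..<1} (\<lambda>t. v t x)"
        by (rule continuous_on_eq) (simp add: v)
      then show ?case using conv v by auto
    qed
    have vmeas [measurable]: "v t \<in> borel_measurable borel" for t
      unfolding v_def[abs_def] by measurable
    have ev: "is_evolution P f v"
      unfolding is_evolution_def
    proof (intro conjI ballI)
      show "AE x in lborel. continuous_on {0<..<1} (\<lambda>t. v t x)"
        using good_x by eventually_elim simp
      fix t :: real assume t: "t \<in> {0<..<1}"
      have "has_L2_integral (\<lambda>x \<xi>. cis (1 * (x \<bullet> \<xi>)) * (cis (t * P \<xi>) * g \<xi>)) (v t)"
      proof (rule has_L2_integral_limit(1)[where h="\<lambda>k \<xi>. cis (t * P \<xi>) * trunc (r k) g \<xi>"])
        show "l2sq (\<lambda>\<xi>. cis (t * P \<xi>) * g \<xi>) < top" using g2 by simp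
        show "integrable lborel (\<lambda>\<xi>. cis (t * P \<xi>) * trunc (r k) g \<xi>)" for k
          by (intro integrable_cis_mult ti) measurable
        have "(\<lambda>k. l2sq (\<lambda>\<xi>. g \<xi> - trunc (r k) g \<xi>)) \<longlonglongrightarrow> 0"
          using LIMSEQ_subseq_LIMSEQ[OF lim r] by (simp add: o_def)
        moreover have "cmod (cis (t * P \<xi>) * g \<xi> - cis (t * P \<xi>) * trunc (r k) g \<xi>) = cmod (g \<xi> - trunc (r k) g \<xi>)" for k \<xi>
          by (simp flip: right_diff_distrib)
        ultimately show "(\<lambda>k. l2sq (\<lambda>\<xi>. cis (t * P \<xi>) * g \<xi> - cis (t * P \<xi>) * trunc (r k) g \<xi>)) \<longlonglongrightarrow> 0"
          by simp
        show "AE x in lborel. (\<lambda>k. ft2 1 (\<lambda>\<xi>. cis (t * P \<xi>) * trunc (r k) g \<xi>) x) \<longlonglongrightarrow> v t x"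
          using good_x unfolding e_def evo_def by eventually_elim (use t in blast)
      qed auto
      then show "has_L2_integral (\<lambda>x \<xi>. cis (x \<bullet> \<xi> + t * P \<xi>) * fourier f \<xi>) (v t)"
        by (simp add: g_def mult.assoc flip: cis_mult)
    qed
    have bound: "(\<integral>\<^sup>+x\<in>ball 0 1. (maximal v x)\<^sup>2 \<partial>lborel) \<le> ennreal C * W"
    proof -
      have [measurable]: "maximal (e k) \<in> borel_measurable borel" for k
        unfolding e_def using ti by measurable
      \<comment> \<open>The supremum of a pointwise limit is at most the lower limit of the suprema;
        Fatou in \<open>x\<close> then transfers the tame estimate to \<open>v\<close>.\<close>
      have pw: "(maximal v x)\<^sup>2 \<le> liminf (\<lambda>k. (maximal (e k) x)\<^sup>2)"
        if x: "\<forall>t\<in>{0<..<1}. (\<lambda>k. e k t x) \<longlonglongrightarrow> v t x" for x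
      proof -
        define B where "B = liminf (\<lambda>k. (maximal (e k) x)\<^sup>2)"
        have "maximal v x \<le> ennsqrt B"
          unfolding maximal_def
        proof (rule SUP_least)
          fix t :: real assume t: "t \<in> {0<..<1}"
          have "(\<lambda>k. ennreal ((cmod (e k t x))\<^sup>2)) \<longlonglongrightarrow> ennreal ((cmod (v t x))\<^sup>2)"
            using x t by (intro tendsto_ennrealI tendsto_power tendsto_norm) auto
          then have "ennreal ((cmod (v t x))\<^sup>2) = liminf (\<lambda>k. ennreal ((cmod (e k t x))\<^sup>2))"
            by (intro lim_imp_Liminf[symmetric]) auto
          also have "\<dots> \<le> B"
            unfolding B_def
          proof (intro Liminf_mono always_eventually allI)
            fix k
            have "ennreal (cmod (e k t x)) \<le> maximal (e k) x"
              unfolding maximal_def using t by (rule SUP_upper)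
            then have "(ennreal (cmod (e k t x)))\<^sup>2 \<le> (maximal (e k) x)\<^sup>2"
              by (rule power_mono) simp
            then show "ennreal ((cmod (e k t x))\<^sup>2) \<le> (maximal (e k) x)\<^sup>2"
              by (simp add: ennreal_power)
          qed
          finally have "(ennreal (cmod (v t x)))\<^sup>2 \<le> (ennsqrt B)\<^sup>2"
            by (simp add: ennsqrt_squared ennreal_power)
          then show "ennreal (cmod (v t x)) \<le> ennsqrt B" by (rule ennreal_power2_le_imp_le)
        qed
        then have "(maximal v x)\<^sup>2 \<le> (ennsqrt B)\<^sup>2" by (rule power_mono) simp
        then show ?thesis by (simp add: ennsqrt_squared B_def)
      qed
      have "(\<integral>\<^sup>+x\<in>ball 0 1. (maximal v x)\<^sup>2 \<partial>lborel)
        \<le> (\<integral>\<^sup>+x. liminf (\<lambda>k. (maximal (e k) x)\<^sup>2 * indicator (cball 0 1) x) \<partial>lborel)"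
      proof (rule nn_integral_mono_AE, use good_x in eventually_elim)
        case (elim x)
        then show ?case using pw[of x] by (auto simp: indicator_def)
      qed
      also have "\<dots> \<le> liminf (\<lambda>k. \<integral>\<^sup>+x\<in>cball 0 1. (maximal (e k) x)\<^sup>2 \<partial>lborel)"
        by (rule nn_integral_liminf) measurable
      also have "\<dots> \<le> liminf (\<lambda>k. ennreal C * W)"
      proof (intro Liminf_mono always_eventually allI)
        fix k
        have "(\<integral>\<^sup>+x\<in>cball 0 1. (maximal (e k) x)\<^sup>2 \<partial>lborel)
          \<le> ennreal (C * 1) * wsq s (trunc (r k) g)"
          unfolding e_def by (intro C tt) simp
        also have "\<dots> \<le> ennreal (C * 1) * W"
          unfolding W_def
          by (intro mult_left_mono nn_integral_mono ennreal_leI power_mono norm_trunc_le)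
             (auto simp: less_imp_le[OF weight_pos])
        finally show "(\<integral>\<^sup>+x\<in>cball 0 1. (maximal (e k) x)\<^sup>2 \<partial>lborel) \<le> ennreal C * W" by simp
      qed
      also have "\<dots> = ennreal C * W" by (simp add: Liminf_const)
      finally show ?thesis .
    qed
    have "L2_norm_on (ball 0 1) (maximal u) \<le> ennreal (sqrt C + 1) * sobolev_norm s f"
      if u: "is_evolution P f u" for u
    proof (rule ennreal_power2_le_imp_le)
      have "AE x in lborel. \<forall>t\<in>{0<..<1}. u t x = v t x"
        by (rule is_evolution_unique[OF u ev]) (simp_all flip: g_def)
      then have "(\<integral>\<^sup>+x\<in>ball 0 1. (maximal u x)\<^sup>2 \<partial>lborel) = (\<integral>\<^sup>+x\<in>ball 0 1. (maximal v x)\<^sup>2 \<partial>lborel)"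
        by (intro nn_integral_cong_AE, eventually_elim) (simp add: maximal_def)
      then have "(L2_norm_on (ball 0 1) (maximal u))\<^sup>2 \<le> ennreal C * W"
        using bound by (simp add: L2_norm_on_def ennsqrt_squared)
      also have "\<dots> \<le> ennreal ((sqrt C + 1)\<^sup>2) * W"
      proof (intro mult_right_mono ennreal_leI)
        have "(sqrt C)\<^sup>2 \<le> (sqrt C + 1)\<^sup>2" using C0 by (intro power_mono) auto
        then show "C \<le> (sqrt C + 1)\<^sup>2" using C0 by simp
      qed simp
      also have "\<dots> = (ennreal (sqrt C + 1) * sobolev_norm s f)\<^sup>2"
      proof -
        have "ennreal ((sqrt C + 1)\<^sup>2) = (ennreal (sqrt C + 1))\<^sup>2"
          using C0 by (intro ennreal_power[symmetric]) auto
        then show ?thesis by (simp only: W power_mult_distrib)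
      qed
      finally show "(L2_norm_on (ball 0 1) (maximal u))\<^sup>2 \<le> (ennreal (sqrt C + 1) * sobolev_norm s f)\<^sup>2" .
    qed
    with ev show ?thesis by blast
  qed
  show ?thesis
    by (rule exI[of _ "sqrt C + 1"]) (use main C0 in \<open>auto intro: add_nonneg_pos\<close>)
qed

section \<open>Fourier inversion for products of tent functions\<close>

text \<open>A Gaussian factor is inserted in the outer transform. As it widens, dominated
  convergence restores the outer transform because \<open>ft f\<close> is integrable; by
  \<open>ft_gauss_cutoff\<close> the same quantity is \<open>2 * pi\<close> times an average of
  \<open>f\<close> near \<open>\<xi>\<close>, which tends to \<open>f \<xi>\<close> by
  continuity.\<close>

lemma fourier_inversion_line:
  fixes f :: "real \<Rightarrow> complex"
  assumes f: "integrable lborel f" and cont: "continuous_on UNIV f" and B: "\<And>x. cmod (f x) \<le> B"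
    and F: "integrable lborel (ft f)"
  shows "ft (ft f) (- \<xi>) = 2 * pi * f \<xi>"
proof (rule LIMSEQ_unique)
  have [measurable]: "f \<in> borel_measurable borel" using f by auto
  have [measurable]: "ft f \<in> borel_measurable borel" by measurable
  have eq: "ft (\<lambda>x. gauss (Suc n) x * ft f x) (- \<xi>)
      = (\<integral>x. cis (- \<xi> * x) * (complex_of_real (gauss (Suc n) x) * ft f x) \<partial>lborel)" for n
    by (rule ft_def)
  show "(\<lambda>n. ft (\<lambda>x. gauss (Suc n) x * ft f x) (- \<xi>)) \<longlonglongrightarrow> ft (ft f) (- \<xi>)"
    unfolding eq ft_def[of "ft f"]
  proof (rule integral_dominated_convergence[where w="\<lambda>x. cmod (ft f x)"])
    show "AE x in lborel. (\<lambda>n. cis (- \<xi> * x) * (complex_of_real (gauss (Suc n) x) * ft f x)) \<longlonglongrightarrow> cis (- \<xi> * x) * ft f x"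
    proof (rule AE_I2)
      fix x
      have "(\<lambda>n. cis (- \<xi> * x) * (complex_of_real (gauss (Suc n) x) * ft f x)) \<longlonglongrightarrow> cis (- \<xi> * x) * (complex_of_real 1 * ft f x)"
        by (intro tendsto_intros gauss_tendsto)
      then show "(\<lambda>n. cis (- \<xi> * x) * (complex_of_real (gauss (Suc n) x) * ft f x)) \<longlonglongrightarrow> cis (- \<xi> * x) * ft f x" by simp
    qed
    show "AE x in lborel. norm (cis (- \<xi> * x) * (complex_of_real (gauss (Suc n) x) * ft f x)) \<le> cmod (ft f x)" for n
      using gauss_nonneg[of "Suc n"] gauss_le_1[of "Suc n"]
      by (intro AE_I2) (simp add: norm_mult mult_left_le_one_le)
  qed (use F in auto)
  \<comment> \<open>Substituting \<open>\<eta> = \<xi> + z / Suc n\<close> moves the shrinking width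
    from the density into the argument of \<open>f\<close>, so one fixed density dominates all
    \<open>n\<close>.\<close>
  have sub: "ft (\<lambda>x. gauss (Suc n) x * ft f x) (- \<xi>)
      = (\<integral>z. 2 * pi * (of_real (std_normal_density z) * f (\<xi> + z / Suc n)) \<partial>lborel)" for n
  proof -
    define c where "c = 1 / real (Suc n)"
    have c: "c > 0" by (simp add: c_def)
    have "ft (\<lambda>x. gauss (Suc n) x * ft f x) (- \<xi>)
      = (\<integral>\<eta>. 2 * pi * normal_density 0 c (- \<xi> + \<eta>) * f \<eta> \<partial>lborel)"
      using ft_gauss_cutoff[OF f, of "real (Suc n)" "- \<xi>"] by (simp add: c_def)
    also have "\<dots> = \<bar>c\<bar> *\<^sub>R (\<integral>z. 2 * pi * normal_density 0 c (- \<xi> + (\<xi> + c * z)) * f (\<xi> + c * z) \<partial>lborel)"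
      using c by (intro lborel_integral_real_affine) simp
    also have "\<dots> = (\<integral>z. \<bar>c\<bar> *\<^sub>R (2 * pi * normal_density 0 c (- \<xi> + (\<xi> + c * z)) * f (\<xi> + c * z)) \<partial>lborel)"
      by (rule integral_scaleR_right[symmetric])
    also have "\<dots> = (\<integral>z. 2 * pi * (of_real (std_normal_density z) * f (\<xi> + z / Suc n)) \<partial>lborel)"
    proof (rule Bochner_Integration.integral_cong)
      fix z
      have "c * normal_density 0 c (c * z) = std_normal_density z"
        using c by (simp add: normal_density_def real_sqrt_mult power_mult_distrib)
      then have "complex_of_real (std_normal_density z) = of_real c * of_real (normal_density 0 c (c * z))"
        by (metis of_real_mult)
      then show "\<bar>c\<bar> *\<^sub>R (2 * pi * normal_density 0 c (- \<xi> + (\<xi> + c * z)) * f (\<xi> + c * z))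
        = 2 * pi * (of_real (std_normal_density z) * f (\<xi> + z / Suc n))"
        using c by (simp add: scaleR_conv_of_real c_def mult_ac)
    qed simp
    finally show ?thesis .
  qed
  have "(\<lambda>n. \<integral>z. 2 * pi * (of_real (std_normal_density z) * f (\<xi> + z / Suc n)) \<partial>lborel)
      \<longlonglongrightarrow> (\<integral>z. 2 * pi * (of_real (std_normal_density z) * f \<xi>) \<partial>lborel)"
  proof (rule integral_dominated_convergence[where w="\<lambda>z. 2 * pi * B * std_normal_density z"])
    show "AE z in lborel. (\<lambda>n. 2 * pi * (of_real (std_normal_density z) * f (\<xi> + z / Suc n)))
        \<longlonglongrightarrow> 2 * pi * (of_real (std_normal_density z) * f \<xi>)"
    proof (rule AE_I2)
      fix z
      have "(\<lambda>n. \<xi> + z / Suc n) \<longlonglongrightarrow> \<xi> + 0"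
        using LIMSEQ_Suc[OF lim_const_over_n[of z]] by (intro tendsto_add tendsto_const) simp
      then have "(\<lambda>n. f (\<xi> + z / Suc n)) \<longlonglongrightarrow> f \<xi>"
        using continuous_on_tendsto_compose[OF cont, of "\<lambda>n. \<xi> + z / Suc n" \<xi>] by simp
      then show "(\<lambda>n. 2 * pi * (of_real (std_normal_density z) * f (\<xi> + z / Suc n)))
        \<longlonglongrightarrow> 2 * pi * (of_real (std_normal_density z) * f \<xi>)"
        by (intro tendsto_intros)
    qed
    show "AE z in lborel. norm (2 * pi * (of_real (std_normal_density z) * f (\<xi> + z / Suc n)))
        \<le> 2 * pi * B * std_normal_density z" for n
    proof (rule AE_I2)
      fix z
      have "norm (2 * pi * (of_real (std_normal_density z) * f (\<xi> + z / Suc n)))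
        = (2 * pi * std_normal_density z) * cmod (f (\<xi> + z / Suc n))"
        by (simp add: norm_mult)
      also have "\<dots> \<le> (2 * pi * std_normal_density z) * B"
        by (intro mult_left_mono B) simp
      finally show "norm (2 * pi * (of_real (std_normal_density z) * f (\<xi> + z / Suc n)))
        \<le> 2 * pi * B * std_normal_density z" by (simp add: mult_ac)
    qed
  qed auto
  moreover have "(\<integral>z. 2 * pi * (of_real (std_normal_density z) * f \<xi>) \<partial>lborel) = 2 * pi * f \<xi>"
  proof -
    have "(\<integral>z. 2 * pi * (of_real (std_normal_density z) * f \<xi>) \<partial>lborel)
      = (\<integral>z. complex_of_real (std_normal_density z) * (2 * pi * f \<xi>) \<partial>lborel)"
      by (simp only: mult_ac)
    also have "\<dots> = (\<integral>z. complex_of_real (std_normal_density z) \<partial>lborel) * (2 * pi * f \<xi>)"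
      by (rule integral_mult_left_zero)
    also have "(\<integral>z. complex_of_real (std_normal_density z) \<partial>lborel) = of_real 1"
      by (subst integral_complex_of_real) simp
    finally show ?thesis by simp
  qed
  ultimately show "(\<lambda>n. ft (\<lambda>x. gauss (Suc n) x * ft f x) (- \<xi>)) \<longlonglongrightarrow> 2 * pi * f \<xi>"
    unfolding sub by simp
qed

text \<open>The tent is the convolution of the indicator of \<open>{p..q}\<close> with itself, so that its Fourier
  transform is a square and hence integrable by Plancherel.\<close>

definition tent :: "real \<Rightarrow> real \<Rightarrow> real \<Rightarrow> real" where
  "tent p q \<xi> = max 0 (min q (\<xi> - p) - max p (\<xi> - q))"

lemma tent_nonneg: "0 \<le> tent p q \<xi>"
  by (simp add: tent_def)

lemma tent_le: "p \<le> q \<Longrightarrow> tent p q \<xi> \<le> q - p"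
  by (simp add: tent_def)

lemma tent_support: "tent p q \<xi> \<noteq> 0 \<Longrightarrow> 2 * p \<le> \<xi> \<and> \<xi> \<le> 2 * q"
  by (auto simp: tent_def max_def min_def split: if_splits)

lemma continuous_tent: "continuous_on UNIV (tent p q)"
  unfolding tent_def[abs_def] by (intro continuous_intros)

lemma tent_measurable [measurable]: "tent p q \<in> borel_measurable borel"
  unfolding tent_def[abs_def] by measurable

lemma tame_tent: "p \<le> q \<Longrightarrow> tame (\<lambda>\<xi>. complex_of_real (tent p q \<xi>))"
  by (rule tameI[where B="q - p" and N="2 * \<bar>p\<bar> + 2 * \<bar>q\<bar>"])
     (use tent_nonneg[of p q] tent_le[of p q] tent_support[of p q] in \<open>auto, fastforce\<close>)

text \<open>The product of the two indicators is the indicator of an intersection of intervals, and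
  the formula of \<open>tent\<close> is the length of that intersection.\<close>

lemma tent_convolution:
  assumes "p \<le> q"
  shows "(\<integral>\<eta>. indicator {p..q} \<eta> * indicator {p..q} (\<xi> - \<eta>) \<partial>lborel) = complex_of_real (tent p q \<xi>)"
proof -
  have "(\<integral>\<eta>. indicator {p..q} \<eta> * indicator {p..q} (\<xi> - \<eta>) \<partial>lborel)
    = (\<integral>\<eta>. complex_of_real (indicator {max p (\<xi> - q)..min q (\<xi> - p)} \<eta>) \<partial>lborel)"
    by (intro Bochner_Integration.integral_cong) (auto simp: indicator_def)
  also have "\<dots> = complex_of_real (tent p q \<xi>)"
    by (subst integral_complex_of_real) (simp add: tent_def max_def)
  finally show ?thesis .
qed

lemma ft_tent:
  assumes pq: "p \<le> q"
  shows "ft (\<lambda>\<xi>. complex_of_real (tent p q \<xi>)) x = (ft (indicator {p..q}) x)\<^sup>2"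
proof -
  define I where "I = (indicator {p..q} :: real \<Rightarrow> complex)"
  have [measurable]: "I \<in> borel_measurable borel" unfolding I_def by measurable
  define N where "N = \<bar>p\<bar> + \<bar>q\<bar>"
  have I: "cmod (I a) \<le> 1" "I a \<noteq> 0 \<Longrightarrow> \<bar>a\<bar> \<le> N" for a
    by (auto simp: I_def indicator_def N_def split: if_splits)
  have int: "integrable (lborel \<Otimes>\<^sub>M lborel) (\<lambda>(\<xi>, \<eta>). cis (x * \<xi>) * (I \<eta> * I (\<xi> - \<eta>)))"
    unfolding lborel_prod
  proof (rule integrable_bounded_support[where B=1 and N="3 * N"])
    show "(\<lambda>(\<xi>, \<eta>). cis (x * \<xi>) * (I \<eta> * I (\<xi> - \<eta>))) \<in> borel_measurable borel"
      by (simp add: borel_prod[symmetric])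
    show "cmod (case z of (\<xi>, \<eta>) \<Rightarrow> cis (x * \<xi>) * (I \<eta> * I (\<xi> - \<eta>))) \<le> 1" for z
      using I(1) by (auto simp: norm_mult split: prod.split intro!: mult_le_one)
    show "norm z \<le> 3 * N" if "(case z of (\<xi>, \<eta>) \<Rightarrow> cis (x * \<xi>) * (I \<eta> * I (\<xi> - \<eta>))) \<noteq> 0" for z
    proof (cases z)
      case (Pair \<xi> \<eta>)
      then have "\<bar>\<eta>\<bar> \<le> N" "\<bar>\<xi> - \<eta>\<bar> \<le> N" using that I(2) by auto
      moreover have "norm z \<le> \<bar>\<xi>\<bar> + \<bar>\<eta>\<bar>"
        unfolding Pair using norm_Pair_le[of \<xi> \<eta>] by simp
      ultimately show ?thesis by linarith
    qed
  qed
  have "ft (\<lambda>\<xi>. complex_of_real (tent p q \<xi>)) x = (\<integral>\<xi>. (\<integral>\<eta>. cis (x * \<xi>) * (I \<eta> * I (\<xi> - \<eta>)) \<partial>lborel) \<partial>lborel)"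
    unfolding ft_def I_def by (simp add: tent_convolution[OF pq, symmetric])
  also have "\<dots> = (\<integral>\<eta>. (\<integral>\<xi>. cis (x * \<xi>) * (I \<eta> * I (\<xi> - \<eta>)) \<partial>lborel) \<partial>lborel)"
    by (rule lborel_pair.Fubini_integral[OF int, symmetric])
  also have "\<dots> = (\<integral>\<eta>. cis (x * \<eta>) * I \<eta> * ft I x \<partial>lborel)"
  proof (rule Bochner_Integration.integral_cong)
    fix \<eta>
    have "(\<integral>\<xi>. cis (x * \<xi>) * (I \<eta> * I (\<xi> - \<eta>)) \<partial>lborel)
      = \<bar>1\<bar> *\<^sub>R (\<integral>\<zeta>. cis (x * (\<eta> + 1 * \<zeta>)) * (I \<eta> * I ((\<eta> + 1 * \<zeta>) - \<eta>)) \<partial>lborel)"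
      by (rule lborel_integral_real_affine) simp
    also have "\<dots> = (\<integral>\<zeta>. (cis (x * \<eta>) * I \<eta>) * (cis (x * \<zeta>) * I \<zeta>) \<partial>lborel)"
      by (simp add: distrib_left mult_ac flip: cis_mult)
    also have "\<dots> = cis (x * \<eta>) * I \<eta> * ft I x"
      unfolding ft_def by (rule integral_mult_right_zero)
    finally show "(\<integral>\<xi>. cis (x * \<xi>) * (I \<eta> * I (\<xi> - \<eta>)) \<partial>lborel) = cis (x * \<eta>) * I \<eta> * ft I x" .
  qed simp
  also have "\<dots> = ft I x * ft I x"
    by (subst integral_mult_left_zero) (simp add: ft_def)
  finally show ?thesis by (simp add: power2_eq_square I_def)
qed

lemma integrable_ft_tent:
  assumes pq: "p \<le> q"
  shows "integrable lborel (ft (\<lambda>\<xi>. complex_of_real (tent p q \<xi>)))"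
proof (rule integrableI_bounded)
  define I where "I = (indicator {p..q} :: real \<Rightarrow> complex)"
  have I: "integrable lborel I"
  proof (rule integrable_bounded_support)
    show "cmod (I x) \<le> 1" for x by (simp add: I_def indicator_def)
    show "norm x \<le> \<bar>p\<bar> + \<bar>q\<bar>" if "I x \<noteq> 0" for x
      using that by (auto simp: I_def indicator_def split: if_splits)
  qed (simp add: I_def)
  have "(\<integral>\<^sup>+x. ennreal (norm (ft (\<lambda>\<xi>. complex_of_real (tent p q \<xi>)) x)) \<partial>lborel) = l2sq (ft I)"
    by (simp add: ft_tent[OF pq] norm_power I_def)
  also have "\<dots> \<le> ennreal (2 * pi) * l2sq I" by (rule plancherel[OF I])
  also have "l2sq I = (\<integral>\<^sup>+\<eta>. indicator {p..q} \<eta> \<partial>lborel)"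
    by (intro nn_integral_cong) (simp add: I_def indicator_def)
  also have "ennreal (2 * pi) * \<dots> < \<infinity>"
    using pq by (simp add: ennreal_mult_less_top)
  finally show "(\<integral>\<^sup>+x. ennreal (norm (ft (\<lambda>\<xi>. complex_of_real (tent p q \<xi>)) x)) \<partial>lborel) < \<infinity>" .
  have [measurable]: "(\<lambda>\<xi>. complex_of_real (tent p q \<xi>)) \<in> borel_measurable lborel" by measurable
  show "ft (\<lambda>\<xi>. complex_of_real (tent p q \<xi>)) \<in> borel_measurable lborel" by simp
qed

lemma tent_inversion:
  assumes "p \<le> q"
  shows "ft (ft (\<lambda>\<xi>. complex_of_real (tent p q \<xi>))) (- \<xi>) = 2 * pi * complex_of_real (tent p q \<xi>)"
proof (rule fourier_inversion_line)
  show "continuous_on UNIV (\<lambda>\<xi>. complex_of_real (tent p q \<xi>))"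
    by (intro continuous_on_of_real continuous_tent)
  show "cmod (complex_of_real (tent p q \<xi>)) \<le> q - p" for \<xi>
    using tent_nonneg[of p q \<xi>] tent_le[OF assms, of \<xi>] by simp
qed (use tame_integrable[OF tame_tent] integrable_ft_tent assms in auto)

text \<open>The value of \<open>ft_tent\<close> at 0: the integral of a convolution is the product
  of the integrals.\<close>

lemma integral_tent:
  assumes "p \<le> q"
  shows "(\<integral>\<xi>. tent p q \<xi> \<partial>lborel) = (q - p)\<^sup>2"
proof -
  have "complex_of_real (\<integral>\<xi>. tent p q \<xi> \<partial>lborel) = ft (\<lambda>\<xi>. complex_of_real (tent p q \<xi>)) 0"
    by (simp add: ft_def)
  also have "\<dots> = (ft (indicator {p..q}) 0)\<^sup>2" by (rule ft_tent[OF assms])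
  also have "ft (indicator {p..q}) 0 = (\<integral>\<eta>. complex_of_real (indicator {p..q} \<eta>) \<partial>lborel)"
    unfolding ft_def by (intro Bochner_Integration.integral_cong) (auto simp: indicator_def)
  also have "\<dots> = of_real (q - p)"
    using assms by (subst integral_complex_of_real) simp
  finally show ?thesis by (metis of_real_eq_iff of_real_power)
qed

lemma integrable_tent: "p \<le> q \<Longrightarrow> integrable lborel (tent p q)"
  using tame_integrable[OF tame_tent[of p q]] by (simp only: complex_of_real_integrable_eq)

lemma nn_integral_tent_power2:
  assumes "p \<le> q"
  shows "(\<integral>\<^sup>+\<xi>. ennreal ((tent p q \<xi>)\<^sup>2) \<partial>lborel) \<le> ennreal ((q - p) ^ 3)"
proof -
  have "(\<integral>\<^sup>+\<xi>. ennreal ((tent p q \<xi>)\<^sup>2) \<partial>lborel) \<le> (\<integral>\<^sup>+\<xi>. ennreal ((q - p) * tent p q \<xi>) \<partial>lborel)"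
    using tent_nonneg[of p q] tent_le[OF assms]
    by (intro nn_integral_mono ennreal_leI) (simp add: power2_eq_square mult_right_mono)
  also have "\<dots> = ennreal (\<integral>\<xi>. (q - p) * tent p q \<xi> \<partial>lborel)"
    using integrable_tent[OF assms] tent_nonneg assms by (intro nn_integral_eq_integral) auto
  also have "(\<integral>\<xi>. (q - p) * tent p q \<xi> \<partial>lborel) = (q - p) ^ 3"
    by (simp add: integral_tent[OF assms] power3_eq_cube power2_eq_square)
  finally show ?thesis .
qed

section \<open>Data with a prescribed Fourier transform\<close>

lemma has_L2_integral_integrable:
  assumes g: "integrable lborel g" and fin: "l2sq g < top" and \<sigma>: "\<bar>\<sigma>\<bar> = 1"
  shows "has_L2_integral (\<lambda>x \<xi>. cis (\<sigma> * (x \<bullet> \<xi>)) * g \<xi>) (ft2 \<sigma> g)"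
proof -
  have [measurable]: "g \<in> borel_measurable borel" using g by auto
  show ?thesis
    by (rule has_L2_integral_limit(1)[OF _ fin \<sigma>, of "\<lambda>_. g"]) (use g in auto)
qed

lemma has_L2_integral_cong:
  assumes [measurable]: "\<And>x. K x \<in> borel_measurable borel" "\<And>x. K' x \<in> borel_measurable borel"
    and "\<And>x. AE y in lborel. K x y = K' x y"
  shows "has_L2_integral K F \<longleftrightarrow> has_L2_integral K' F"
proof -
  have "(LINT y:cball 0 r|lborel. K x y) = (LINT y:cball 0 r|lborel. K' x y)" for r x
    unfolding set_lebesgue_integral_def
    by (rule integral_cong_AE) (measurable, use assms(3)[of x] in eventually_elim, simp)
  then show ?thesis by (simp add: has_L2_integral_def)
qed

lemma tame_l2sq:
  fixes g :: "'a::euclidean_space \<Rightarrow> complex"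
  assumes "tame g"
  shows "l2sq g < top"
proof -
  from assms obtain B N where B: "\<And>\<xi>. cmod (g \<xi>) \<le> B" and "B > 0" by (rule tameE) blast
  have "l2sq g \<le> (\<integral>\<^sup>+\<xi>. ennreal B * ennreal (cmod (g \<xi>)) \<partial>lborel)"
  proof (rule nn_integral_mono)
    fix \<xi>
    have "ennreal ((cmod (g \<xi>))\<^sup>2) \<le> ennreal (B * cmod (g \<xi>))"
      using B[of \<xi>] by (intro ennreal_leI) (simp add: power2_eq_square mult_right_mono)
    then show "ennreal ((cmod (g \<xi>))\<^sup>2) \<le> ennreal B * ennreal (cmod (g \<xi>))"
      using \<open>B > 0\<close> by (simp add: ennreal_mult)
  qed
  also have "\<dots> = ennreal B * (\<integral>\<^sup>+\<xi>. ennreal (cmod (g \<xi>)) \<partial>lborel)"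
    using tame_measurable[OF assms] by (intro nn_integral_cmult) measurable
  also have "\<dots> < top"
    using tame_integrable[OF assms] by (simp add: integrable_iff_bounded ennreal_mult_less_top)
  finally show ?thesis .
qed

text \<open>\<open>fourier\<close> is a choice, so its value is known only through uniqueness of
  mean-square limits: inversion shows that \<open>g\<close> is an admissible transform, hence it
  agrees with the chosen one almost everywhere.\<close>

lemma fourier_of_inverse:
  fixes g :: "real^2 \<Rightarrow> complex"
  assumes g: "tame g" and f: "integrable lborel (ft2 1 g)"
    and inv: "\<And>\<xi>. ft2 (-1) (ft2 1 g) \<xi> = (2 * pi)\<^sup>2 * g \<xi>"
  shows "in_L2 (ft2 1 g)" and "AE \<xi> in lborel. fourier (ft2 1 g) \<xi> = g \<xi>"
proof -
  have [measurable]: "g \<in> borel_measurable borel" using g by (rule tame_measurable)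
  have "l2sq (ft2 1 g) \<le> ennreal ((2 * pi)\<^sup>2) * l2sq g"
    by (rule plancherel_plane_1[OF tame_integrable[OF g]])
  also have "\<dots> < top" using tame_l2sq[OF g] by (simp add: ennreal_mult_less_top)
  finally have fin: "l2sq (ft2 1 g) < top" .
  then show L2: "in_L2 (ft2 1 g)"
    by (simp add: in_L2_def L2_norm_less_top_iff)
  define h where "h x = ft2 1 g x / (2 * pi)\<^sup>2" for x
  have hint: "integrable lborel h" unfolding h_def using f by simp
  have hg: "ft2 (-1) h \<xi> = g \<xi>" for \<xi>
  proof -
    have "ft2 (-1) h \<xi> = ft2 (-1) (ft2 1 g) \<xi> / (2 * pi)\<^sup>2"
      unfolding h_def ft2_def[of "-1"] by (simp only: times_divide_eq_right integral_divide_zero)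
    then show ?thesis by (simp add: inv)
  qed
  have "l2sq h \<le> l2sq (ft2 1 g)"
  proof (intro nn_integral_mono ennreal_leI power_mono)
    fix x
    have "1 \<le> (2 * pi)\<^sup>2" using pi_gt3 by (intro one_le_power) simp
    moreover have "cmod (h x) = cmod (ft2 1 g x) / (2 * pi)\<^sup>2"
      by (simp add: h_def norm_divide norm_mult norm_power)
    ultimately show "cmod (h x) \<le> cmod (ft2 1 g x)"
      using divide_left_mono[of 1 "(2 * pi)\<^sup>2" "cmod (ft2 1 g x)"] by simp
  qed simp
  then have "l2sq h < top" using fin by (rule le_less_trans)
  then have "has_L2_integral (\<lambda>x \<xi>. cis (- 1 * (x \<bullet> \<xi>)) * h \<xi>) (ft2 (-1) h)"
    using hint by (intro has_L2_integral_integrable) auto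
  moreover have "ft2 (-1) h = g" using hg by auto
  ultimately have "is_fourier (ft2 1 g) g"
    by (simp add: is_fourier_def h_def inner_commute)
  then show "AE \<xi> in lborel. fourier (ft2 1 g) \<xi> = g \<xi>"
    using is_fourier_fourier[OF L2] unfolding is_fourier_def
    by (intro has_L2_integral_unique[where K="\<lambda>\<xi> x. cis (- (x \<bullet> \<xi>)) * ft2 1 g x / (2 * pi)\<^sup>2"]) auto
qed

text \<open>Changing \<open>fourier f\<close> on a null set of frequencies does not affect any disc
  integral, and \<open>evo\<close> is continuous in time at every point because \<open>g\<close> is
  integrable.\<close>

lemma is_evolution_evo:
  assumes [measurable]: "P \<in> borel_measurable borel" and L2: "in_L2 f" and g: "tame g"
    and AE: "AE \<xi> in lborel. fourier f \<xi> = g \<xi>"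
  shows "is_evolution P f (evo P g)"
  unfolding is_evolution_def
proof (intro conjI ballI AE_I2 continuous_on_evo tame_integrable g)
  have [measurable]: "g \<in> borel_measurable borel" using g by (rule tame_measurable)
  have [measurable]: "fourier f \<in> borel_measurable borel"
    using is_fourier_fourier[OF L2] by (simp add: is_fourier_def has_L2_integral_def in_L2_def)
  fix t :: real
  have "has_L2_integral (\<lambda>x \<xi>. cis (1 * (x \<bullet> \<xi>)) * (cis (t * P \<xi>) * g \<xi>)) (ft2 1 (\<lambda>\<xi>. cis (t * P \<xi>) * g \<xi>))"
    using tame_integrable[OF g] tame_l2sq[OF g]
    by (intro has_L2_integral_integrable integrable_cis_mult) auto
  then have "has_L2_integral (\<lambda>x \<xi>. cis (x \<bullet> \<xi> + t * P \<xi>) * g \<xi>) (evo P g t)"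
    by (simp add: evo_def mult.assoc flip: cis_mult)
  moreover have "has_L2_integral (\<lambda>x \<xi>. cis (x \<bullet> \<xi> + t * P \<xi>) * g \<xi>) (evo P g t)
      \<longleftrightarrow> has_L2_integral (\<lambda>x \<xi>. cis (x \<bullet> \<xi> + t * P \<xi>) * fourier f \<xi>) (evo P g t)"
    by (rule has_L2_integral_cong) (measurable, use AE in eventually_elim, simp)
  ultimately show "has_L2_integral (\<lambda>x \<xi>. cis (x \<bullet> \<xi> + t * P \<xi>) * fourier f \<xi>) (evo P g t)" by simp
qed measurable

lemma ft2_product:
  assumes g: "tame (\<lambda>\<xi> :: real^2. f1 (\<xi> $ 1) * f2 (\<xi> $ 2))"
  shows "ft2 1 (\<lambda>\<xi>. f1 (\<xi> $ 1) * f2 (\<xi> $ 2)) (pt x y) = ft f1 x * ft f2 y"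
proof -
  have "ft2 1 (\<lambda>\<xi>. f1 (\<xi> $ 1) * f2 (\<xi> $ 2)) (pt x y) = ft (\<lambda>a. ft (\<lambda>b. f1 a * f2 b) y) x"
    by (subst ft2_plane[OF tame_integrable[OF g]]) simp
  also have "(\<lambda>a. ft (\<lambda>b. f1 a * f2 b) y) = (\<lambda>a. f1 a * ft f2 y)"
    unfolding ft_def by (intro ext) (simp only: mult.left_commute[of "cis _"] integral_mult_right_zero)
  also have "ft (\<lambda>a. f1 a * ft f2 y) x = ft f1 x * ft f2 y"
    unfolding ft_def[of "\<lambda>a. f1 a * ft f2 y"] ft_def[of f1]
    by (simp only: mult.assoc[symmetric] integral_mult_left_zero)
  finally show ?thesis .
qed

lemma integrable_product_plane:
  fixes f1 f2 :: "real \<Rightarrow> complex"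
  assumes f: "integrable lborel f1" "integrable lborel f2"
  shows "integrable lborel (\<lambda>\<xi> :: real^2. f1 (\<xi> $ 1) * f2 (\<xi> $ 2))"
proof -
  have [measurable]: "f1 \<in> borel_measurable borel" "f2 \<in> borel_measurable borel" using f by auto
  have "integrable (distr (lborel \<Otimes>\<^sub>M lborel) borel (\<lambda>z. pt (fst z) (snd z))) (\<lambda>\<xi>. f1 (\<xi> $ 1) * f2 (\<xi> $ 2))"
    using lborel_pair.integrable_mult_prod[OF f] by (subst integrable_distr_eq) auto
  then show ?thesis by (simp flip: lborel_plane)
qed

lemma ft2_minus_product:
  fixes f1 f2 :: "real \<Rightarrow> complex"
  assumes f: "integrable lborel f1" "integrable lborel f2"
  shows "ft2 (-1) (\<lambda>x. f1 (x $ 1) * f2 (x $ 2)) \<xi> = ft f1 (- \<xi> $ 1) * ft f2 (- \<xi> $ 2)"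
proof -
  have [measurable]: "f1 \<in> borel_measurable borel" "f2 \<in> borel_measurable borel" using f by auto
  have "ft2 (-1) (\<lambda>x. f1 (x $ 1) * f2 (x $ 2)) \<xi>
    = (\<integral>a. (\<integral>b. cis (-1 * (\<xi> \<bullet> pt a b)) * (f1 (pt a b $ 1) * f2 (pt a b $ 2)) \<partial>lborel) \<partial>lborel)"
    unfolding ft2_def
    by (rule integral_plane(1)) (intro integrable_cis_mult integrable_product_plane f; measurable)
  also have "\<dots> = (\<integral>a. (\<integral>b. (cis (- \<xi> $ 1 * a) * f1 a) * (cis (- \<xi> $ 2 * b) * f2 b) \<partial>lborel) \<partial>lborel)"
  proof (intro Bochner_Integration.integral_cong refl)
    fix a b
    have "cis (-1 * (\<xi> \<bullet> pt a b)) = cis (- \<xi> $ 1 * a) * cis (- \<xi> $ 2 * b)"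
      by (simp add: inner_plane cis_mult)
    then show "cis (-1 * (\<xi> \<bullet> pt a b)) * (f1 (pt a b $ 1) * f2 (pt a b $ 2))
      = (cis (- \<xi> $ 1 * a) * f1 a) * (cis (- \<xi> $ 2 * b) * f2 b)" by simp
  qed
  also have "\<dots> = ft f1 (- \<xi> $ 1) * ft f2 (- \<xi> $ 2)"
    unfolding ft_def by (simp only: integral_mult_right_zero integral_mult_left_zero)
  finally show ?thesis .
qed

section \<open>The counterexample\<close>

text \<open>The datum has frequencies \<open>\<xi>\<^sub>1 \<in> [R, R + 1/8]\<close> and \<open>\<xi>\<^sub>2 \<in> [0, R]\<close>.  At time \<open>t = - x\<^sub>2 / R\<close> the
  phase \<open>x \<bullet> \<xi> + t (\<xi>\<^sub>1 \<xi>\<^sub>2 + h(\<xi>\<^sub>1))\<close> varies by at most \<open>1/2\<close> over this rectangle; this uses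
  \<open>h'(R) = R\<^bsup>m-1\<^esup> \<le> R\<close>, that is \<open>m \<le> 2\<close>.\<close>

definition bump :: "real \<Rightarrow> real^2 \<Rightarrow> real" where
  "bump R \<xi> = tent (R / 2) ((R + 1/8) / 2) (\<xi> $ 1) * tent 0 (R / 2) (\<xi> $ 2)"

lemma bump_nonneg: "0 \<le> bump R \<xi>"
  by (simp add: bump_def tent_nonneg)

lemma bump_support:
  assumes "bump R \<xi> \<noteq> 0"
  shows "R \<le> \<xi> $ 1" "\<xi> $ 1 \<le> R + 1/8" "0 \<le> \<xi> $ 2" "\<xi> $ 2 \<le> R"
  using assms tent_support[of "R / 2" "(R + 1/8) / 2" "\<xi> $ 1"] tent_support[of 0 "R / 2" "\<xi> $ 2"]
  by (auto simp: bump_def)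

lemma bump_measurable [measurable]: "bump R \<in> borel_measurable borel"
  unfolding bump_def[abs_def] by measurable

lemma norm_le_sum_components: "norm (\<xi> :: real^2) \<le> \<bar>\<xi> $ 1\<bar> + \<bar>\<xi> $ 2\<bar>"
  using norm_le_l1_cart[of \<xi>] by (simp add: sum_2)

lemma bump_annulus:
  assumes "R \<ge> 1" "bump R \<xi> \<noteq> 0"
  shows "R \<le> norm \<xi>" "norm \<xi> \<le> 3 * R"
  using bump_support[OF assms(2)] assms(1) component_le_norm_cart[of \<xi> 1] norm_le_sum_components[of \<xi>]
  by linarith+

lemma tame_bump:
  assumes R: "R \<ge> 1"
  shows "tame (\<lambda>\<xi>. complex_of_real (bump R \<xi>))"
proof (rule tameI)
  show "cmod (complex_of_real (bump R \<xi>)) \<le> 1 / 16 * (R / 2)" for \<xi>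
  proof -
    have "tent (R / 2) ((R + 1/8) / 2) (\<xi> $ 1) \<le> (R + 1/8) / 2 - R / 2" by (rule tent_le) simp
    also have "\<dots> = 1 / 16" by (simp add: field_simps)
    finally have "bump R \<xi> \<le> 1 / 16 * (R / 2)"
      unfolding bump_def using R tent_le[of 0 "R / 2" "\<xi> $ 2"] by (intro mult_mono tent_nonneg) auto
    then show ?thesis using bump_nonneg[of R \<xi>] by simp
  qed
  show "norm \<xi> \<le> 3 * R" if "complex_of_real (bump R \<xi>) \<noteq> 0" for \<xi>
    using bump_annulus[OF R] that by simp
qed measurable

text \<open>The factors are tents built from intervals of length \<open>1/16\<close> and
  \<open>R / 2\<close>, and the integral of a tent is the square of that length.\<close>

lemma integral_bump:
  assumes R: "R \<ge> 1"
  shows "(\<integral>\<xi>. bump R \<xi> \<partial>lborel) = (R / 32)\<^sup>2"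
proof -
  have "complex_of_real (\<integral>\<xi>. bump R \<xi> \<partial>lborel) = (\<integral>\<xi>. complex_of_real (bump R \<xi>) \<partial>lborel)"
    by (rule integral_complex_of_real[symmetric])
  also have "\<dots> = (\<integral>a. (\<integral>b. complex_of_real (bump R (pt a b)) \<partial>lborel) \<partial>lborel)"
    by (rule integral_plane(1)[OF tame_integrable[OF tame_bump[OF R]]])
  also have "\<dots> = (\<integral>a. complex_of_real (tent (R / 2) ((R + 1/8) / 2) a * (R / 2)\<^sup>2) \<partial>lborel)"
    using R by (intro Bochner_Integration.integral_cong refl)
      (subst integral_complex_of_real, simp add: bump_def integral_tent)
  also have "\<dots> = complex_of_real ((1 / 16)\<^sup>2 * (R / 2)\<^sup>2)"
    by (subst integral_complex_of_real) (simp add: integral_tent diff_divide_distrib[symmetric])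
  finally have "(\<integral>\<xi>. bump R \<xi> \<partial>lborel) = (1 / 16)\<^sup>2 * (R / 2)\<^sup>2"
    by (simp only: of_real_eq_iff)
  then show ?thesis by (simp add: power2_eq_square)
qed

lemma l2sq_bump:
  assumes R: "R \<ge> 1"
  shows "l2sq (\<lambda>\<xi>. complex_of_real (bump R \<xi>)) \<le> ennreal ((R / 32) ^ 3)"
proof -
  let ?a = "tent (R / 2) ((R + 1/8) / 2)" and ?b = "tent 0 (R / 2)"
  have "l2sq (\<lambda>\<xi>. complex_of_real (bump R \<xi>))
      = (\<integral>\<^sup>+a. (\<integral>\<^sup>+b. ennreal ((?a a)\<^sup>2) * ennreal ((?b b)\<^sup>2) \<partial>lborel) \<partial>lborel)"
  proof (subst nn_integral_plane, measurable, intro nn_integral_cong)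
    fix a b
    have "(cmod (complex_of_real (bump R (pt a b))))\<^sup>2 = (?a a)\<^sup>2 * (?b b)\<^sup>2"
      by (simp only: norm_of_real power2_abs bump_def vector_2 power_mult_distrib)
    then show "ennreal ((cmod (complex_of_real (bump R (pt a b))))\<^sup>2) = ennreal ((?a a)\<^sup>2) * ennreal ((?b b)\<^sup>2)"
      by (simp only:) (rule ennreal_mult; simp)
  qed
  also have "\<dots> = (\<integral>\<^sup>+a. ennreal ((?a a)\<^sup>2) \<partial>lborel) * (\<integral>\<^sup>+b. ennreal ((?b b)\<^sup>2) \<partial>lborel)"
    by (simp add: nn_integral_cmult nn_integral_multc)
  also have "\<dots> \<le> ennreal (((R + 1/8) / 2 - R / 2) ^ 3) * ennreal ((R / 2 - 0) ^ 3)"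
    using R by (intro mult_mono nn_integral_tent_power2) auto
  also have "\<dots> = ennreal (((R + 1/8) / 2 - R / 2) ^ 3 * (R / 2 - 0) ^ 3)"
    using R by (intro ennreal_mult[symmetric]) auto
  also have "((R + 1/8) / 2 - R / 2) ^ 3 * (R / 2 - 0) ^ 3 = (R / 32) ^ 3"
    by (simp add: diff_divide_distrib[symmetric] flip: power_mult_distrib)
  finally show ?thesis .
qed

definition datum :: "real \<Rightarrow> real^2 \<Rightarrow> complex" where
  "datum R = ft2 1 (\<lambda>\<xi>. complex_of_real (bump R \<xi>))"

text \<open>The norm occurs in a denominator, so it must be nonzero and bounded from above;
  Plancherel's inequality gives a bound of order \<open>R\<close> to the power 3/2.\<close>

lemma datum_fourier:
  assumes R: "R \<ge> 1"
  shows "in_L2 (datum R)" "AE \<xi> in lborel. fourier (datum R) \<xi> = complex_of_real (bump R \<xi>)"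
    and "L2_norm (datum R) \<noteq> 0" "L2_norm (datum R) \<le> ennreal (2 * pi * sqrt ((R / 32) ^ 3))"
proof -
  define A where "A = (\<lambda>x. complex_of_real (tent (R / 2) ((R + 1/8) / 2) x))"
  define B where "B = (\<lambda>x. complex_of_real (tent 0 (R / 2) x))"
  have bump: "(\<lambda>\<xi>. complex_of_real (bump R \<xi>)) = (\<lambda>\<xi>. A (\<xi> $ 1) * B (\<xi> $ 2))"
    by (simp add: bump_def A_def B_def)
  have tame: "tame (\<lambda>\<xi> :: real^2. A (\<xi> $ 1) * B (\<xi> $ 2))"
    using tame_bump[OF R] unfolding bump .
  have fA: "integrable lborel (ft A)" and fB: "integrable lborel (ft B)"
    unfolding A_def B_def using R by (intro integrable_ft_tent; simp)+
  have datum: "datum R = (\<lambda>x. ft A (x $ 1) * ft B (x $ 2))"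
  proof
    fix x :: "real^2"
    show "datum R x = ft A (x $ 1) * ft B (x $ 2)"
      using ft2_product[OF tame, of "x $ 1" "x $ 2"] by (simp add: datum_def bump)
  qed
  have int: "integrable lborel (datum R)"
    unfolding datum by (rule integrable_product_plane[OF fA fB])
  have inv: "ft2 (-1) (datum R) \<xi> = (2 * pi)\<^sup>2 * complex_of_real (bump R \<xi>)" for \<xi>
  proof -
    have "ft2 (-1) (datum R) \<xi> = ft (ft A) (- \<xi> $ 1) * ft (ft B) (- \<xi> $ 2)"
      unfolding datum by (rule ft2_minus_product[OF fA fB])
    also have "\<dots> = (2 * pi * A (\<xi> $ 1)) * (2 * pi * B (\<xi> $ 2))"
      unfolding A_def B_def using R by (simp add: tent_inversion)
    finally show ?thesis by (simp add: bump_def A_def B_def power2_eq_square)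
  qed
  show "in_L2 (datum R)" "AE \<xi> in lborel. fourier (datum R) \<xi> = complex_of_real (bump R \<xi>)"
    using fourier_of_inverse[OF tame_bump[OF R]] int inv unfolding datum_def by auto
  have [measurable]: "datum R \<in> borel_measurable borel" using int by auto
  show "L2_norm (datum R) \<noteq> 0"
  proof
    assume "L2_norm (datum R) = 0"
    then have "l2sq (datum R) = 0" using L2_norm_squared[of "datum R"] by simp
    then have AE0: "AE x in lborel. datum R x = 0"
      by (subst (asm) nn_integral_0_iff_AE) auto
    \<comment> \<open>Inversion would turn a datum vanishing almost everywhere into a vanishing
      bump, against the positive integral of the latter.\<close>
    have "ft2 (-1) (datum R) \<xi> = 0" for \<xi>
      unfolding ft2_def by (rule integral_eq_zero_AE) (use AE0 in eventually_elim, simp)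
    then have "bump R \<xi> = 0" for \<xi> using inv[of \<xi>] by simp
    then show False using integral_bump[OF R] R by simp
  qed
  show "L2_norm (datum R) \<le> ennreal (2 * pi * sqrt ((R / 32) ^ 3))"
  proof (rule ennreal_power2_le_imp_le)
    have "(L2_norm (datum R))\<^sup>2 \<le> ennreal ((2 * pi)\<^sup>2) * l2sq (\<lambda>\<xi>. complex_of_real (bump R \<xi>))"
      unfolding L2_norm_squared datum_def by (rule plancherel_plane_1[OF tame_integrable[OF tame_bump[OF R]]])
    also have "\<dots> \<le> ennreal ((2 * pi)\<^sup>2) * ennreal ((R / 32) ^ 3)"
      by (intro mult_left_mono l2sq_bump R) simp
    also have "\<dots> = ennreal ((2 * pi)\<^sup>2 * (R / 32) ^ 3)"
      using R by (intro ennreal_mult[symmetric]) auto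
    also have "(2 * pi)\<^sup>2 * (R / 32) ^ 3 = (2 * pi * sqrt ((R / 32) ^ 3))\<^sup>2"
      using R by (simp add: power_mult_distrib)
    also have "ennreal \<dots> = (ennreal (2 * pi * sqrt ((R / 32) ^ 3)))\<^sup>2"
      using R by (intro ennreal_power[symmetric]) auto
    finally show "(L2_norm (datum R))\<^sup>2 \<le> (ennreal (2 * pi * sqrt ((R / 32) ^ 3)))\<^sup>2" .
  qed
qed

lemma norm_cis_diff_le: "cmod (cis a - cis b) \<le> \<bar>a - b\<bar>"
proof -
  have "cis a - cis b = cis b * (cis (a - b) - 1)"
    by (simp add: right_diff_distrib cis_mult)
  then have "cmod (cis a - cis b) = cmod (cis (a - b) - 1)"
    by (simp only: norm_cis_mult)
  also have "\<dots> \<le> \<bar>a - b\<bar>"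
    using iexp_approx1[of "a - b" 0] by (simp add: cis_conv_exp)
  finally show ?thesis .
qed

text \<open>The mean value theorem over a step of length at most 1/8, where the derivative
  \<open>z powr (m - 1)\<close> is at most \<open>z \<le> 2 * R\<close>.\<close>

lemma h_real_increment:
  assumes m: "1 < m" "m < 2" and R: "R \<ge> 1" and y: "R \<le> y" "y \<le> R + 1/8"
  shows "0 \<le> h_real m y - h_real m R" "h_real m y - h_real m R \<le> R / 4"
proof -
  have eq: "h_real m y - h_real m R = (y powr m - R powr m) / m"
    using y R by (simp add: h_real_def diff_divide_distrib)
  show "0 \<le> h_real m y - h_real m R"
    unfolding eq using m y R by (auto intro!: divide_nonneg_pos powr_mono2)
  show "h_real m y - h_real m R \<le> R / 4"
  proof (cases "y = R")
    case False
    then have "R < y" using y by simp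
    then obtain z where z: "R < z" "z < y" and "y powr m - R powr m = (y - R) * (m * z powr (m - 1))"
      using MVT2[of R y "\<lambda>x. x powr m" "\<lambda>x. m * x powr (m - 1)"] R has_real_derivative_powr[of _ m] by auto
    then have "h_real m y - h_real m R = (y - R) * z powr (m - 1)"
      unfolding eq using m by simp
    also have "\<dots> \<le> 1/8 * (2 * R)"
    proof (intro mult_mono)
      have "z powr (m - 1) \<le> z powr 1" using m z R by (intro powr_mono) auto
      then show "z powr (m - 1) \<le> 2 * R" using z y R by simp
    qed (use y R in auto)
    finally show ?thesis by simp
  qed (use R in simp)
qed

text \<open>The half-plane \<open>x $ 2 < 0\<close> is the one where the time
  \<open>- x $ 2 / R\<close> is positive; \<open>norm x < 1\<close> and \<open>R \<ge> 1\<close>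
  keep it below 1. A phase within 1/2 of a constant costs at most half of the integral of the
  nonnegative bump.\<close>

lemma maximal_bump_ge:
  assumes m: "1 < m" "m < 2" and R: "R \<ge> 1" and x: "norm x < 1" "x $ 2 < 0"
  shows "ennreal ((R / 32)\<^sup>2 / 2) \<le> maximal (evo (phase (h_real m)) (\<lambda>\<xi>. complex_of_real (bump R \<xi>))) x"
proof -
  define t where "t = - x $ 2 / R"
  have x12: "\<bar>x $ 1\<bar> \<le> 1" "\<bar>x $ 2\<bar> < 1"
    using component_le_norm_cart[of x 1] component_le_norm_cart[of x 2] x by auto
  have t: "t \<in> {0<..<1}"
    using x x12 R by (auto simp: t_def divide_simps)
  define \<theta> where "\<theta> \<xi> = x \<bullet> \<xi> + t * phase (h_real m) \<xi>" for \<xi>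
  define c where "c = x $ 1 * R + t * h_real m R"
  have [measurable]: "\<theta> \<in> borel_measurable borel" unfolding \<theta>_def[abs_def] by measurable
  have osc: "\<bar>\<theta> \<xi> - c\<bar> \<le> 1/2" if "bump R \<xi> \<noteq> 0" for \<xi>
  proof -
    note s = bump_support[OF that]
    \<comment> \<open>The choice of time replaces the large term \<open>x $ 2 * \<xi> $ 2\<close> by
      one containing the factor \<open>\<xi> $ 1 - R\<close>, which is at most 1/8.\<close>
    have "\<theta> \<xi> - c = x $ 1 * (\<xi> $ 1 - R) + - (x $ 2) * (\<xi> $ 2 / R * (\<xi> $ 1 - R))
        + - (x $ 2) * ((h_real m (\<xi> $ 1) - h_real m R) / R)"
      using R by (simp add: \<theta>_def c_def t_def phase_def inner_plane field_simps)
    also have "\<bar>\<dots>\<bar> \<le> 1 * (1/8) + 1 * (1 * (1/8)) + 1 * (1/4)"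
    proof (intro order_trans[OF abs_triangle_ineq] add_mono)
      show "\<bar>x $ 1 * (\<xi> $ 1 - R)\<bar> \<le> 1 * (1/8)"
        unfolding abs_mult using x12 s by (intro mult_mono) auto
      show "\<bar>- (x $ 2) * (\<xi> $ 2 / R * (\<xi> $ 1 - R))\<bar> \<le> 1 * (1 * (1/8))"
        unfolding abs_mult using x12 s R by (intro mult_mono) auto
      have "\<bar>(h_real m (\<xi> $ 1) - h_real m R) / R\<bar> \<le> 1/4"
        using h_real_increment[OF m R s(1,2)] R by (simp add: divide_le_eq)
      then show "\<bar>- (x $ 2) * ((h_real m (\<xi> $ 1) - h_real m R) / R)\<bar> \<le> 1 * (1/4)"
        unfolding abs_mult using x12 by (intro mult_mono) auto
    qed
    finally show ?thesis by simp
  qed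
  have bi: "integrable lborel (\<lambda>\<xi>. complex_of_real (bump R \<xi>))"
    by (rule tame_integrable[OF tame_bump[OF R]])
  then have bi': "integrable lborel (bump R)" by (simp only: complex_of_real_integrable_eq)
  define G where "G = (R / 32)\<^sup>2"
  have evo: "evo (phase (h_real m)) (\<lambda>\<xi>. complex_of_real (bump R \<xi>)) t x = (\<integral>\<xi>. cis (\<theta> \<xi>) * complex_of_real (bump R \<xi>) \<partial>lborel)"
    unfolding evo_def ft2_def \<theta>_def by (simp add: mult.assoc flip: cis_mult)
  have "cmod ((\<integral>\<xi>. cis (\<theta> \<xi>) * complex_of_real (bump R \<xi>) \<partial>lborel) - cis c * complex_of_real G) \<le> G / 2"
  proof -
    have "complex_of_real G = (\<integral>\<xi>. complex_of_real (bump R \<xi>) \<partial>lborel)"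
      by (simp only: G_def integral_bump[OF R, symmetric] integral_complex_of_real)
    then have "(\<integral>\<xi>. cis (\<theta> \<xi>) * complex_of_real (bump R \<xi>) \<partial>lborel) - cis c * complex_of_real G
      = (\<integral>\<xi>. cis (\<theta> \<xi>) * complex_of_real (bump R \<xi>) - cis c * complex_of_real (bump R \<xi>) \<partial>lborel)"
      by (subst Bochner_Integration.integral_diff) (auto intro!: integrable_cis_mult bi)
    also have "cmod \<dots> \<le> (\<integral>\<xi>. cmod (cis (\<theta> \<xi>) * complex_of_real (bump R \<xi>) - cis c * complex_of_real (bump R \<xi>)) \<partial>lborel)"
      by (rule integral_norm_bound)
    also have "\<dots> \<le> (\<integral>\<xi>. 1/2 * bump R \<xi> \<partial>lborel)"
    proof (rule integral_mono)
      show "cmod (cis (\<theta> \<xi>) * complex_of_real (bump R \<xi>) - cis c * complex_of_real (bump R \<xi>)) \<le> 1/2 * bump R \<xi>" for \<xi>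
      proof (cases "bump R \<xi> = 0")
        case False
        have "cmod (cis (\<theta> \<xi>) * complex_of_real (bump R \<xi>) - cis c * complex_of_real (bump R \<xi>))
          = cmod (cis (\<theta> \<xi>) - cis c) * bump R \<xi>"
          using bump_nonneg[of R \<xi>] by (simp add: norm_mult flip: left_diff_distrib)
        also have "\<dots> \<le> 1/2 * bump R \<xi>"
          using norm_cis_diff_le[of "\<theta> \<xi>" c] osc[OF False] by (intro mult_right_mono bump_nonneg) linarith
        finally show ?thesis .
      qed simp
    qed (use bi bi' in \<open>auto intro!: integrable_norm Bochner_Integration.integrable_diff integrable_cis_mult\<close>)
    also have "\<dots> = G / 2" by (simp add: integral_bump[OF R] G_def)
    finally show ?thesis .
  qed
  then have "cmod (cis c * complex_of_real G) - G / 2 \<le> cmod (\<integral>\<xi>. cis (\<theta> \<xi>) * complex_of_real (bump R \<xi>) \<partial>lborel)"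
    using norm_triangle_ineq3[of "cis c * complex_of_real G" "\<integral>\<xi>. cis (\<theta> \<xi>) * complex_of_real (bump R \<xi>) \<partial>lborel"]
    by (simp add: norm_minus_commute del: norm_cis_mult)
  moreover have "0 \<le> G" by (simp add: G_def)
  then have "cmod (cis c * complex_of_real G) = G" by simp
  ultimately have "G / 2 \<le> cmod (evo (phase (h_real m)) (\<lambda>\<xi>. complex_of_real (bump R \<xi>)) t x)"
    unfolding evo by linarith
  then have "ennreal (G / 2) \<le> ennreal (cmod (evo (phase (h_real m)) (\<lambda>\<xi>. complex_of_real (bump R \<xi>)) t x))"
    by (rule ennreal_leI)
  also have "\<dots> \<le> maximal (evo (phase (h_real m)) (\<lambda>\<xi>. complex_of_real (bump R \<xi>))) x"
    unfolding maximal_def using t by (rule SUP_upper)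
  finally show ?thesis by (simp add: G_def)
qed

lemma filterlim_powr_at_top:
  fixes a :: real
  assumes "a > 0"
  shows "filterlim (\<lambda>x. x powr a) at_top at_top"
proof (rule filterlim_cong[THEN iffD1, OF refl refl])
  show "\<forall>\<^sub>F x in at_top. exp (a * ln x) = x powr a"
    using eventually_gt_at_top[of 0] by eventually_elim (simp add: powr_def)
  show "filterlim (\<lambda>x. exp (a * ln x)) at_top at_top"
    by (rule filterlim_compose[OF exp_at_top filterlim_tendsto_pos_mult_at_top[OF tendsto_const assms ln_at_top]])
qed

text \<open>Counting powers of \<open>R\<close>: the maximal function is at least of order 2 on a
  fixed set and the norm of the datum at most of order 3/2, so with \<open>R powr (- s)\<close> the
  quotient grows at least like \<open>R powr (1/2 - s)\<close>.\<close>

lemma datum_ratio_tendsto: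
  assumes m: "1 < m" "m < 2" and s: "s < 1/2"
  shows "((\<lambda>R. ennreal (R powr (- s)) * L1_norm_on (ball 0 1)
      (maximal (evo (phase (h_real m)) (\<lambda>\<xi>. complex_of_real (bump R \<xi>)))) / L2_norm (datum R)) \<longlongrightarrow> \<infinity>) at_top"
proof -
  let ?M = "\<lambda>R. maximal (evo (phase (h_real m)) (\<lambda>\<xi>. complex_of_real (bump R \<xi>)))"
  \<comment> \<open>A fixed ball inside the unit ball and the lower half-plane, where
    \<open>maximal_bump_ge\<close> applies for every \<open>R \<ge> 1\<close>.\<close>
  define S where "S = ball (pt 0 (-1/2)) (1/2)"
  define \<kappa> where "\<kappa> = measure lborel S"
  have emS: "emeasure lborel S = ennreal \<kappa>"
    unfolding \<kappa>_def using emeasure_bounded_finite[of S]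
    by (intro emeasure_eq_ennreal_measure) (auto simp: S_def)
  have \<kappa>: "\<kappa> > 0" unfolding \<kappa>_def S_def by (rule content_ball_pos) simp
  have S: "norm x < 1 \<and> x $ 2 < 0" if "x \<in> S" for x
  proof -
    have d: "norm (x - pt 0 (-1/2)) < 1/2" using that by (simp add: S_def dist_norm norm_minus_commute)
    have "norm (pt 0 (-1/2)) \<le> 1/2" using norm_le_sum_components[of "pt 0 (-1/2)"] by simp
    then have "norm x < 1" using norm_triangle_ineq[of "x - pt 0 (-1/2)" "pt 0 (-1/2)"] d by simp
    moreover have "x $ 2 < 0" using component_le_norm_cart[of "x - pt 0 (-1/2)" 2] d by simp
    ultimately show ?thesis by simp
  qed
  \<comment> \<open>With \<open>y = R / 32\<close>, the quotient of
    \<open>y\<^sup>2 / 2 * \<kappa>\<close> by \<open>2 * pi * sqrt (y ^ 3)\<close> is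
    \<open>\<kappa> * sqrt y / (4 * pi)\<close>, and \<open>sqrt y\<close> contributes
    \<open>sqrt 32\<close>.\<close>
  define c where "c = \<kappa> / (4 * pi * sqrt 32)"
  have c: "c > 0" using \<kappa> by (simp add: c_def)
  have "filterlim (\<lambda>R. c * R powr (1/2 - s)) at_top at_top"
    using s by (intro filterlim_tendsto_pos_mult_at_top[OF tendsto_const c] filterlim_powr_at_top) simp
  then have lim: "((\<lambda>R. ennreal (c * R powr (1/2 - s))) \<longlongrightarrow> \<infinity>) at_top"
    by (simp add: ennreal_tendsto_top_eq_at_top infinity_ennreal_def)
  have le: "ennreal (c * R powr (1/2 - s)) \<le> ennreal (R powr (- s)) * L1_norm_on (ball 0 1) (?M R) / L2_norm (datum R)"
    if R: "R \<ge> 1" for R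
  proof -
    define y where "y = R / 32"
    have y: "y > 0" using R by (simp add: y_def)
    have "ennreal (y\<^sup>2 / 2) * ennreal \<kappa> = (\<integral>\<^sup>+x. ennreal (y\<^sup>2 / 2) * indicator S x \<partial>lborel)"
      by (subst nn_integral_cmult_indicator) (simp_all add: emS, simp add: S_def)
    also have "\<dots> \<le> L1_norm_on (ball 0 1) (?M R)"
      unfolding L1_norm_on_def
    proof (rule nn_integral_mono)
      fix x
      show "ennreal (y\<^sup>2 / 2) * indicator S x \<le> ?M R x * indicator (ball 0 1) x"
        using maximal_bump_ge[OF m R, of x] S[of x] by (cases "x \<in> S") (auto simp: y_def)
    qed
    finally have L1: "ennreal (y\<^sup>2 / 2 * \<kappa>) \<le> L1_norm_on (ball 0 1) (?M R)"
      using \<kappa> by (simp only: ennreal_mult[of "y\<^sup>2 / 2" \<kappa>] divide_nonneg_nonneg zero_le_power2 zero_le_numeral less_imp_le)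
    have "L2_norm (datum R) \<noteq> top"
      using datum_fourier(4)[OF R] by (auto simp: top_unique)
    then obtain l where l: "L2_norm (datum R) = ennreal l" "l \<ge> 0" by (metis ennreal_cases)
    then have l0: "l > 0" using datum_fourier(3)[OF R] by (cases "l = 0") auto
    have lL: "l \<le> 2 * pi * sqrt (y ^ 3)"
      using datum_fourier(4)[OF R] l y unfolding y_def[symmetric] by (simp add: ennreal_le_iff)
    have "c * R powr (1/2 - s) = R powr (- s) * (y\<^sup>2 / 2 * \<kappa>) / (2 * pi * sqrt (y ^ 3))"
    proof -
      have R1: "R powr (1/2 - s) = R powr (- s) * sqrt R"
        using R by (simp add: powr_half_sqrt[symmetric] flip: powr_add)
      have y1: "y\<^sup>2 / sqrt (y ^ 3) = sqrt y"
      proof -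
        have "sqrt y * sqrt (y ^ 3) = sqrt ((y\<^sup>2)\<^sup>2)"
          by (simp add: real_sqrt_mult[symmetric] power2_eq_square power3_eq_cube mult_ac)
        then have "sqrt y * sqrt (y ^ 3) = y\<^sup>2" by (simp only: real_sqrt_abs abs_power2)
        then show ?thesis using y by (simp add: divide_eq_eq)
      qed
      have "R powr (- s) * (y\<^sup>2 / 2 * \<kappa>) / (2 * pi * sqrt (y ^ 3)) = R powr (- s) * \<kappa> / (4 * pi) * (y\<^sup>2 / sqrt (y ^ 3))"
        by (simp add: mult_ac)
      also have "\<dots> = R powr (- s) * \<kappa> / (4 * pi) * (sqrt R / sqrt 32)"
        unfolding y1 by (simp add: y_def real_sqrt_divide)
      also have "\<dots> = c * R powr (1/2 - s)"
        unfolding R1 c_def by simp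
      finally show ?thesis by simp
    qed
    also have "\<dots> \<le> R powr (- s) * (y\<^sup>2 / 2 * \<kappa>) / l"
      using lL l0 \<kappa> by (intro divide_left_mono) auto
    finally have "ennreal (c * R powr (1/2 - s)) \<le> ennreal (R powr (- s) * (y\<^sup>2 / 2 * \<kappa>) / l)"
      by (rule ennreal_leI)
    also have "\<dots> = ennreal (R powr (- s)) * ennreal (y\<^sup>2 / 2 * \<kappa>) / ennreal l"
      using l0 \<kappa> by (simp add: divide_ennreal flip: ennreal_mult)
    also have "\<dots> \<le> ennreal (R powr (- s)) * L1_norm_on (ball 0 1) (?M R) / L2_norm (datum R)"
      unfolding l(1) by (intro divide_right_mono_ennreal mult_left_mono L1) simp
    finally show ?thesis .
  qed
  show ?thesis
  proof (rule tendsto_sandwich[OF _ _ lim tendsto_const])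
    show "\<forall>\<^sub>F R in at_top. ennreal (c * R powr (1/2 - s)) \<le> ennreal (R powr (- s)) * L1_norm_on (ball 0 1) (?M R) / L2_norm (datum R)"
      using eventually_ge_at_top[of 1] by eventually_elim (rule le)
    show "\<forall>\<^sub>F R in at_top. ennreal (R powr (- s)) * L1_norm_on (ball 0 1) (?M R) / L2_norm (datum R) \<le> \<infinity>"
      by simp
  qed
qed

text \<open>The existence clauses keep the bounds over all evolutions from being vacuous. The
  constants of the annulus are quantified before \<open>m\<close> and \<open>s\<close>, so they are
  absolute.\<close>

theorem theorem1p3:
  shows
    "(\<forall>m::nat. m \<ge> 1 \<longrightarrow> (\<forall>s::real. s > 1/2 \<longrightarrow>
        (\<exists>C::real. C > 0 \<and> (\<forall>f. in_sobolev s f \<longrightarrow>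
           (\<exists>u. is_evolution (phase (h_nat m)) f u) \<and>
           (\<forall>u. is_evolution (phase (h_nat m)) f u \<longrightarrow>
              L2_norm_on (ball 0 1) (maximal u) \<le> ennreal C * sobolev_norm s f)))))
   \<and> (\<forall>m::real. 1 < m \<and> m < 2 \<longrightarrow> (\<forall>s::real. s > 1/2 \<longrightarrow>
        (\<exists>C::real. C > 0 \<and> (\<forall>f. in_sobolev s f \<longrightarrow>
           (\<exists>u. is_evolution (phase (h_real m)) f u) \<and>
           (\<forall>u. is_evolution (phase (h_real m)) f u \<longrightarrow>
              L2_norm_on (ball 0 1) (maximal u) \<le> ennreal C * sobolev_norm s f)))))
   \<and> (\<exists>c1 c2 :: real. 0 < c1 \<and> c1 < c2 \<and>
        (\<forall>m::real. 1 < m \<and> m < 2 \<longrightarrow> (\<forall>s::real. s < 1/2 \<longrightarrow>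
           (\<exists>(R0::real) (f :: real \<Rightarrow> real^2 \<Rightarrow> complex) (u :: real \<Rightarrow> real \<Rightarrow> real^2 \<Rightarrow> complex).
              (\<forall>R\<ge>R0. in_L2 (f R) \<and> L2_norm (f R) \<noteq> 0
                 \<and> (AE \<xi> in lborel. fourier (f R) \<xi> \<noteq> 0 \<longrightarrow> c1 * R \<le> norm \<xi> \<and> norm \<xi> \<le> c2 * R)
                 \<and> is_evolution (phase (h_real m)) (f R) (u R))
            \<and> ((\<lambda>R. ennreal (R powr (- s)) * L1_norm_on (ball 0 1) (maximal (u R)) / L2_norm (f R))
                 \<longlongrightarrow> \<infinity>) at_top))))"
proof (intro conjI, goal_cases)
  case 1
  show ?case
    by (intro allI impI maximal_estimate good_region_h_nat phase_measurable h_nat_measurable) auto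
next
  case 2
  show ?case
    by (intro allI impI maximal_estimate good_region_h_real phase_measurable h_real_measurable) auto
next
  case 3
  show ?case
  \<comment> \<open>The annulus constants are those of \<open>bump_annulus\<close>: the first
    frequency is at least \<open>R\<close>, and the two components add up to at most
    \<open>3 * R\<close>.\<close>
  proof (rule exI[of _ 1], rule exI[of _ 3], intro conjI allI impI, goal_cases)
    case (3 m s)
    let ?u = "\<lambda>R. evo (phase (h_real m)) (\<lambda>\<xi>. complex_of_real (bump R \<xi>))"
    have "in_L2 (datum R) \<and> L2_norm (datum R) \<noteq> 0
        \<and> (AE \<xi> in lborel. fourier (datum R) \<xi> \<noteq> 0 \<longrightarrow> 1 * R \<le> norm \<xi> \<and> norm \<xi> \<le> 3 * R)
        \<and> is_evolution (phase (h_real m)) (datum R) (?u R)" if R: "R \<ge> 1" for R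
    proof (intro conjI)
      show "AE \<xi> in lborel. fourier (datum R) \<xi> \<noteq> 0 \<longrightarrow> 1 * R \<le> norm \<xi> \<and> norm \<xi> \<le> 3 * R"
        using datum_fourier(2)[OF R] by eventually_elim (use bump_annulus[OF R] in auto)
      show "is_evolution (phase (h_real m)) (datum R) (?u R)"
        using datum_fourier(1,2)[OF R] tame_bump[OF R] by (intro is_evolution_evo) auto
    qed (use datum_fourier[OF R] in auto)
    moreover have "((\<lambda>R. ennreal (R powr (- s)) * L1_norm_on (ball 0 1) (maximal (?u R)) / L2_norm (datum R))
        \<longlongrightarrow> \<infinity>) at_top"
      using 3 by (intro datum_ratio_tendsto) auto
    ultimately show ?case
      by (intro exI[of _ 1] exI[of _ datum] exI[of _ ?u]) blast
  qed auto
qed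

end
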